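(* Let $g$ be a Ricci-flat Riemannian metric of type D on a four-manifold, let $\dot g$ be a Ricci-flat perturbation of $g$, and let $(l,\overline l,m,\overline m)$ be an adapted tetrad for $g$. Then, with $D,\Delta,\delta,\tilde\delta$ the tetrad derivative operators and Greek letters the spin coefficients of this tetrad, the perturbation $\dot\Psi_0$ satisfies $$\Big((D-3\epsilon+\tilde\epsilon-\tilde\rho-4\rho)(\Delta-4\gamma+\mu)-(\delta-\tilde\alpha-3\beta+\tilde\pi-4\tau)(\tilde\delta-4\alpha+\pi)-3\Psi_2\Big)\dot\Psi_0=0,$$ and the perturbation $\dot{\tilde\Psi}_0$ satisfies $$\Big((D-3\tilde\epsilon+\epsilon-\rho-4\tilde\rho)(\Delta-4\tilde\gamma+\tilde\mu)-(\tilde\delta-\alpha-3\tilde\beta+\pi-4\tilde\tau)(\delta-4\tilde\alpha+\tilde\pi)-3\tilde\Psi_2\Big)\dot{\tilde\Psi}_0=0.$$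
   Context: **Tetrads.** A tetrad for $g$ is a (locally defined) smooth frame of complex vector fields $(l,\overline l,m,\overline m)$, where bars denote complex conjugates, with $g(l,\overline l)=g(m,\overline m)=1$ and all other inner products zero ($g$ extended complex-bilinearly). As first-order differential operators on functions, $D=l$, $\Delta=\overline l$, $\delta=m$, $\tilde\delta=-\overline m$ (note the minus sign). In the operator products in the claim, scalars act by multiplication. **Spin coefficients.** With $\nabla$ the Levi-Civita connection and indices lowered with $g$, the spin coefficients are the scalar functions defined by $$\tfrac12(\overline l^a\nabla_bl_a-m^a\nabla_b\overline m_a)=\gamma l_b+\epsilon\overline l_b-\alpha m_b+\beta\overline m_b,$$ $$\overline l^a\nabla_b\overline m_a=-\nu l_b-\pi\overline l_b+\lambda m_b-\mu\overline m_b,$$ $$m^a\nabla_bl_a=\tau l_b+\kappa\overline l_b-\rho m_b+\sigma\overline m_b,$$ $$\tfrac12(\overline l^a\nabla_bl_a-\overline m^a\nabla_bm_a)=\tilde\gamma l_b+\tilde\epsilon\overline l_b-\tilde\beta m_b+\tilde\alpha\overline m_b,$$ $$\overline l^a\nabla_bm_a=\tilde\nu l_b+\tilde\pi\overline l_b-\tilde\mu m_b+\tilde\lambda\overline m_b,$$ $$\overline m^a\nabla_bl_a=-\tilde\tau l_b-\tilde\kappa\overline l_b+\tilde\sigma m_b-\tilde\rho\overline m_b.$$ **Weyl scalars.** Let $W$ be the $(0,4)$ Weyl tensor, extended complex-multilinearly, with sign convention that the Riemann tensor is $R(X,Y,Z,T)=g(\nabla_X\nabla_YZ-\nabla_Y\nabla_XZ-\nabla_{[X,Y]}Z,\,T)$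 (so $R(X,Y,Y,X)$ is the sectional curvature for orthonormal $X,Y$). Set $$\Psi_0=-W(l,m,l,m),\quad \Psi_1=-W(l,\overline l,l,m),\quad \Psi_2=W(l,m,\overline l,\overline m),$$ $$\tilde\Psi_0=-W(l,\overline m,l,\overline m),\quad \tilde\Psi_1=-W(l,\overline l,l,\overline m),\quad \tilde\Psi_2=W(l,\overline m,\overline l,m).$$ The tetrad is adapted if $\Psi_0=\Psi_1=\tilde\Psi_0=\tilde\Psi_1=0$ and $\Psi_2,\tilde\Psi_2\neq0$. A Ricci-flat four-manifold is of type D (Petrov type $\mathrm D^+\mathrm D^-$) if and only if it admits adapted tetrads. **Perturbations.** A perturbation of $g$ is a smooth symmetric two-tensor $\dot g$; it is Ricci-flat if it lies in the kernel of the linearization of $g\mapsto\operatorname{Ric}_g$ at $g$. A dot denotes the derivative in the direction $\dot g$: $\dot\Psi_0=\frac{d}{ds}|_{s=0}\big(-W_{g_s}(l_s,m_s,l_s,m_s)\big)$ with $g_s=g+s\dot g$ and $(l_s,\overline{l_s},m_s,\overline{m_s})$ a smooth family of tetrads for $g_s$ equal to the given adapted tetrad at $s=0$; this does not depend on the choice of family. $\dot{\tilde\Psi}_0$ is defined in the same way from $\tilde\Psi_0$. In the equations, all undotted quantities are those of the unperturbed metric $g$ and its adapted tetrad. *)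

theory Defs
  imports "HOL-Analysis.Analysis"
begin

section \<open>Smooth maps between Euclidean spaces\<close>

definition partial :: "'n::finite \<Rightarrow> (real^'n \<Rightarrow> 'b::real_normed_vector) \<Rightarrow> real^'n \<Rightarrow> 'b" where
  "partial i f x = frechet_derivative f (at x) (axis i 1)"

primrec Ck_on :: "nat \<Rightarrow> 'a::euclidean_space set \<Rightarrow> ('a \<Rightarrow> 'b::real_normed_vector) \<Rightarrow> bool" where
  "Ck_on 0 S f \<longleftrightarrow> continuous_on S f"
| "Ck_on (Suc k) S f \<longleftrightarrow>
     f differentiable_on S \<and> (\<forall>v\<in>Basis. Ck_on k S (\<lambda>x. frechet_derivative f (at x) v))"

definition smooth_on :: "'a::euclidean_space set \<Rightarrow> ('a \<Rightarrow> 'b::real_normed_vector) \<Rightarrow> bool" where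
  "smooth_on S f \<longleftrightarrow> open S \<and> (\<forall>k. Ck_on k S f)"


section \<open>Smooth four-manifolds and tensor fields on them\<close>

type_synonym 'a chart = "'a set \<times> ('a \<Rightarrow> real^4)"

definition is_chart :: "'a topology \<Rightarrow> 'a chart \<Rightarrow> bool" where
  "is_chart X c \<longleftrightarrow> openin X (fst c) \<and> open (snd c ` fst c) \<and>
     homeomorphic_map (subtopology X (fst c)) (top_of_set (snd c ` fst c)) (snd c)"

text \<open>The coordinate region of the part of \<open>S\<close> that is covered by the chart \<open>c\<close>.\<close>

definition region :: "'a chart \<Rightarrow> 'a set \<Rightarrow> (real^4) set" where
  "region c S = snd c ` (fst c \<inter> S)"

definition transition :: "'a chart \<Rightarrow> 'a chart \<Rightarrow> real^4 \<Rightarrow> real^4" where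
  "transition c c' = snd c' \<circ> inv_into (fst c) (snd c)"

definition jacobian :: "'a chart \<Rightarrow> 'a chart \<Rightarrow> real^4 \<Rightarrow> real^4^4" where
  "jacobian c c' x = matrix (frechet_derivative (transition c c') (at x))"

definition smooth_four_manifold :: "'a topology \<Rightarrow> 'a chart set \<Rightarrow> bool" where
  "smooth_four_manifold X A \<longleftrightarrow>
     Hausdorff_space X \<and> second_countable X \<and>
     (\<forall>c\<in>A. is_chart X c) \<and> topspace X = (\<Union>c\<in>A. fst c) \<and>
     (\<forall>c\<in>A. \<forall>c'\<in>A. smooth_on (region c (fst c')) (transition c c'))"

text \<open>A tensor field assigns to every chart of the atlas its components, as functions of the
  coordinates of that chart; the components in different charts are related by the tensor
  transformation law. Values outside the coordinate region are irrelevant.\<close>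

type_synonym 'a tensor2 = "'a chart \<Rightarrow> real^4 \<Rightarrow> real^4^4"
type_synonym 'a cvector_field = "'a chart \<Rightarrow> real^4 \<Rightarrow> complex^4"

definition smooth_symmetric_tensor :: "'a chart set \<Rightarrow> 'a tensor2 \<Rightarrow> bool" where
  "smooth_symmetric_tensor A h \<longleftrightarrow>
     (\<forall>c\<in>A. smooth_on (region c UNIV) (h c)) \<and>
     (\<forall>c\<in>A. \<forall>x\<in>region c UNIV. transpose (h c x) = h c x) \<and>
     (\<forall>c\<in>A. \<forall>c'\<in>A. \<forall>x\<in>region c (fst c').
        h c x = transpose (jacobian c c' x) ** h c' (transition c c' x) ** jacobian c c' x)"

definition riemannian_metric :: "'a chart set \<Rightarrow> 'a tensor2 \<Rightarrow> bool" where
  "riemannian_metric A g \<longleftrightarrow> smooth_symmetric_tensor A g \<and>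
     (\<forall>c\<in>A. \<forall>x\<in>region c UNIV. \<forall>v. v \<noteq> 0 \<longrightarrow> v \<bullet> (g c x *v v) > 0)"

definition smooth_cvector_field :: "'a chart set \<Rightarrow> 'a set \<Rightarrow> 'a cvector_field \<Rightarrow> bool" where
  "smooth_cvector_field A V l \<longleftrightarrow>
     (\<forall>c\<in>A. smooth_on (region c V) (l c)) \<and>
     (\<forall>c\<in>A. \<forall>c'\<in>A. \<forall>x\<in>region c (fst c' \<inter> V). \<forall>i.
        l c' (transition c c' x) $ i = (\<Sum>j\<in>UNIV. of_real (jacobian c c' x $ i $ j) * l c x $ j))"


section \<open>Levi-Civita connection and curvature in coordinates\<close>

text \<open>In this section and in those on spin coefficients and Weyl scalars, \<open>g\<close>, \<open>X\<close>, \<open>Y\<close>, ...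
  are component functions in one coordinate system. Vector fields may be real or complex;
  \<open>g\<close> is extended bilinearly (not sesquilinearly).\<close>

definition inner_g :: "real^4^4 \<Rightarrow> 'k::real_normed_field^4 \<Rightarrow> 'k^4 \<Rightarrow> 'k" where
  "inner_g G u v = (\<Sum>i\<in>UNIV. \<Sum>j\<in>UNIV. of_real (G $ i $ j) * u $ i * v $ j)"

definition lower :: "real^4^4 \<Rightarrow> 'k::real_normed_field^4 \<Rightarrow> 'k^4" where
  "lower G u = (\<chi> b. \<Sum>a\<in>UNIV. of_real (G $ a $ b) * u $ a)"

definition coord_field :: "4 \<Rightarrow> real^4 \<Rightarrow> 'k::real_normed_field^4" where
  "coord_field i = (\<lambda>x. axis i 1)"

definition christoffel :: "(real^4 \<Rightarrow> real^4^4) \<Rightarrow> 4 \<Rightarrow> 4 \<Rightarrow> 4 \<Rightarrow> real^4 \<Rightarrow> real" where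
  "christoffel g k i j x = (\<Sum>n\<in>UNIV. matrix_inv (g x) $ k $ n *
     (partial i (\<lambda>y. g y $ j $ n) x + partial j (\<lambda>y. g y $ i $ n) x
       - partial n (\<lambda>y. g y $ i $ j) x)) / 2"

definition nabla :: "(real^4 \<Rightarrow> real^4^4) \<Rightarrow> (real^4 \<Rightarrow> 'k::real_normed_field^4) \<Rightarrow>
    (real^4 \<Rightarrow> 'k^4) \<Rightarrow> real^4 \<Rightarrow> 'k^4" where
  "nabla g X Y x = (\<chi> a. \<Sum>b\<in>UNIV. X x $ b *
     (partial b (\<lambda>y. Y y $ a) x + (\<Sum>c\<in>UNIV. of_real (christoffel g a b c x) * Y x $ c)))"

definition lie_bracket :: "(real^4 \<Rightarrow> 'k::real_normed_field^4) \<Rightarrow> (real^4 \<Rightarrow> 'k^4) \<Rightarrow>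
    real^4 \<Rightarrow> 'k^4" where
  "lie_bracket X Y x = (\<chi> a. \<Sum>b\<in>UNIV.
     X x $ b * partial b (\<lambda>y. Y y $ a) x - Y x $ b * partial b (\<lambda>y. X y $ a) x)"

definition riemann :: "(real^4 \<Rightarrow> real^4^4) \<Rightarrow> (real^4 \<Rightarrow> real^4) \<Rightarrow> (real^4 \<Rightarrow> real^4) \<Rightarrow>
    (real^4 \<Rightarrow> real^4) \<Rightarrow> (real^4 \<Rightarrow> real^4) \<Rightarrow> real^4 \<Rightarrow> real" where
  "riemann g X Y Z T x = inner_g (g x)
     (nabla g X (nabla g Y Z) x - nabla g Y (nabla g X Z) x - nabla g (lie_bracket X Y) Z x) (T x)"

definition riemann_comp :: "(real^4 \<Rightarrow> real^4^4) \<Rightarrow> real^4 \<Rightarrow> 4 \<Rightarrow> 4 \<Rightarrow> 4 \<Rightarrow> 4 \<Rightarrow> real" where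
  "riemann_comp g x i j k t =
     riemann g (coord_field i) (coord_field j) (coord_field k) (coord_field t) x"

definition ricci :: "(real^4 \<Rightarrow> real^4^4) \<Rightarrow> real^4 \<Rightarrow> real^4^4" where
  "ricci g x = (\<chi> j k. \<Sum>a\<in>UNIV. \<Sum>b\<in>UNIV. matrix_inv (g x) $ a $ b * riemann_comp g x a j k b)"

definition scalar_curvature :: "(real^4 \<Rightarrow> real^4^4) \<Rightarrow> real^4 \<Rightarrow> real" where
  "scalar_curvature g x = (\<Sum>a\<in>UNIV. \<Sum>b\<in>UNIV. matrix_inv (g x) $ a $ b * ricci g x $ a $ b)"

text \<open>With the present sign convention a metric of constant curvature \<open>K\<close> has
  \<open>R\<^sub>i\<^sub>j\<^sub>k\<^sub>t = K (g\<^sub>i\<^sub>t g\<^sub>j\<^sub>k - g\<^sub>i\<^sub>k g\<^sub>j\<^sub>t)\<close>; the coefficients below are those of dimension four.\<close>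

definition weyl_comp :: "(real^4 \<Rightarrow> real^4^4) \<Rightarrow> real^4 \<Rightarrow> 4 \<Rightarrow> 4 \<Rightarrow> 4 \<Rightarrow> 4 \<Rightarrow> real" where
  "weyl_comp g x i j k t = riemann_comp g x i j k t
     - (g x $ i $ t * ricci g x $ j $ k - g x $ i $ k * ricci g x $ j $ t
        + g x $ j $ k * ricci g x $ i $ t - g x $ j $ t * ricci g x $ i $ k) / 2
     + scalar_curvature g x / 6 * (g x $ i $ t * g x $ j $ k - g x $ i $ k * g x $ j $ t)"

definition weyl :: "(real^4 \<Rightarrow> real^4^4) \<Rightarrow> real^4 \<Rightarrow>
    complex^4 \<Rightarrow> complex^4 \<Rightarrow> complex^4 \<Rightarrow> complex^4 \<Rightarrow> complex" where
  "weyl g x u v w z = (\<Sum>i\<in>UNIV. \<Sum>j\<in>UNIV. \<Sum>k\<in>UNIV. \<Sum>t\<in>UNIV.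
     of_real (weyl_comp g x i j k t) * u $ i * v $ j * w $ k * z $ t)"

definition ricci_flat :: "'a chart set \<Rightarrow> 'a tensor2 \<Rightarrow> bool" where
  "ricci_flat A g \<longleftrightarrow> (\<forall>c\<in>A. \<forall>x\<in>region c UNIV. ricci (g c) x = 0)"


section \<open>Perturbations\<close>

definition perturbed ::
    "(real^4 \<Rightarrow> real^4^4) \<Rightarrow> (real^4 \<Rightarrow> real^4^4) \<Rightarrow> real \<Rightarrow> real^4 \<Rightarrow> real^4^4" where
  "perturbed g h s = (\<lambda>x. g x + s *\<^sub>R h x)"

definition linearized_ricci ::
    "(real^4 \<Rightarrow> real^4^4) \<Rightarrow> (real^4 \<Rightarrow> real^4^4) \<Rightarrow> real^4 \<Rightarrow> real^4^4" where
  "linearized_ricci g h x = vector_derivative (\<lambda>s. ricci (perturbed g h s) x) (at 0)"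

definition ricci_flat_perturbation :: "'a chart set \<Rightarrow> 'a tensor2 \<Rightarrow> 'a tensor2 \<Rightarrow> bool" where
  "ricci_flat_perturbation A g h \<longleftrightarrow> smooth_symmetric_tensor A h \<and>
     (\<forall>c\<in>A. \<forall>x\<in>region c UNIV. linearized_ricci (g c) (h c) x = 0)"


section \<open>Tetrads\<close>

definition conj_vec :: "complex^4 \<Rightarrow> complex^4" where
  "conj_vec u = (\<chi> i. cnj (u $ i))"

definition tetrad_at :: "real^4^4 \<Rightarrow> complex^4 \<Rightarrow> complex^4 \<Rightarrow> bool" where
  "tetrad_at G u v \<longleftrightarrow>
     inner_g G u (conj_vec u) = 1 \<and> inner_g G v (conj_vec v) = 1 \<and>
     inner_g G u u = 0 \<and> inner_g G (conj_vec u) (conj_vec u) = 0 \<and>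
     inner_g G v v = 0 \<and> inner_g G (conj_vec v) (conj_vec v) = 0 \<and>
     inner_g G u v = 0 \<and> inner_g G u (conj_vec v) = 0 \<and>
     inner_g G (conj_vec u) v = 0 \<and> inner_g G (conj_vec u) (conj_vec v) = 0"

text \<open>A tetrad \<open>(l, conj l, m, conj m)\<close> on the open set \<open>V\<close> is determined by \<open>l\<close> and \<open>m\<close>;
  the inner products make the four fields linearly independent at each point of \<open>V\<close>.\<close>

definition tetrad :: "'a topology \<Rightarrow> 'a chart set \<Rightarrow> 'a tensor2 \<Rightarrow> 'a set \<Rightarrow>
    'a cvector_field \<Rightarrow> 'a cvector_field \<Rightarrow> bool" where
  "tetrad X A g V l m \<longleftrightarrow> openin X V \<and>
     smooth_cvector_field A V l \<and> smooth_cvector_field A V m \<and>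
     (\<forall>c\<in>A. \<forall>x\<in>region c V. tetrad_at (g c x) (l c x) (m c x))"

text \<open>The tetrads for \<open>g + s h\<close> are defined on the slices of an open neighbourhood \<open>N\<close> of
  \<open>{0} \<times> V\<close>: in general \<open>g + s h\<close> is positive definite only for \<open>s\<close> in an interval that depends
  on the point of \<open>V\<close>.\<close>

definition tetrad_family :: "'a topology \<Rightarrow> 'a chart set \<Rightarrow> 'a tensor2 \<Rightarrow> 'a tensor2 \<Rightarrow> 'a set \<Rightarrow>
    'a cvector_field \<Rightarrow> 'a cvector_field \<Rightarrow>
    (real \<Rightarrow> 'a cvector_field) \<Rightarrow> (real \<Rightarrow> 'a cvector_field) \<Rightarrow> bool" where
  "tetrad_family X A g h V l m ls ms \<longleftrightarrow>
     (\<exists>N. openin (prod_topology euclideanreal X) N \<and> {0} \<times> V \<subseteq> N \<and>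
        (\<forall>s. tetrad X A (\<lambda>c. perturbed (g c) (h c) s) {p. (s, p) \<in> N} (ls s) (ms s)) \<and>
        (\<forall>c\<in>A. smooth_on {(s, x). x \<in> region c {p. (s, p) \<in> N}} (\<lambda>(s, x). ls s c x)) \<and>
        (\<forall>c\<in>A. smooth_on {(s, x). x \<in> region c {p. (s, p) \<in> N}} (\<lambda>(s, x). ms s c x))) \<and>
     (\<forall>c\<in>A. \<forall>x\<in>region c V. ls 0 c x = l c x \<and> ms 0 c x = m c x)"

definition deriv_along ::
    "(real^4 \<Rightarrow> complex^4) \<Rightarrow> (real^4 \<Rightarrow> complex) \<Rightarrow> real^4 \<Rightarrow> complex" where
  "deriv_along v f x = (\<Sum>i\<in>UNIV. v x $ i * partial i f x)"

text \<open>The sum of a differential operator and multiplication by a scalar.\<close>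

definition plus_scalar :: "((real^4 \<Rightarrow> complex) \<Rightarrow> real^4 \<Rightarrow> complex) \<Rightarrow> (real^4 \<Rightarrow> complex) \<Rightarrow>
    (real^4 \<Rightarrow> complex) \<Rightarrow> real^4 \<Rightarrow> complex" (infixl "\<boxplus>" 65) where
  "(P \<boxplus> a) f x = P f x + a x * f x"


section \<open>Spin coefficients\<close>

text \<open>\<open>conn g u v b x\<close> is \<open>u\<^sup>a \<nabla>\<^sub>b v\<^sub>a\<close>, the lowering of indices being parallel.\<close>

definition conn :: "(real^4 \<Rightarrow> real^4^4) \<Rightarrow> (real^4 \<Rightarrow> complex^4) \<Rightarrow> (real^4 \<Rightarrow> complex^4) \<Rightarrow>
    4 \<Rightarrow> real^4 \<Rightarrow> complex" where
  "conn g u v b x = inner_g (g x) (u x) (nabla g (coord_field b) v x)"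

text \<open>A trailing \<open>t\<close> stands for a tilde.\<close>

definition spin_coefficients where
  "spin_coefficients g l m S \<gamma> \<epsilon> \<alpha> \<beta> \<nu> \<pi> lam \<mu> \<tau> \<kappa> \<rho> \<sigma>
     \<gamma>t \<epsilon>t \<alpha>t \<beta>t \<nu>t \<pi>t lamt \<mu>t \<tau>t \<kappa>t \<rho>t \<sigma>t \<longleftrightarrow>
   (let lb = (\<lambda>x. conj_vec (l x)); mb = (\<lambda>x. conj_vec (m x));
        expansion = (\<lambda>x b p q r s. p * lower (g x) (l x) $ b + q * lower (g x) (lb x) $ b
                                  + r * lower (g x) (m x) $ b + s * lower (g x) (mb x) $ b)
    in \<forall>x\<in>S. \<forall>b.
     (conn g lb l b x - conn g m mb b x) / 2 = expansion x b (\<gamma> x) (\<epsilon> x) (- \<alpha> x) (\<beta> x) \<and>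
     conn g lb mb b x = expansion x b (- \<nu> x) (- \<pi> x) (lam x) (- \<mu> x) \<and>
     conn g m l b x = expansion x b (\<tau> x) (\<kappa> x) (- \<rho> x) (\<sigma> x) \<and>
     (conn g lb l b x - conn g mb m b x) / 2 = expansion x b (\<gamma>t x) (\<epsilon>t x) (- \<beta>t x) (\<alpha>t x) \<and>
     conn g lb m b x = expansion x b (\<nu>t x) (\<pi>t x) (- \<mu>t x) (lamt x) \<and>
     conn g mb l b x = expansion x b (- \<tau>t x) (- \<kappa>t x) (\<sigma>t x) (- \<rho>t x))"


section \<open>Weyl scalars\<close>

definition Psi0 :: "(real^4 \<Rightarrow> real^4^4) \<Rightarrow> (real^4 \<Rightarrow> complex^4) \<Rightarrow> (real^4 \<Rightarrow> complex^4) \<Rightarrow>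
    real^4 \<Rightarrow> complex" where
  "Psi0 g l m x = - weyl g x (l x) (m x) (l x) (m x)"

definition Psi1 :: "(real^4 \<Rightarrow> real^4^4) \<Rightarrow> (real^4 \<Rightarrow> complex^4) \<Rightarrow> (real^4 \<Rightarrow> complex^4) \<Rightarrow>
    real^4 \<Rightarrow> complex" where
  "Psi1 g l m x = - weyl g x (l x) (conj_vec (l x)) (l x) (m x)"

definition Psi2 :: "(real^4 \<Rightarrow> real^4^4) \<Rightarrow> (real^4 \<Rightarrow> complex^4) \<Rightarrow> (real^4 \<Rightarrow> complex^4) \<Rightarrow>
    real^4 \<Rightarrow> complex" where
  "Psi2 g l m x = weyl g x (l x) (m x) (conj_vec (l x)) (conj_vec (m x))"

definition Psi0t :: "(real^4 \<Rightarrow> real^4^4) \<Rightarrow> (real^4 \<Rightarrow> complex^4) \<Rightarrow> (real^4 \<Rightarrow> complex^4) \<Rightarrow>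
    real^4 \<Rightarrow> complex" where
  "Psi0t g l m x = - weyl g x (l x) (conj_vec (m x)) (l x) (conj_vec (m x))"

definition Psi1t :: "(real^4 \<Rightarrow> real^4^4) \<Rightarrow> (real^4 \<Rightarrow> complex^4) \<Rightarrow> (real^4 \<Rightarrow> complex^4) \<Rightarrow>
    real^4 \<Rightarrow> complex" where
  "Psi1t g l m x = - weyl g x (l x) (conj_vec (l x)) (l x) (conj_vec (m x))"

definition Psi2t :: "(real^4 \<Rightarrow> real^4^4) \<Rightarrow> (real^4 \<Rightarrow> complex^4) \<Rightarrow> (real^4 \<Rightarrow> complex^4) \<Rightarrow>
    real^4 \<Rightarrow> complex" where
  "Psi2t g l m x = weyl g x (l x) (conj_vec (m x)) (conj_vec (l x)) (m x)"

definition adapted_tetrad :: "'a topology \<Rightarrow> 'a chart set \<Rightarrow> 'a tensor2 \<Rightarrow> 'a set \<Rightarrow>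
    'a cvector_field \<Rightarrow> 'a cvector_field \<Rightarrow> bool" where
  "adapted_tetrad X A g V l m \<longleftrightarrow> tetrad X A g V l m \<and>
     (\<forall>c\<in>A. \<forall>x\<in>region c V.
        Psi0 (g c) (l c) (m c) x = 0 \<and> Psi1 (g c) (l c) (m c) x = 0 \<and>
        Psi0t (g c) (l c) (m c) x = 0 \<and> Psi1t (g c) (l c) (m c) x = 0 \<and>
        Psi2 (g c) (l c) (m c) x \<noteq> 0 \<and> Psi2t (g c) (l c) (m c) x \<noteq> 0)"

text \<open>Tetrads are locally defined, so type D means that there is an adapted tetrad near every
  point.\<close>

definition type_D :: "'a topology \<Rightarrow> 'a chart set \<Rightarrow> 'a tensor2 \<Rightarrow> bool" where
  "type_D X A g \<longleftrightarrow> (\<forall>p\<in>topspace X. \<exists>V l m. p \<in> V \<and> adapted_tetrad X A g V l m)"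

definition Psi0_dot :: "(real^4 \<Rightarrow> real^4^4) \<Rightarrow> (real^4 \<Rightarrow> real^4^4) \<Rightarrow>
    (real \<Rightarrow> real^4 \<Rightarrow> complex^4) \<Rightarrow> (real \<Rightarrow> real^4 \<Rightarrow> complex^4) \<Rightarrow> real^4 \<Rightarrow> complex" where
  "Psi0_dot g h ls ms x = vector_derivative (\<lambda>s. Psi0 (perturbed g h s) (ls s) (ms s) x) (at 0)"

definition Psi0t_dot :: "(real^4 \<Rightarrow> real^4^4) \<Rightarrow> (real^4 \<Rightarrow> real^4^4) \<Rightarrow>
    (real \<Rightarrow> real^4 \<Rightarrow> complex^4) \<Rightarrow> (real \<Rightarrow> real^4 \<Rightarrow> complex^4) \<Rightarrow> real^4 \<Rightarrow> complex" where
  "Psi0t_dot g h ls ms x = vector_derivative (\<lambda>s. Psi0t (perturbed g h s) (ls s) (ms s) x) (at 0)"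

end

theory Submission
  imports Defs
begin

text \<open>To first order in the parameter \<open>s\<close> a family of tetrads consists of germs modulo \<open>s\<^sup>2\<close>, which
  form a commutative ring with commuting derivations. Over this ring the perturbed metric is exactly
  Ricci-flat, so the vacuum Newman-Penrose equations hold for it; they follow from purely algebraic
  Levi-Civita calculus. Since \<open>\<Psi>\<^sub>0\<close> and \<open>\<Psi>\<^sub>1\<close> are multiples of \<open>s\<close>, two Bianchi identities show the same
  for \<open>\<kappa>\<close> and \<open>\<sigma>\<close> (\<open>\<Psi>\<^sub>2\<close> can be cancelled), and products of two such quantities vanish. Applying the
  outer operators of the equation to these identities and subtracting, the terms with \<open>\<Psi>\<^sub>1\<close> cancel by
  the commutator \<open>[D, \<delta>]\<close> evaluated on \<open>\<Psi>\<^sub>1\<close> and on \<open>\<Psi>\<^sub>2\<close> together with the Ricci identity for \<open>D\<beta> - \<delta>\<epsilon>\<close>,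
  while the terms with \<open>\<kappa>\<close> and \<open>\<sigma>\<close> combine to \<open>3 \<Psi>\<^sub>2 \<Psi>\<^sub>0\<close> by the Ricci identity for \<open>D\<sigma> - \<delta>\<kappa>\<close>.
  The second equation is the first one for the tetrad given by \<open>l\<close> and minus the conjugate of \<open>m\<close>, which
  exchanges the coefficients with and without tilde.\<close>


section \<open>Curvature of an abstract Levi-Civita connection\<close>

text \<open>Varying the Newman-Penrose equations one by one would call for the first variations of
  all spin coefficients and of the tetrad. Modulo \<open>s^2\<close> they stay ordinary identities,
  and the variation of \<open>Psi0\<close> appears only at the end: its germ is \<open>eps\<close>
  times its derivative in \<open>s\<close>. Since \<open>eps\<close> is a constant for the
  derivations, it can be factored out of the whole equation, and under this factor only the values
  of the coefficients at \<open>s = 0\<close> are visible.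

  The ring has zero divisors, so two facts take the place of division. A factor \<open>A2\<close> is
  cancelled only under \<open>eps\<close>, where it suffices that \<open>Psi2\<close> has no zero at
  \<open>s = 0\<close>. An element killed by \<open>eps\<close> is a multiple of \<open>eps\<close>,
  which makes products of two such elements vanish.

  No conjugation is used on the ring: the conjugate tetrad vectors enter as independent elements
  with prescribed inner products. This lets one computation serve both equations.\<close>

locale levi_civita = module sc
  for sc :: "'r::comm_ring_1 \<Rightarrow> 'v::ab_group_add \<Rightarrow> 'v" (infixr "\<odot>" 75) +
  fixes ac :: "'v \<Rightarrow> 'r \<Rightarrow> 'r" and nb :: "'v \<Rightarrow> 'v \<Rightarrow> 'v" and ip :: "'v \<Rightarrow> 'v \<Rightarrow> 'r"
  assumes ac_add_left: "ac (X + Y) f = ac X f + ac Y f"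
    and ac_scale_left: "ac (f \<odot> X) h = f * ac X h"
    and ac_add: "ac X (f + h) = ac X f + ac X h"
    and ac_mult: "ac X (f * h) = ac X f * h + f * ac X h"
    and ac_faithful: "(\<And>f. ac X f = 0) \<Longrightarrow> X = 0"
    and nb_add_left: "nb (X + Y) Z = nb X Z + nb Y Z"
    and nb_scale_left: "nb (f \<odot> X) Z = f \<odot> nb X Z"
    and nb_add: "nb X (Y + Z) = nb X Y + nb X Z"
    and nb_scale: "nb X (f \<odot> Z) = ac X f \<odot> Z + f \<odot> nb X Z"
    and ip_add_left: "ip (X + Y) Z = ip X Z + ip Y Z"
    and ip_scale_left: "ip (f \<odot> X) Z = f * ip X Z"
    and ip_commute: "ip X Y = ip Y X"
    and metric: "ac X (ip Y Z) = ip (nb X Y) Z + ip Y (nb X Z)"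
    and torsion_free: "ac (nb X Y - nb Y X) f = ac X (ac Y f) - ac Y (ac X f)"
    and double_eq_0: "(r::'r) + r = 0 \<Longrightarrow> r = 0"
begin

lemma ip_add_right: "ip Z (X + Y) = ip Z X + ip Z Y"
  by (metis ip_add_left ip_commute)

lemma ip_scale_right: "ip Z (f \<odot> X) = f * ip Z X"
  by (metis ip_scale_left ip_commute)

lemma zero_simps [simp]:
  "ac 0 f = 0" "ac X 0 = 0" "nb 0 Z = 0" "nb X 0 = 0" "ip 0 Z = 0" "ip Z 0 = 0" "ac X 1 = 0"
  using ac_add_left[of 0 0] ac_add[of X 0 0] nb_add_left[of 0 0] nb_add[of X 0 0]
    ip_add_left[of 0 0] ip_add_right[of Z 0 0] ac_mult[of X 1 1] by simp_all

lemma minus_simps [simp]: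
  "ac (- X) f = - ac X f" "ac X (- f) = - ac X f" "nb (- X) Z = - nb X Z" "nb X (- Z) = - nb X Z"
  "ip (- X) Z = - ip X Z" "ip Z (- X) = - ip Z X"
  using ac_add_left[of X "- X" f] ac_add[of X f "- f"] nb_add_left[of X "- X" Z] nb_add[of X Z "- Z"]
    ip_add_left[of X "- X" Z] ip_add_right[of Z X "- X"]
  by (simp_all add: eq_neg_iff_add_eq_0 add.commute)

lemma diff_simps:
  "ac (X - Y) f = ac X f - ac Y f" "ac X (f - h) = ac X f - ac X h"
  "nb (X - Y) Z = nb X Z - nb Y Z" "nb X (Y - Z) = nb X Y - nb X Z"
  "ip (X - Y) Z = ip X Z - ip Y Z" "ip Z (X - Y) = ip Z X - ip Z Y"
  using ac_add_left[of X "- Y" f] ac_add[of X f "- h"] nb_add_left[of X "- Y" Z] nb_add[of X Y "- Z"]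
    ip_add_left[of X "- Y" Z] ip_add_right[of Z X "- Y"] by simp_all

lemmas multilinear = ac_add_left ac_scale_left ac_add nb_add_left nb_scale_left nb_add
  ip_add_left ip_scale_left ip_add_right ip_scale_right diff_simps

text \<open>The Lie bracket, obtained from the connection: the torsion vanishes by definition, and
  \<open>torsion_free\<close> says that the bracket acts on functions as the commutator of
  derivations.\<close>

definition br :: "'v \<Rightarrow> 'v \<Rightarrow> 'v" where "br X Y = nb X Y - nb Y X"

lemma ac_br: "ac (br X Y) f = ac X (ac Y f) - ac Y (ac X f)"
  by (simp add: br_def torsion_free)

lemma br_anti: "br Y X = - br X Y"
  by (simp add: br_def)

lemma br_add: "br (X + Y) Z = br X Z + br Y Z" "br X (Y + Z) = br X Y + br X Z"
  by (simp_all add: br_def multilinear)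

lemma br_scale: "br (f \<odot> X) Y = f \<odot> br X Y - ac Y f \<odot> X" "br X (f \<odot> Y) = f \<odot> br X Y + ac X f \<odot> Y"
  by (simp_all add: br_def multilinear nb_scale scale_right_diff_distrib)

text \<open>Acting on a function, each bracket becomes a commutator of operators, for which the
  identity is formal; \<open>ac_faithful\<close> carries it back to vectors.\<close>

lemma jacobi: "br X (br Y Z) + br Y (br Z X) + br Z (br X Y) = 0"
  by (rule ac_faithful) (simp add: ac_add_left ac_br diff_simps)

definition curv :: "'v \<Rightarrow> 'v \<Rightarrow> 'v \<Rightarrow> 'v" where
  "curv X Y Z = nb X (nb Y Z) - nb Y (nb X Z) - nb (br X Y) Z"

definition Rm :: "'v \<Rightarrow> 'v \<Rightarrow> 'v \<Rightarrow> 'v \<Rightarrow> 'r" where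
  "Rm X Y Z T = ip (curv X Y Z) T"

lemma curv_anti: "curv Y X Z = - curv X Y Z"
  by (simp add: curv_def br_anti[of Y X])

text \<open>In the third argument the second derivatives of \<open>f\<close> combine to
  \<open>ac (br X Y) f\<close> by \<open>ac_br\<close> and cancel against the bracket term of
  \<open>curv\<close>.\<close>

lemma curv_linear:
  "curv (X + X') Y Z = curv X Y Z + curv X' Y Z" "curv (f \<odot> X) Y Z = f \<odot> curv X Y Z"
  "curv X Y (Z + Z') = curv X Y Z + curv X Y Z'" "curv X Y (f \<odot> Z) = f \<odot> curv X Y Z"
  by (simp_all add: curv_def br_add br_scale nb_add nb_add_left nb_scale nb_scale_left diff_simps
      scale_right_diff_distrib scale_left_diff_distrib ac_br)

lemma Rm_anti12: "Rm Y X Z T = - Rm X Y Z T"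
  by (simp add: Rm_def curv_anti[of Y X])

lemma Rm_linear:
  "Rm (X + X') Y Z T = Rm X Y Z T + Rm X' Y Z T" "Rm (f \<odot> X) Y Z T = f * Rm X Y Z T"
  "Rm X (Y + Y') Z T = Rm X Y Z T + Rm X Y' Z T" "Rm X (f \<odot> Y) Z T = f * Rm X Y Z T"
  "Rm X Y (Z + Z') T = Rm X Y Z T + Rm X Y Z' T" "Rm X Y (f \<odot> Z) T = f * Rm X Y Z T"
  "Rm X Y Z (T + T') = Rm X Y Z T + Rm X Y Z T'" "Rm X Y Z (f \<odot> T) = f * Rm X Y Z T"
proof -
  show *: "Rm (X + X') Y Z T = Rm X Y Z T + Rm X' Y Z T" "Rm (f \<odot> X) Y Z T = f * Rm X Y Z T"
    for X X' Y by (simp_all add: Rm_def curv_linear multilinear)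
  show "Rm X (Y + Y') Z T = Rm X Y Z T + Rm X Y' Z T" "Rm X (f \<odot> Y) Z T = f * Rm X Y Z T"
    using *(1)[of Y Y' X] *(2)[of Y X] by (simp_all add: Rm_anti12[of X])
qed (simp_all add: Rm_def curv_linear multilinear)

lemma Rm_minus:
  "Rm (- X) Y Z T = - Rm X Y Z T" "Rm X (- Y) Z T = - Rm X Y Z T"
  "Rm X Y (- Z) T = - Rm X Y Z T" "Rm X Y Z (- T) = - Rm X Y Z T"
  using Rm_linear(2)[of "- 1" X] Rm_linear(4)[of X "- 1" Y] Rm_linear(6)[of X Y "- 1" Z]
    Rm_linear(8)[of X Y Z "- 1" T] by simp_all

text \<open>The curvature operator acts trivially on the function \<open>ip Z T\<close>: two
  applications of \<open>metric\<close> turn \<open>ac_br\<close> for this function into the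
  claim.\<close>

lemma Rm_anti34: "Rm X Y T Z = - Rm X Y Z T"
proof -
  have "ac (br X Y) (ip Z T) = ac X (ac Y (ip Z T)) - ac Y (ac X (ip Z T))"
    by (rule ac_br)
  thus ?thesis
    by (simp add: metric Rm_def curv_def multilinear ip_commute[of _ Z] algebra_simps)
qed

lemma first_bianchi: "Rm X Y Z T + Rm Y Z X T + Rm Z X Y T = 0"
proof -
  have "curv X Y Z + curv Y Z X + curv Z X Y = br X (br Y Z) + br Y (br Z X) + br Z (br X Y)"
    by (simp add: curv_def br_def diff_simps algebra_simps)
  thus ?thesis by (simp add: Rm_def jacobi flip: ip_add_left)
qed

text \<open>The octahedron argument: four instances of \<open>first_bianchi\<close>, combined with
  signs, leave twice the difference of the two sides. \<open>double_eq_0\<close> stands in for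
  division by two.\<close>

lemma Rm_pair: "Rm X Y Z T = Rm Z T X Y"
proof -
  have 1: "Rm X Y Z T + Rm Y Z X T + Rm Z X Y T = 0"
    by (rule first_bianchi)
  have 2: "Rm Y Z X T + Rm Z T X Y + Rm Y T Z X = 0"
    using arg_cong[OF first_bianchi[of Y Z T X], of uminus]
    unfolding Rm_anti34[of Y Z T X] Rm_anti34[of Z T Y X] Rm_anti12[of T Y Z X]
    by (simp add: add.commute add.left_commute)
  have 3: "Rm Z T X Y + Rm X T Y Z + Rm Z X Y T = 0"
    using first_bianchi[of Z T X Y]
    unfolding Rm_anti12[of T X Z Y] Rm_anti34[of X T Z Y] Rm_anti12[of X Z T Y] Rm_anti34[of Z X T Y]
    by simp
  have 4: "Rm X Y Z T + Rm X T Y Z + Rm Y T Z X = 0"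
    using arg_cong[OF first_bianchi[of T X Y Z], of uminus]
    unfolding Rm_anti12[of T X Y Z] Rm_anti34[of X Y T Z] Rm_anti34[of Y T X Z]
    by (simp add: add.commute add.left_commute)
  have "Rm X Y Z T - Rm Z T X Y + (Rm X Y Z T - Rm Z T X Y) =
    (Rm X Y Z T + Rm Y Z X T + Rm Z X Y T) + (Rm X Y Z T + Rm X T Y Z + Rm Y T Z X)
    - (Rm Y Z X T + Rm Z T X Y + Rm Y T Z X) - (Rm Z T X Y + Rm X T Y Z + Rm Z X Y T)"
    by (simp add: algebra_simps)
  hence "Rm X Y Z T - Rm Z T X Y + (Rm X Y Z T - Rm Z T X Y) = 0"
    by (simp only: 1 2 3 4) simp
  from double_eq_0[OF this] show ?thesis by simp
qed

text \<open>This is the Jacobi identity for the operators \<open>nb X\<close>, \<open>nb Y\<close>,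
  \<open>nb Z\<close>. In the cyclic sum the covariant derivatives in the first two slots of
  \<open>Rm\<close> combine to brackets, so the identity is stated with \<open>br\<close>
  there.\<close>

lemma second_bianchi:
  "ac X (Rm Y Z W T) - Rm Y Z (nb X W) T - Rm Y Z W (nb X T) - Rm (br X Y) Z W T
   + (ac Y (Rm Z X W T) - Rm Z X (nb Y W) T - Rm Z X W (nb Y T) - Rm (br Y Z) X W T)
   + (ac Z (Rm X Y W T) - Rm X Y (nb Z W) T - Rm X Y W (nb Z T) - Rm (br Z X) Y W T) = 0"
proof -
  have "nb X (curv Y Z W) - curv Y Z (nb X W) - curv (br X Y) Z W
    + (nb Y (curv Z X W) - curv Z X (nb Y W) - curv (br Y Z) X W)
    + (nb Z (curv X Y W) - curv X Y (nb Z W) - curv (br Z X) Y W)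
    = nb (br (br X Y) Z + br (br Y Z) X + br (br Z X) Y) W"
    by (simp add: curv_def diff_simps nb_add nb_add_left algebra_simps)
  also have "br (br X Y) Z + br (br Y Z) X + br (br Z X) Y = 0"
    using jacobi[of X Y Z] by (simp add: br_anti[of "br _ _"] eq_neg_iff_add_eq_0 algebra_simps
        neg_eq_iff_add_eq_0)
  finally have "ip (nb X (curv Y Z W) - curv Y Z (nb X W) - curv (br X Y) Z W
    + (nb Y (curv Z X W) - curv Z X (nb Y W) - curv (br Y Z) X W)
    + (nb Z (curv X Y W) - curv X Y (nb Z W) - curv (br Z X) Y W)) T = 0"
    by simp
  thus ?thesis by (simp add: Rm_def metric multilinear algebra_simps)
qed

end

section \<open>Newman-Penrose equations in a vacuum null frame\<close>

text \<open>The inverse metric is the symmetrized sum of \<open>l\<close>, \<open>n\<close> and of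
  \<open>m\<close>, \<open>k\<close>. Hence \<open>complete\<close> is the expansion of a vector in
  the frame, and \<open>vacuum\<close> says that the Ricci tensor, the trace of \<open>Rm\<close>
  over its outer slots, is zero.\<close>

locale vacuum_frame = levi_civita +
  fixes l n m k :: 'b
  assumes ip_frame: "ip l l = 0" "ip l n = 1" "ip l m = 0" "ip l k = 0" "ip n n = 0" "ip n m = 0"
      "ip n k = 0" "ip m m = 0" "ip m k = 1" "ip k k = 0"
    and complete: "X = ip X n \<odot> l + ip X l \<odot> n + ip X k \<odot> m + ip X m \<odot> k"
    and vacuum: "Rm l Y Z n + Rm n Y Z l + Rm m Y Z k + Rm k Y Z m = 0"
begin

text \<open>The vectors \<open>n\<close> and \<open>k\<close> play the roles of the conjugates of \<open>l\<close> and \<open>m\<close>, with \<open>\<delta>t = - k\<close>. In terms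
  of the spin coefficients, \<open>\<kappa> = cml l\<close>, \<open>\<sigma> = cml m\<close>, \<open>\<tau> = cml n\<close>, \<open>\<rho> = - cml k\<close>, \<open>\<rho>t = - ckl m\<close>,
  \<open>\<mu> = - cnk m\<close>, \<open>\<pi> = - cnk l\<close>, \<open>\<pi>t = cnm l\<close>,
  \<open>\<epsilon> \<plusminus> \<epsilon>t = cnl l\<close> or \<open>ckm l\<close>, \<open>\<gamma> \<plusminus> \<gamma>t = cnl n\<close> or \<open>ckm n\<close>,
  \<open>\<beta> \<plusminus> \<alpha>t = cnl m\<close> or \<open>ckm m\<close>, \<open>- (\<alpha> \<plusminus> \<beta>t) = cnl k\<close> or \<open>ckm k\<close>. No halves occur in the combinations
  needed below.\<close>

definition cnl :: "'b \<Rightarrow> 'a" where "cnl X = ip n (nb X l)"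
definition ckm :: "'b \<Rightarrow> 'a" where "ckm X = ip k (nb X m)"
definition cml :: "'b \<Rightarrow> 'a" where "cml X = ip m (nb X l)"
definition ckl :: "'b \<Rightarrow> 'a" where "ckl X = ip k (nb X l)"
definition cnk :: "'b \<Rightarrow> 'a" where "cnk X = ip n (nb X k)"
definition cnm :: "'b \<Rightarrow> 'a" where "cnm X = ip n (nb X m)"

lemmas coeff_defs = cnl_def ckm_def cml_def ckl_def cnk_def cnm_def

lemma ip_frame_rev: "ip n l = 1" "ip m l = 0" "ip k l = 0" "ip m n = 0" "ip k n = 0" "ip k m = 1"
  using ip_frame by (simp_all add: ip_commute[of n l] ip_commute[of m l] ip_commute[of k l]
    ip_commute[of m n] ip_commute[of k n] ip_commute[of k m])

lemma ip_nb_self: "ip Y Y = 0 \<Longrightarrow> ip Y (nb X Y) = 0"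
  by (rule double_eq_0) (use metric[of X Y Y] in \<open>simp add: ip_commute[of "nb X Y"]\<close>)

lemma ip_nb_const: "ip Y Z = 0 \<or> ip Y Z = 1 \<Longrightarrow> ip Y (nb X Z) = - ip Z (nb X Y)"
  using metric[of X Y Z] by (auto simp: ip_commute[of Z] eq_neg_iff_add_eq_0 add.commute)

text \<open>The inner products of the frame are constant, so the connection matrix is skew and six
  one-forms determine it; \<open>complete\<close> supplies the expansion.\<close>

lemma nb_frame:
  "nb X l = cnl X \<odot> l + ckl X \<odot> m + cml X \<odot> k"
  "nb X n = - cnl X \<odot> n + (- cnk X) \<odot> m + (- cnm X) \<odot> k"
  "nb X m = ckm X \<odot> m + cnm X \<odot> l + (- cml X) \<odot> n"
  "nb X k = - ckm X \<odot> k + cnk X \<odot> l + (- ckl X) \<odot> n"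
proof -
  have *: "ip (nb X Y) Z = ip Z (nb X Y)" for Y Z by (rule ip_commute)
  note s = ip_frame ip_frame_rev ip_nb_self coeff_defs
  show "nb X l = cnl X \<odot> l + ckl X \<odot> m + cml X \<odot> k"
    by (subst complete[of "nb X l"]) (simp add: * s)
  show "nb X n = - cnl X \<odot> n + (- cnk X) \<odot> m + (- cnm X) \<odot> k"
    by (subst complete[of "nb X n"])
      (simp add: * s ip_nb_const[of l n] ip_nb_const[of k n] ip_nb_const[of m n])
  show "nb X m = ckm X \<odot> m + cnm X \<odot> l + (- cml X) \<odot> n"
    by (subst complete[of "nb X m"]) (simp add: * s ip_nb_const[of l m])
  show "nb X k = - ckm X \<odot> k + cnk X \<odot> l + (- ckl X) \<odot> n"
    by (subst complete[of "nb X k"])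
      (simp add: * s ip_nb_const[of l k] ip_nb_const[of m k])
qed

section \<open>Curvature components in a vacuum null frame\<close>

lemma Rm_self: "Rm X X Z T = 0" "Rm X Y Z Z = 0"
proof -
  have "Rm X X Z T + Rm X X Z T = 0"
    using Rm_anti12[of X X Z T] by (metis add.right_inverse)
  thus "Rm X X Z T = 0" by (rule double_eq_0)
  have "Rm X Y Z Z + Rm X Y Z Z = 0"
    using Rm_anti34[of X Y Z Z] by (metis add.right_inverse)
  thus "Rm X Y Z Z = 0" by (rule double_eq_0)
qed

lemma Rm_diff:
  "Rm (X - X') Y Z T = Rm X Y Z T - Rm X' Y Z T" "Rm X (Y - Y') Z T = Rm X Y Z T - Rm X Y' Z T"
  "Rm X Y (Z - Z') T = Rm X Y Z T - Rm X Y Z' T" "Rm X Y Z (T - T') = Rm X Y Z T - Rm X Y Z T'"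
  using Rm_linear(1)[of X "- X'"] Rm_linear(3)[of X Y "- Y'"] Rm_linear(5)[of X Y Z "- Z'"]
    Rm_linear(7)[of X Y Z T "- T'"] by (simp_all add: Rm_minus)

text \<open>\<open>A0\<close>, \<open>A1\<close>, \<open>A2\<close>, \<open>B2\<close> correspond to \<open>- \<Psi>\<^sub>0\<close>, \<open>- \<Psi>\<^sub>1\<close>, \<open>\<Psi>\<^sub>2\<close> and \<open>\<Psi>\<^sub>2\<close> with a tilde.\<close>

definition "A0 = Rm l m l m"
definition "A1 = Rm l n l m"
definition "A2 = Rm l m n k"
definition "B2 = Rm l k n m"

text \<open>Directed instances of the curvature symmetries. Vectors within a pair are put in the
  order \<open>l\<close>, \<open>n\<close>, \<open>m\<close>, \<open>k\<close> and pairs in the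
  order \<open>ln\<close>, \<open>lm\<close>, \<open>lk\<close>, \<open>nm\<close>,
  \<open>nk\<close>, \<open>mk\<close>, so that rewriting reaches a normal form.\<close>

lemmas Rm_order12 = Rm_anti12[of n l] Rm_anti12[of m l] Rm_anti12[of k l]
  Rm_anti12[of m n] Rm_anti12[of k n] Rm_anti12[of k m]
lemmas Rm_order34 = Rm_anti34[of _ _ n l] Rm_anti34[of _ _ m l] Rm_anti34[of _ _ k l]
  Rm_anti34[of _ _ m n] Rm_anti34[of _ _ k n] Rm_anti34[of _ _ k m]
lemmas Rm_order_pairs =
  Rm_pair[of l m l n] Rm_pair[of l k l n] Rm_pair[of n m l n] Rm_pair[of n k l n]
  Rm_pair[of m k l n] Rm_pair[of l k l m] Rm_pair[of n m l m] Rm_pair[of n k l m]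
  Rm_pair[of m k l m] Rm_pair[of n m l k] Rm_pair[of n k l k] Rm_pair[of m k l k]
  Rm_pair[of n k n m] Rm_pair[of m k n m] Rm_pair[of m k n k]
lemmas Rm_order = Rm_order12 Rm_order34 Rm_order_pairs Rm_self

text \<open>A Ricci-flat curvature tensor does not mix the two halves of the bivectors, spanned by
  \<open>lm\<close>, \<open>nk\<close>, \<open>ln + mk\<close> and by \<open>lk\<close>,
  \<open>nm\<close>, \<open>ln - mk\<close>. The zeros and the equalities between components express
  this. Each zero comes from a diagonal Ricci component, in which it is counted twice.\<close>

lemma Rm_components:
  "Rm l m l m = A0" "Rm l n l m = A1" "Rm l m m k = A1" "Rm l m n k = A2" "Rm l k n m = B2"
  "Rm l n m k = A2 - B2" "Rm l n l n = A2 + B2" "Rm m k m k = A2 + B2"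
  "Rm l m l k = 0" "Rm l m n m = 0" "Rm l k n k = 0" "Rm n m n k = 0"
  "Rm l k m k = - Rm l n l k" "Rm n m m k = - Rm l n n m" "Rm n k m k = Rm l n n k"
proof -
  show 0: "Rm l m l m = A0" "Rm l n l m = A1" "Rm l m n k = A2" "Rm l k n m = B2"
    by (simp_all add: A0_def A1_def A2_def B2_def)
  show "Rm l m m k = A1" using vacuum[of l m] by (simp add: Rm_order 0)
  show "Rm l n m k = A2 - B2" using first_bianchi[of l n m k] by (simp add: Rm_order 0 algebra_simps)
  show "Rm l n l n = A2 + B2" using vacuum[of l n] by (simp add: Rm_order 0 algebra_simps)
  show "Rm m k m k = A2 + B2" using vacuum[of m k] by (simp add: Rm_order 0 algebra_simps)
  show "Rm l k m k = - Rm l n l k"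
    using vacuum[of l k] by (simp add: Rm_order eq_neg_iff_add_eq_0 algebra_simps)
  show "Rm n m m k = - Rm l n n m"
    using vacuum[of n m] by (simp add: Rm_order eq_neg_iff_add_eq_0 algebra_simps)
  show "Rm n k m k = Rm l n n k"
    using vacuum[of n k] by (simp add: Rm_order eq_neg_iff_add_eq_0 algebra_simps)
  show "Rm l m l k = 0"
    by (rule double_eq_0) (use arg_cong[OF vacuum[of l l], of uminus] in \<open>simp add: Rm_order\<close>)
  show "Rm l m n m = 0"
    by (rule double_eq_0) (use arg_cong[OF vacuum[of m m], of uminus] in \<open>simp add: Rm_order\<close>)
  show "Rm l k n k = 0"
    by (rule double_eq_0) (use arg_cong[OF vacuum[of k k], of uminus] in \<open>simp add: Rm_order\<close>)
  show "Rm n m n k = 0"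
    by (rule double_eq_0) (use arg_cong[OF vacuum[of n n], of uminus] in \<open>simp add: Rm_order\<close>)
qed

section \<open>Bianchi identities in the frame\<close>

lemmas frame_expand = br_def nb_frame diff_simps Rm_linear Rm_minus Rm_diff Rm_order Rm_components

text \<open>The coefficient 3: differentiating \<open>Rm m k l m\<close> along \<open>l\<close>
  contributes \<open>A2 + B2\<close> and \<open>A2 - B2\<close>, the bracket of \<open>l\<close> and
  \<open>m\<close> contributes one more \<open>A2\<close>, and the other half \<open>B2\<close>
  drops out.\<close>

lemma bianchi1:
  "ac k A0 = (2 * cnl k + 2 * ckm k - cnk l) * A0 - ac l A1 + (- 4 * cml k + cnl l + ckm l) * A1
    - 3 * cml l * A2"
  using second_bianchi[of l m k l m] by (simp add: frame_expand) (simp add: algebra_simps)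

lemma bianchi2:
  "ac n A0 = (2 * cnl n + 2 * ckm n + cnk m) * A0 + ac m A1 - (4 * cml n + cnl m + ckm m) * A1
    + 3 * cml m * A2"
  using second_bianchi[of l n m l m] by (simp add: frame_expand) (simp add: algebra_simps)

text \<open>The component \<open>Rm l n n k\<close>, which is \<Psi>_3 up to sign, is left as it is.
  Here it is multiplied by \<open>cml l\<close> and in \<open>bianchi4\<close> by
  \<open>cml m\<close>, both of which are first order in the application.\<close>

lemma bianchi3:
  "ac l A2 = - 3 * cml k * A2 - ac k A1 + (cnl k + ckm k - 2 * cnk l) * A1
    - cnk k * A0 - 2 * cml l * Rm l n n k"
  using second_bianchi[of l n k l m] by (simp add: frame_expand) (simp add: algebra_simps)

lemma bianchi4:
  "ac m A2 = 3 * cml n * A2 + ac n A1 - (cnl n + ckm n + 2 * cnk m) * A1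
    + cnk n * A0 - 2 * cml m * Rm l n n k"
  using second_bianchi[of m n k l m] by (simp add: frame_expand) (simp add: algebra_simps)

section \<open>Commutator and Ricci identities for the spin coefficients\<close>

lemma commutator: "ac l (ac m f) = ac m (ac l f) + (cnm l - cnl m) * ac l f - cml l * ac n f
   + (ckm l - ckl m) * ac m f - cml m * ac k f"
  using ac_br[of l m f] by (simp add: br_def nb_frame multilinear) (simp add: algebra_simps)

text \<open>Cartan's second structure equation: \<open>metric\<close> moves the outer derivative
  from vectors to inner products. For frame vectors these inner products are spin coefficients, so
  the Ricci identities are instances.\<close>

lemma Rm_cartan:
  "Rm X Y Z T = ac X (ip (nb Y Z) T) - ac Y (ip (nb X Z) T) - ip (nb Y Z) (nb X T)
    + ip (nb X Z) (nb Y T) - ip (nb (br X Y) Z) T"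
  by (simp add: Rm_def curv_def metric multilinear)

lemma coeff_linear:
  "cnl (X + Y) = cnl X + cnl Y" "cnl (f \<odot> X) = f * cnl X"
  "cnl (X - Y) = cnl X - cnl Y" "cnl (- X) = - cnl X"
  "ckm (X + Y) = ckm X + ckm Y" "ckm (f \<odot> X) = f * ckm X"
  "ckm (X - Y) = ckm X - ckm Y" "ckm (- X) = - ckm X"
  "cml (X + Y) = cml X + cml Y" "cml (f \<odot> X) = f * cml X"
  "cml (X - Y) = cml X - cml Y" "cml (- X) = - cml X"
  "ckl (X + Y) = ckl X + ckl Y" "ckl (f \<odot> X) = f * ckl X"
  "ckl (X - Y) = ckl X - ckl Y" "ckl (- X) = - ckl X"
  "cnk (X + Y) = cnk X + cnk Y" "cnk (f \<odot> X) = f * cnk X"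
  "cnk (X - Y) = cnk X - cnk Y" "cnk (- X) = - cnk X"
  "cnm (X + Y) = cnm X + cnm Y" "cnm (f \<odot> X) = f * cnm X"
  "cnm (X - Y) = cnm X - cnm Y" "cnm (- X) = - cnm X"
  by (simp_all add: coeff_defs multilinear)

lemma ricci_sigma:
  "ac l (cml m) = (cnl l + 2 * ckm l - cml k - ckl m) * cml m + ac m (cml l)
    + (cnm l - cml n - 2 * cnl m - ckm m) * cml l + A0"
  using Rm_cartan[of l m l m]
  by (simp add: Rm_components br_def nb_frame multilinear ip_frame ip_frame_rev coeff_linear)
   (simp add: algebra_simps)

text \<open>Adding the two structure equations produces the sums \<open>cnl + ckm\<close>, that is 2
  \<beta> and 2 \<epsilon>, and cancels the products of \<open>ckl\<close> with \<open>cnm\<close>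
  in the quadratic terms. The result is twice the identity for D \<beta> - \<delta>
  \<epsilon>.\<close>

lemma ricci_beta:
  "ac l (cnl m + ckm m) - ac m (cnl l + ckm l) =
     (cnm l - cnl m) * (cnl l + ckm l) + (ckm l - ckl m) * (cnl m + ckm m) + 2 * A1 
    - (cnl k + ckm k + 2 * cnk l) * cml m + (2 * cnk m - cnl n - ckm n) * cml l"
  using Rm_cartan[of l m l n] Rm_cartan[of l m m k]
  by (simp add: Rm_order Rm_components br_def nb_frame multilinear ip_frame ip_frame_rev coeff_linear)
    (simp add: algebra_simps)

text \<open>The element \<open>e\<close> stands for the parameter of the family: \<open>e * r = 0\<close> says that \<open>r\<close> vanishes for the
  unperturbed metric.\<close>

lemma teukolsky:
  assumes ac_e: "\<And>X. ac X e = 0"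
    and div_e: "\<And>r. e * r = 0 \<Longrightarrow> \<exists>y. r = e * y"
    and three: "\<And>r::'a. 3 * r = 0 \<Longrightarrow> r = 0"
    and cancel: "\<And>r. e * (A2 * r) = 0 \<Longrightarrow> e * r = 0"
    and A0: "e * A0 = 0" and A1: "e * A1 = 0"
  defines "P2 \<equiv> ac n A0 + (- 2 * (cnl n + ckm n) - cnk m) * A0"
    and "P1 \<equiv> - ac k A0 + (2 * (cnl k + ckm k) - cnk l) * A0"
  shows "ac l P2 + (- cnl l - 2 * ckm l + ckl m + 4 * cml k) * P2
      - (ac m P1 + (- 2 * cnl m - ckm m + cnm l - 4 * cml n) * P1) - 3 * A2 * A0 = 0"
proof -
  have ac_ann: "e * ac X r = 0" if "e * r = 0" for X r
    using ac_mult[of X e r] that by (simp add: ac_e)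
  have prod_ann: "r * r' = 0" if "e * r = 0" "e * r' = 0" for r r'
  proof -
    obtain y where "r = e * y" using div_e[OF \<open>e * r = 0\<close>] by blast
    hence "r * r' = y * (e * r')" by (simp add: ac_simps)
    thus ?thesis using that(2) by simp
  qed
  have mult_ann: "e * (f * r) = 0" if "e * r = 0" for f r
    using that by (metis mult.left_commute mult_zero_right)
  have mult_ann': "e * (r * f) = 0" if "e * r = 0" for f r
    using that by (simp flip: mult.assoc)
  have P1: "P1 = ac l A1 - (- 4 * cml k + cnl l + ckm l) * A1 + 3 * cml l * A2"
    unfolding P1_def using bianchi1 by (simp add: algebra_simps)
  have P2: "P2 = ac m A1 - (4 * cml n + cnl m + ckm m) * A1 + 3 * cml m * A2"
    unfolding P2_def using bianchi2 by (simp add: algebra_simps)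
  have kappa: "e * cml l = 0"
  proof -
    \<comment> \<open>By definition \<open>P1\<close> is built from \<open>A0\<close> and its
      derivative, hence first order. Rewritten with \<open>bianchi1\<close>, its only term not yet
      known to be first order is \<open>3 * cml l * A2\<close>.\<close>
    have "e * P1 = 0" by (simp add: P1_def distrib_left right_diff_distrib mult_ann ac_ann A0)
    hence "3 * (e * (A2 * cml l)) = 0"
      by (simp add: P1 distrib_left right_diff_distrib mult_ann ac_ann A1) (simp add: ac_simps)
    from three[OF this] show ?thesis by (rule cancel)
  qed
  have sigma: "e * cml m = 0"
  proof -
    have "e * P2 = 0" by (simp add: P2_def distrib_left right_diff_distrib mult_ann ac_ann A0)
    hence "3 * (e * (A2 * cml m)) = 0"
      by (simp add: P2 distrib_left right_diff_distrib mult_ann ac_ann A1) (simp add: ac_simps)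
    from three[OF this] show ?thesis by (rule cancel)
  qed
  \<comment> \<open>\<open>w1\<close> and \<open>w2\<close> are the defects in D \<Psi>_2 = 3 \<rho>
    \<Psi>_2 and \<delta> \<Psi>_2 = 3 \<tau> \<Psi>_2, which hold for the unperturbed
    metric.\<close>
  define w1 where "w1 = ac l A2 + 3 * cml k * A2"
  define w2 where "w2 = ac m A2 - 3 * cml n * A2"
  have w1: "e * w1 = 0"
    unfolding w1_def bianchi3 by (simp add: distrib_left right_diff_distrib mult_ann ac_ann A0 A1 kappa)
      (simp add: mult.assoc mult_ann mult_ann' kappa)
  have w2: "e * w2 = 0"
    unfolding w2_def bianchi4 by (simp add: distrib_left right_diff_distrib mult_ann ac_ann A0 A1 sigma)
      (simp add: mult.assoc mult_ann mult_ann' sigma)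
  have lA2: "ac l A2 = w1 - 3 * cml k * A2" and mA2: "ac m A2 = w2 + 3 * cml n * A2"
    by (simp_all add: w1_def w2_def)
  have ac_num: "ac X (numeral i) = 0" for X i
  proof -
    have "ac X (of_nat j) = 0" for j by (induction j) (simp_all add: ac_add)
    from this[of "numeral i"] show ?thesis by simp
  qed
  \<comment> \<open>\<open>y\<close> is the defect in the equation for \<open>D\<tau> - \<delta>\<rho>\<close>; evaluating the commutator on \<open>\<Psi>\<^sub>2\<close> replaces the
    two Ricci identities from which that equation is usually obtained.\<close>
  define y where "y = ac l (cml n) + ac m (cml k) + (cnm l - cnl m) * cml k - (ckm l - ckl m) * cml n"
  have y: "e * y = 0"
  proof -
    \<comment> \<open>Both orders of differentiating \<open>A2\<close> produce
      \<open>- 9 * cml n * cml k * A2\<close>. These terms cancel, and the derivatives of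
      \<open>cml n\<close> and \<open>cml k\<close> assemble to \<open>y\<close>.\<close>
    have "3 * (A2 * y) = - 3 * cml n * w1 - 3 * cml k * w2 - ac l w2 + ac m w1 + (cnm l - cnl m) * w1
        - cml l * ac n A2 + (ckm l - ckl m) * w2 - cml m * ac k A2"
      using commutator[of A2] unfolding y_def
      by (simp add: lA2 mA2 ac_add ac_mult diff_simps ac_num) (simp add: algebra_simps)
    hence "3 * (e * (A2 * y)) = e * (- 3 * cml n * w1 - 3 * cml k * w2 - ac l w2 + ac m w1
        + (cnm l - cnl m) * w1
        - cml l * ac n A2 + (ckm l - ckl m) * w2 - cml m * ac k A2)"
      by (metis mult.left_commute)
    also have "\<dots> = 0"
      by (simp add: distrib_left right_diff_distrib mult_ann ac_ann w1 w2)
        (simp add: mult_ann' kappa sigma)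
    finally show ?thesis by (rule cancel[OF three])
  qed
  \<comment> \<open>\<open>z\<close> is the coefficient of \<open>A1\<close> in the final identity,
    after \<open>beta\<close> and \<open>tau\<close> have replaced the derivatives along
    \<open>l\<close>. As \<open>A1\<close> is first order, it is enough that \<open>z\<close> is
    too.\<close>
  define z where "z = - 4 * y - 2 * A1 + (cnl k + ckm k + 2 * cnk l) * cml m - (2 * cnk m - cnl n
      - ckm n) * cml l"
  have z: "e * z = 0"
    unfolding z_def by (simp add: distrib_left right_diff_distrib mult_ann ac_ann y A1 kappa sigma)
  have beta: "ac l (cnl m) = ac m (cnl l) + ac m (ckm l) - ac l (ckm m) +
     (cnm l - cnl m) * (cnl l + ckm l) + (ckm l - ckl m) * (cnl m + ckm m) + 2 * A1
    - (cnl k + ckm k + 2 * cnk l) * cml m + (2 * cnk m - cnl n - ckm n) * cml l"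
    using ricci_beta by (simp add: ac_add algebra_simps)
  have tau: "ac l (cml n) = y - ac m (cml k) - (cnm l - cnl m) * cml k + (ckm l - ckl m) * cml n"
    by (simp add: y_def)
  \<comment> \<open>This identity is exact. Its right side consists of products of two elements
    killed by \<open>e\<close>; the derivatives of \<open>A1\<close> survive only along
    \<open>n\<close> and \<open>k\<close>, with the factors \<open>cml l\<close> and
    \<open>cml m\<close>.\<close>
  have "ac l P2 + (- cnl l - 2 * ckm l + ckl m + 4 * cml k) * P2
      - (ac m P1 + (- 2 * cnl m - ckm m + cnm l - 4 * cml n) * P1) - 3 * A2 * A0
    = A1 * z - cml l * ac n A1 - cml m * ac k A1 + 3 * (cml m * w1) - 3 * (cml l * w2)"
    unfolding P1 P2
    by (simp add: ac_add ac_mult diff_simps ac_num beta tau lA2 mA2 commutator[of A1] ricci_sigma z_def)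
      (simp add: algebra_simps)
  also have "\<dots> = 0"
    by (simp add: prod_ann ac_ann A1 z w1 w2 kappa sigma)
  finally show ?thesis .
qed

end

section \<open>Calculus of smooth functions\<close>

text \<open>\<open>Ck_on\<close> iterates these derivatives over a basis. The same notion covers
  coordinate derivatives on space and, on the product with the parameter line, the derivative in
  \<open>s\<close>.\<close>

definition ddir :: "'a::euclidean_space \<Rightarrow> ('a \<Rightarrow> 'b::real_normed_vector) \<Rightarrow> 'a \<Rightarrow> 'b" where
  "ddir v f x = frechet_derivative f (at x) v"

lemma Ck_on_Suc:
  assumes "open S"
  shows "Ck_on (Suc k) S f \<longleftrightarrow>
    (\<forall>x\<in>S. f differentiable at x) \<and> (\<forall>v\<in>Basis. Ck_on k S (ddir v f))"
  using assms by (simp add: differentiable_on_eq_differentiable_at ddir_def[abs_def])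

lemma ddir_eqI: "(f has_derivative f') (at x) \<Longrightarrow> ddir v f x = f' v"
  unfolding ddir_def by (metis frechet_derivative_at)

lemma differentiable_cong_open:
  assumes "open S" "x \<in> S" "\<And>y. y \<in> S \<Longrightarrow> f y = g y" "f differentiable at x"
  shows "g differentiable at x"
  using assms has_derivative_transform_within_open unfolding differentiable_def by blast

lemma ddir_cong_open:
  assumes "open S" "x \<in> S" "\<And>y. y \<in> S \<Longrightarrow> f y = g y"
  shows "ddir v f x = ddir v g x"
proof -
  have "(f has_derivative D) (at x) \<longleftrightarrow> (g has_derivative D) (at x)" for D
    using assms has_derivative_transform_within_open[of f D x UNIV S g]
      has_derivative_transform_within_open[of g D x UNIV S f] by auto
  thus ?thesis by (simp add: ddir_def frechet_derivative_def)
qed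

lemma Ck_on_cong:
  assumes "open S" "\<And>y. y \<in> S \<Longrightarrow> f y = g y"
  shows "Ck_on k S f \<longleftrightarrow> Ck_on k S g"
  using assms(2)
proof (induction k arbitrary: f g)
  case 0
  thus ?case by (simp cong: continuous_on_cong)
next
  case (Suc k)
  have "Ck_on k S (ddir v f) \<longleftrightarrow> Ck_on k S (ddir v g)" for v
    using Suc.prems by (intro Suc.IH ddir_cong_open[OF assms(1)]) auto
  moreover have "f differentiable at x \<longleftrightarrow> g differentiable at x" if "x \<in> S" for x
    using differentiable_cong_open[OF assms(1) that] Suc.prems by metis
  ultimately show ?case by (simp add: Ck_on_Suc[OF assms(1)] del: Ck_on.simps)
qed

lemma Ck_on_subset:
  assumes "open S" "open T" "T \<subseteq> S" "Ck_on k S f"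
  shows "Ck_on k T f"
  using assms(4)
proof (induction k arbitrary: f)
  case 0
  thus ?case using assms(3) by (auto intro: continuous_on_subset)
next
  case (Suc k)
  thus ?case using assms by (auto simp: Ck_on_Suc simp del: Ck_on.simps)
qed

lemma Ck_on_continuous: "open S \<Longrightarrow> Ck_on k S f \<Longrightarrow> continuous_on S f"
  by (cases k) (auto intro: differentiable_imp_continuous_on)

lemma Ck_on_Suc_D: "open S \<Longrightarrow> Ck_on (Suc k) S f \<Longrightarrow> Ck_on k S f"
proof (induction k arbitrary: f)
  case 0
  thus ?case using Ck_on_continuous[of S "Suc 0" f] by simp
next
  case (Suc k)
  thus ?case by (metis Ck_on_Suc)
qed

lemma Ck_on_const: "open S \<Longrightarrow> Ck_on k S (\<lambda>_. c)"
proof (induction k arbitrary: c)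
  case (Suc k)
  have "ddir v (\<lambda>_. c) = (\<lambda>_. 0)" for v :: 'a
    by (rule ext, rule ddir_eqI[where f'="\<lambda>_. 0"]) auto
  thus ?case using Suc by (simp add: Ck_on_Suc del: Ck_on.simps)
qed auto

lemma ddir_add:
  assumes "f differentiable at x" "g differentiable at x"
  shows "ddir v (\<lambda>x. f x + g x) x = ddir v f x + ddir v g x"
  using ddir_eqI[OF has_derivative_add[of f "frechet_derivative f (at x)" "at x" g
      "frechet_derivative g (at x)"]] assms
  by (simp add: ddir_def frechet_derivative_works)

lemma Ck_on_add: 
  assumes "open S"
  shows "Ck_on k S f \<Longrightarrow> Ck_on k S g \<Longrightarrow> Ck_on k S (\<lambda>x. f x + g x)"
proof (induction k arbitrary: f g)
  case (Suc k)
  have "ddir v (\<lambda>x. f x + g x) x = ddir v f x + ddir v g x" if "x \<in> S" for v x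
    using Suc.prems that assms
    by (intro ddir_add) (auto simp: Ck_on_Suc simp del: Ck_on.simps)
  hence "Ck_on k S (ddir v (\<lambda>x. f x + g x)) \<longleftrightarrow> Ck_on k S (\<lambda>x. ddir v f x + ddir v g x)" for v
    by (intro Ck_on_cong assms)
  thus ?case using Suc assms by (auto simp: Ck_on_Suc simp del: Ck_on.simps)
qed (auto intro: continuous_intros)

lemma ddir_mult:
  fixes f g :: "'a::euclidean_space \<Rightarrow> 'b::real_normed_algebra"
  assumes "f differentiable at x" "g differentiable at x"
  shows "ddir v (\<lambda>x. f x * g x) x = f x * ddir v g x + ddir v f x * g x"
  using ddir_eqI[OF has_derivative_mult[of f "frechet_derivative f (at x)" x UNIV g
      "frechet_derivative g (at x)"]] assms
  by (simp add: ddir_def frechet_derivative_works)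

lemma Ck_on_mult: 
  fixes f g :: "'a::euclidean_space \<Rightarrow> 'b::real_normed_algebra"
  assumes "open S"
  shows "Ck_on k S f \<Longrightarrow> Ck_on k S g \<Longrightarrow> Ck_on k S (\<lambda>x. f x * g x)"
proof (induction k arbitrary: f g)
  case (Suc k)
  have "ddir v (\<lambda>x. f x * g x) x = f x * ddir v g x + ddir v f x * g x" if "x \<in> S" for v x
    using Suc.prems that assms by (intro ddir_mult) (auto simp: Ck_on_Suc simp del: Ck_on.simps)
  hence "Ck_on k S (ddir v (\<lambda>x. f x * g x)) \<longleftrightarrow> Ck_on k S (\<lambda>x. f x * ddir v g x + ddir v f x * g x)" for v
    by (intro Ck_on_cong assms)
  moreover have "Ck_on k S f" "Ck_on k S g" using Suc.prems Ck_on_Suc_D assms by auto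
  ultimately show ?case using Suc assms
    by (auto simp: Ck_on_Suc simp del: Ck_on.simps intro!: Ck_on_add)
qed (auto intro: continuous_intros)

lemma ddir_linear:
  assumes "bounded_linear B" "f differentiable at x"
  shows "ddir v (\<lambda>x. B (f x)) x = B (ddir v f x)"
proof -
  have "(f has_derivative frechet_derivative f (at x)) (at x)"
    using assms(2) by (simp add: frechet_derivative_works)
  from ddir_eqI[OF bounded_linear.has_derivative[OF assms(1) this]] show ?thesis
    by (simp add: ddir_def)
qed

lemma differentiable_linear:
  assumes "bounded_linear B" "f differentiable at x"
  shows "(\<lambda>x. B (f x)) differentiable at x"
  using bounded_linear.has_derivative[OF assms(1)] assms(2) unfolding differentiable_def by blast

lemma Ck_on_linear: 
  assumes "open S" "bounded_linear B"
  shows "Ck_on k S f \<Longrightarrow> Ck_on k S (\<lambda>x. B (f x))"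
proof (induction k arbitrary: f)
  case 0
  thus ?case using linear_continuous_on[OF assms(2)] by (auto intro: continuous_on_compose2)
next
  case (Suc k)
  have "ddir v (\<lambda>x. B (f x)) x = B (ddir v f x)" if "x \<in> S" for v x
    using Suc.prems that assms by (intro ddir_linear) (auto simp: Ck_on_Suc simp del: Ck_on.simps)
  hence "Ck_on k S (ddir v (\<lambda>x. B (f x))) \<longleftrightarrow> Ck_on k S (\<lambda>x. B (ddir v f x))" for v
    by (intro Ck_on_cong assms)
  thus ?case using Suc assms
    by (auto simp: Ck_on_Suc simp del: Ck_on.simps intro!: differentiable_linear[OF assms(2)])
qed

lemma ddir_affine:
  fixes f :: "'a::euclidean_space \<Rightarrow> 'b::real_normed_vector" and A :: "'c::euclidean_space \<Rightarrow> 'a"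
  assumes "bounded_linear A" "f differentiable at (a + A x)"
  shows "ddir v (\<lambda>x. f (a + A x)) x = ddir (A v) f (a + A x)"
    "(\<lambda>x. f (a + A x)) differentiable at x"
proof -
  have "((\<lambda>x. a + A x) has_derivative A) (at x)"
    using bounded_linear_imp_has_derivative[OF assms(1)] by (auto intro!: derivative_eq_intros)
  moreover have "(f has_derivative frechet_derivative f (at (a + A x))) (at (a + A x))"
    using assms(2) by (simp add: frechet_derivative_works)
  ultimately have "((f \<circ> (\<lambda>x. a + A x)) has_derivative frechet_derivative f (at (a + A x)) \<circ> A) (at x)"
    by (rule diff_chain_at)
  hence *: "((\<lambda>x. f (a + A x)) has_derivative frechet_derivative f (at (a + A x)) \<circ> A) (at x)"
    by (simp add: o_def)
  show "ddir v (\<lambda>x. f (a + A x)) x = ddir (A v) f (a + A x)"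
    using ddir_eqI[OF *] by (simp add: ddir_def)
  show "(\<lambda>x. f (a + A x)) differentiable at x" using * unfolding differentiable_def by blast
qed

text \<open>\<open>Ck_on\<close> controls derivatives in basis directions only, whereas an affine
  change of variables produces the direction \<open>A v\<close>. This expansion closes the induction
  in \<open>Ck_on_affine\<close>.\<close>

lemma ddir_expand:
  fixes f :: "'a::euclidean_space \<Rightarrow> 'b::real_normed_vector"
  assumes "f differentiable at x"
  shows "ddir v f x = (\<Sum>b\<in>Basis. (v \<bullet> b) *\<^sub>R ddir b f x)"
proof -
  have "linear (frechet_derivative f (at x))" using linear_frechet_derivative[OF assms] .
  thus ?thesis unfolding ddir_def
    by (subst euclidean_representation[of v, symmetric]) (simp only: linear_sum linear_scale)
qed

lemma Ck_on_sum: "open S \<Longrightarrow> (\<And>i. i \<in> I \<Longrightarrow> Ck_on k S (f i)) \<Longrightarrow> Ck_on k S (\<lambda>x. \<Sum>i\<in>I. f i x)"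
  by (induction I rule: infinite_finite_induct) (auto intro: Ck_on_const Ck_on_add)

lemma Ck_on_affine:
  fixes f :: "'a::euclidean_space \<Rightarrow> 'b::real_normed_vector" and A :: "'c::euclidean_space \<Rightarrow> 'a"
  assumes "open S" "open T" "bounded_linear A" "\<And>x. x \<in> T \<Longrightarrow> a + A x \<in> S"
  shows "Ck_on k S f \<Longrightarrow> Ck_on k T (\<lambda>x. f (a + A x))"
proof (induction k arbitrary: f)
  case 0
  thus ?case using linear_continuous_on[OF assms(3)] assms(4)
    by (auto intro!: continuous_on_compose2[of S f] continuous_intros)
next
  case (Suc k)
  have "ddir v (\<lambda>x. f (a + A x)) x = (\<Sum>b\<in>Basis. (A v \<bullet> b) *\<^sub>R ddir b f (a + A x))" if "x \<in> T" for v x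
    using Suc.prems that assms by (subst ddir_affine) (auto simp: Ck_on_Suc simp del: Ck_on.simps
        intro!: ddir_expand)
  hence "Ck_on k T (ddir v (\<lambda>x. f (a + A x))) \<longleftrightarrow>
      Ck_on k T (\<lambda>x. \<Sum>b\<in>Basis. (A v \<bullet> b) *\<^sub>R ddir b f (a + A x))" for v
    by (intro Ck_on_cong assms)
  moreover have "Ck_on k T (\<lambda>x. \<Sum>b\<in>Basis. (A v \<bullet> b) *\<^sub>R ddir b f (a + A x))" for v
    using Suc assms
    by (intro Ck_on_sum Ck_on_linear[OF _ bounded_linear_scaleR_right] Suc.IH)
      (auto simp: Ck_on_Suc simp del: Ck_on.simps)
  ultimately show ?case using Suc assms by (auto simp: Ck_on_Suc simp del: Ck_on.simps intro!:
      ddir_affine(2))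
qed

section \<open>Closure properties of smooth functions\<close>

lemma smooth_on_differentiable: "smooth_on S f \<Longrightarrow> x \<in> S \<Longrightarrow> f differentiable at x"
  by (metis Ck_on_Suc smooth_on_def)

lemma smooth_on_cong: "(\<And>y. y \<in> S \<Longrightarrow> f y = g y) \<Longrightarrow> smooth_on S f \<longleftrightarrow> smooth_on S g"
  unfolding smooth_on_def using Ck_on_cong by blast

lemma smooth_on_subset: "smooth_on S f \<Longrightarrow> open T \<Longrightarrow> T \<subseteq> S \<Longrightarrow> smooth_on T f"
  unfolding smooth_on_def using Ck_on_subset by blast

lemma smooth_on_const: "open S \<Longrightarrow> smooth_on S (\<lambda>_. c)"
  unfolding smooth_on_def using Ck_on_const by blast

lemma smooth_on_add: "smooth_on S f \<Longrightarrow> smooth_on S g \<Longrightarrow> smooth_on S (\<lambda>x. f x + g x)"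
  unfolding smooth_on_def using Ck_on_add by blast

lemma smooth_on_sum: 
  "open S \<Longrightarrow> (\<And>i. i \<in> I \<Longrightarrow> smooth_on S (f i)) \<Longrightarrow> smooth_on S (\<lambda>x. \<Sum>i\<in>I. f i x)"
  unfolding smooth_on_def using Ck_on_sum[of S I _ f] by blast

lemma smooth_on_mult:
  fixes f g :: "'a::euclidean_space \<Rightarrow> 'b::real_normed_algebra"
  shows "smooth_on S f \<Longrightarrow> smooth_on S g \<Longrightarrow> smooth_on S (\<lambda>x. f x * g x)"
  unfolding smooth_on_def using Ck_on_mult by blast

lemma smooth_on_linear: "bounded_linear B \<Longrightarrow> smooth_on S f \<Longrightarrow> smooth_on S (\<lambda>x. B (f x))"
  unfolding smooth_on_def using Ck_on_linear by blast

lemma smooth_on_minus: "smooth_on S f \<Longrightarrow> smooth_on S (\<lambda>x. - f x)"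
  using smooth_on_linear[OF bounded_linear_minus[OF bounded_linear_ident]] .

lemma smooth_on_diff: "smooth_on S f \<Longrightarrow> smooth_on S g \<Longrightarrow> smooth_on S (\<lambda>x. f x - g x)"
  using smooth_on_add[of S f "\<lambda>x. - g x"] smooth_on_minus[of S g] by simp

lemma smooth_on_affine:
  fixes f :: "'a::euclidean_space \<Rightarrow> 'b::real_normed_vector" and A :: "'c::euclidean_space \<Rightarrow> 'a"
  assumes "bounded_linear A" "smooth_on S f" "open T" "\<And>x. x \<in> T \<Longrightarrow> a + A x \<in> S"
  shows "smooth_on T (\<lambda>x. f (a + A x))"
  using assms Ck_on_affine[of S T A a _ f] unfolding smooth_on_def by blast

lemma smooth_on_ddir: "smooth_on S f \<Longrightarrow> v \<in> Basis \<Longrightarrow> smooth_on S (ddir v f)"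
  unfolding smooth_on_def by (metis Ck_on_Suc)

lemma smooth_on_continuous: "smooth_on S f \<Longrightarrow> continuous_on S f"
  unfolding smooth_on_def by (meson Ck_on.simps(1))

lemma smooth_on_ident: "open S \<Longrightarrow> smooth_on S (\<lambda>x. x)"
  unfolding smooth_on_def
proof (intro conjI allI)
  fix k assume S: "open S"
  have "ddir v (\<lambda>x. x) = (\<lambda>_. v)" for v :: 'a
    by (rule ext, rule ddir_eqI[where f'="\<lambda>x. x"]) auto
  thus "Ck_on k S (\<lambda>x. x)" using S
    by (cases k) (auto simp: Ck_on_Suc Ck_on_const simp del: Ck_on.simps(2))
qed

subsection \<open>Symmetry of second derivatives\<close>

lemma has_real_derivative_along:
  fixes f :: "'a::euclidean_space \<Rightarrow> real"
  assumes "f differentiable at (x + t *\<^sub>R v)"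
  shows "((\<lambda>t. f (x + t *\<^sub>R v)) has_real_derivative ddir v f (x + t *\<^sub>R v)) (at t)"
proof -
  have "((\<lambda>t. x + t *\<^sub>R v) has_vector_derivative v) (at t)"
    by (auto intro!: derivative_eq_intros)
  moreover have "(f has_derivative frechet_derivative f (at (x + t *\<^sub>R v))) (at (x + t *\<^sub>R v))"
    using assms by (simp add: frechet_derivative_works)
  ultimately show ?thesis
    using vector_derivative_diff_chain_within[of "\<lambda>t. x + t *\<^sub>R v" v t UNIV f
        "frechet_derivative f (at (x + t *\<^sub>R v))"]
    by (simp add: o_def ddir_def has_real_derivative_iff_has_vector_derivative
        has_derivative_at_withinI)
qed

text \<open>The mean value theorem is applied in direction \<open>u\<close> and then in direction
  \<open>v\<close>. The second difference is symmetric in \<open>u\<close> and \<open>v\<close>, so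
  exchanging them gives a second expression for the same number.\<close>

lemma second_difference:
  fixes f :: "'a::euclidean_space \<Rightarrow> real"
  assumes "h > 0" and f: "smooth_on S f" and "u \<in> Basis"
    and S: "\<And>s t. 0 \<le> s \<Longrightarrow> s \<le> h \<Longrightarrow> 0 \<le> t \<Longrightarrow> t \<le> h \<Longrightarrow> x + s *\<^sub>R u + t *\<^sub>R v \<in> S"
  obtains s t where "0 < s" "s < h" "0 < t" "t < h"
    "f (x + h *\<^sub>R u + h *\<^sub>R v) - f (x + h *\<^sub>R u) - (f (x + h *\<^sub>R v) - f x)
      = h * (h * ddir v (ddir u f) (x + s *\<^sub>R u + t *\<^sub>R v))"
proof -
  define \<phi> where "\<phi> = (\<lambda>s. f (x + h *\<^sub>R v + s *\<^sub>R u) - f (x + s *\<^sub>R u))"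
  have d: "(\<phi> has_real_derivative ddir u f (x + h *\<^sub>R v + s *\<^sub>R u) - ddir u f (x + s *\<^sub>R u)) (at s)"
    if "0 \<le> s" "s \<le> h" for s
    unfolding \<phi>_def using S[of s h] S[of s 0] that \<open>h > 0\<close>
    by (intro DERIV_diff has_real_derivative_along smooth_on_differentiable[OF f]) (auto simp: add_ac)
  obtain s where s: "0 < s" "s < h"
    "\<phi> h - \<phi> 0 = h * (ddir u f (x + h *\<^sub>R v + s *\<^sub>R u) - ddir u f (x + s *\<^sub>R u))"
    using MVT2[OF \<open>h > 0\<close> d] by auto
  have d2: "((\<lambda>t. ddir u f (x + s *\<^sub>R u + t *\<^sub>R v)) has_real_derivative 
      ddir v (ddir u f) (x + s *\<^sub>R u + t *\<^sub>R v)) (at t)" if "0 \<le> t" "t \<le> h" for t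
    using S[of s t] that s
    by (intro has_real_derivative_along smooth_on_differentiable[OF smooth_on_ddir[OF f \<open>u \<in> Basis\<close>]])
        auto
  obtain t where t: "0 < t" "t < h"
    "ddir u f (x + s *\<^sub>R u + h *\<^sub>R v) - ddir u f (x + s *\<^sub>R u) = h * ddir v (ddir u f) (x + s *\<^sub>R u
        + t *\<^sub>R v)"
    using MVT2[OF \<open>h > 0\<close> d2] by auto
  show thesis using s t by (intro that[of s t]) (simp_all add: \<phi>_def add_ac)
qed

lemma ddir_commute_real:
  fixes f :: "'a::euclidean_space \<Rightarrow> real"
  assumes f: "smooth_on S f" and u: "u \<in> Basis" and v: "v \<in> Basis" and x: "x \<in> S"
  shows "ddir u (ddir v f) x = ddir v (ddir u f) x"
proof (rule ccontr)
  assume neq: "\<not> ?thesis"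
  \<comment> \<open>With half the distance, two equal numbers cannot lie within \<open>e\<close> of
    the two different limits.\<close>
  define e where "e = dist (ddir u (ddir v f) x) (ddir v (ddir u f) x) / 2"
  have e: "e > 0" using neq by (simp add: e_def)
  have S: "open S" using f by (simp add: smooth_on_def)
  have "isCont (ddir u (ddir v f)) x" "isCont (ddir v (ddir u f)) x"
    using smooth_on_continuous[OF smooth_on_ddir[OF smooth_on_ddir[OF f]]] u v x S
    by (auto simp: continuous_on_eq_continuous_at)
  then obtain d1 d2 where d: "d1 > 0" "d2 > 0"
     "\<And>y. dist y x < d1 \<Longrightarrow> dist (ddir u (ddir v f) y) (ddir u (ddir v f) x) < e"
     "\<And>y. dist y x < d2 \<Longrightarrow> dist (ddir v (ddir u f) y) (ddir v (ddir u f) x) < e"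
    using e unfolding continuous_at_eps_delta by metis
  obtain d3 where d3: "d3 > 0" "ball x d3 \<subseteq> S" using S x openE by blast
  \<comment> \<open>Points of the square with side \<open>h\<close> are at distance at most
    \<open>s + t\<close>, hence less than \<open>3 * h\<close>, from \<open>x\<close>; this explains
    the divisor 3.\<close>
  define h where "h = min d1 (min d2 d3) / 3"
  have h: "h > 0" using d d3 by (simp add: h_def)
  have near: "dist (x + s *\<^sub>R u + t *\<^sub>R v) x < min d1 (min d2 d3)" if "0 \<le> s" "s \<le> h" "0 \<le> t" "t \<le> h"
      for s t
  proof -
    have "norm (s *\<^sub>R u + t *\<^sub>R v) \<le> s + t"
      using norm_triangle_ineq[of "s *\<^sub>R u" "t *\<^sub>R v"] u v that by simp
    also have "\<dots> < 3 * h" using that h by linarith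
    finally show ?thesis by (simp add: dist_norm h_def)
  qed
  have near_S: "x + s *\<^sub>R u + t *\<^sub>R v \<in> S" if "0 \<le> s" "s \<le> h" "0 \<le> t" "t \<le> h" for s t
    using near[OF that] d3 by (auto simp: dist_commute)
  have near_S': "x + s *\<^sub>R v + t *\<^sub>R u \<in> S" if "0 \<le> s" "s \<le> h" "0 \<le> t" "t \<le> h" for s t
    using near_S[of t s] that by (simp add: add_ac)
  obtain s t where st: "0 < s" "s < h" "0 < t" "t < h"
    "f (x + h *\<^sub>R u + h *\<^sub>R v) - f (x + h *\<^sub>R u) - (f (x + h *\<^sub>R v) - f x)
      = h * (h * ddir v (ddir u f) (x + s *\<^sub>R u + t *\<^sub>R v))"
    using second_difference[OF h f u near_S] .
  obtain t' s' where st': "0 < t'" "t' < h" "0 < s'" "s' < h"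
    "f (x + h *\<^sub>R v + h *\<^sub>R u) - f (x + h *\<^sub>R v) - (f (x + h *\<^sub>R u) - f x)
      = h * (h * ddir u (ddir v f) (x + t' *\<^sub>R v + s' *\<^sub>R u))"
    using second_difference[OF h f v near_S'] .
  have swap: "x + t' *\<^sub>R v + s' *\<^sub>R u = x + s' *\<^sub>R u + t' *\<^sub>R v" by (simp add: add_ac)
  have swap': "x + h *\<^sub>R v + h *\<^sub>R u = x + h *\<^sub>R u + h *\<^sub>R v" by (simp add: add_ac)
  have "h * (h * ddir u (ddir v f) (x + s' *\<^sub>R u + t' *\<^sub>R v)) = h * (h * ddir v (ddir u f) (x + s *\<^sub>R u
      + t *\<^sub>R v))"
    unfolding st(5)[symmetric] using st'(5) unfolding swap swap' by linarith
  hence "ddir u (ddir v f) (x + s' *\<^sub>R u + t' *\<^sub>R v) = ddir v (ddir u f) (x + s *\<^sub>R u + t *\<^sub>R v)"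
    using h by simp
  moreover have "dist (ddir u (ddir v f) (x + s' *\<^sub>R u + t' *\<^sub>R v)) (ddir u (ddir v f) x) < e"
    using near[of s' t'] st' by (intro d) auto
  moreover have "dist (ddir v (ddir u f) (x + s *\<^sub>R u + t *\<^sub>R v)) (ddir v (ddir u f) x) < e"
    using near[of s t] st by (intro d) auto
  ultimately have "dist (ddir u (ddir v f) x) (ddir v (ddir u f) x) < e + e"
    by (metis dist_triangle_less_add dist_commute)
  thus False by (simp add: e_def)
qed

text \<open>The mean value argument is real, so it is applied to real and imaginary parts.\<close>

lemma ddir_commute:
  fixes f :: "'a::euclidean_space \<Rightarrow> complex"
  assumes f: "smooth_on S f" and u: "u \<in> Basis" and v: "v \<in> Basis" and x: "x \<in> S"
  shows "ddir u (ddir v f) x = ddir v (ddir u f) x"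
proof -
  have S: "open S" using f by (simp add: smooth_on_def)
  have *: "B (ddir u (ddir v f) x) = ddir u (ddir v (\<lambda>x. B (f x))) x"
    if B: "bounded_linear B" and u: "u \<in> Basis" and v: "v \<in> Basis" for B :: "complex \<Rightarrow> real" and u v
  proof -
    have "ddir u (ddir v (\<lambda>x. B (f x))) x = ddir u (\<lambda>x. B (ddir v f x)) x"
      by (rule ddir_cong_open[OF S x]) (auto intro: ddir_linear[OF B] smooth_on_differentiable[OF f])
    also have "\<dots> = B (ddir u (ddir v f) x)"
      by (intro ddir_linear[OF B] smooth_on_differentiable[OF smooth_on_ddir[OF f]] v x)
    finally show ?thesis ..
  qed
  have "ddir u (ddir v (\<lambda>x. B (f x))) x = ddir v (ddir u (\<lambda>x. B (f x))) x" if "bounded_linear B"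
      for B :: "complex \<Rightarrow> real"
    by (rule ddir_commute_real[OF smooth_on_linear[OF that f] u v x])
  thus ?thesis using *[OF bounded_linear_Re u v] *[OF bounded_linear_Im u v]
      *[OF bounded_linear_Re v u] *[OF bounded_linear_Im v u]
    by (intro complex_eqI) (simp_all add: bounded_linear_Re bounded_linear_Im)
qed

section \<open>Connections over a ring with commuting derivations\<close>

text \<open>The coordinate functions \<open>coord\<close> only serve to make the action of vector fields on functions faithful.\<close>

locale coordinate_connection =
  fixes d :: "'n::finite \<Rightarrow> 'r::comm_ring_1 \<Rightarrow> 'r"
    and G :: "'n \<Rightarrow> 'n \<Rightarrow> 'r" and \<Gamma> :: "'n \<Rightarrow> 'n \<Rightarrow> 'n \<Rightarrow> 'r" and coord :: "'n \<Rightarrow> 'r"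
  assumes d_add: "d i (f + h) = d i f + d i h"
    and d_mult: "d i (f * h) = d i f * h + f * d i h"
    and d_commute: "d i (d j f) = d j (d i f)"
    and d_coord: "d i (coord j) = (if i = j then 1 else 0)"
    and G_sym: "G i j = G j i" and \<Gamma>_sym: "\<Gamma> a i j = \<Gamma> a j i"
    and d_G: "d b (G i j) = (\<Sum>a\<in>UNIV. \<Gamma> a b i * G a j + \<Gamma> a b j * G i a)"
    and double_eq_0: "(r::'r) + r = 0 \<Longrightarrow> r = 0"
begin

definition sc :: "'r \<Rightarrow> 'r^'n \<Rightarrow> 'r^'n" where "sc f X = (\<chi> i. f * X $ i)"
definition ac :: "'r^'n \<Rightarrow> 'r \<Rightarrow> 'r" where "ac X f = (\<Sum>i\<in>UNIV. X $ i * d i f)"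
definition nbc :: "'n \<Rightarrow> 'r^'n \<Rightarrow> 'r^'n" where
  "nbc b Y = (\<chi> a. d b (Y $ a) + (\<Sum>c\<in>UNIV. \<Gamma> a b c * Y $ c))"
definition nb :: "'r^'n \<Rightarrow> 'r^'n \<Rightarrow> 'r^'n" where
  "nb X Y = (\<chi> a. \<Sum>b\<in>UNIV. X $ b * (d b (Y $ a) + (\<Sum>c\<in>UNIV. \<Gamma> a b c * Y $ c)))"
definition ip :: "'r^'n \<Rightarrow> 'r^'n \<Rightarrow> 'r" where
  "ip X Y = (\<Sum>i\<in>UNIV. \<Sum>j\<in>UNIV. G i j * X $ i * Y $ j)"

lemma d_0: "d i 0 = 0" using d_add[of i 0 0] by simp

lemma d_sum: "d i (sum f I) = (\<Sum>j\<in>I. d i (f j))"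
  by (induction I rule: infinite_finite_induct) (auto simp: d_add d_0)

lemma d_ip: "d b (ip Y Z) = ip (nbc b Y) Z + ip Y (nbc b Z)"
proof -
  have 1: "(\<Sum>i\<in>UNIV. \<Sum>j\<in>UNIV. (\<Sum>a\<in>UNIV. \<Gamma> a b i * G a j) * Y $ i * Z $ j)
     = (\<Sum>i\<in>UNIV. \<Sum>j\<in>UNIV. G i j * (\<Sum>c\<in>UNIV. \<Gamma> i b c * Y $ c) * Z $ j)"
    unfolding sum_distrib_left sum_distrib_right
    by (subst (2) sum.swap, subst sum.swap, subst (2) sum.swap) (simp add: ac_simps)
  have 2: "(\<Sum>i\<in>UNIV. \<Sum>j\<in>UNIV. (\<Sum>a\<in>UNIV. \<Gamma> a b j * G i a) * Y $ i * Z $ j)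
     = (\<Sum>i\<in>UNIV. \<Sum>j\<in>UNIV. G i j * Y $ i * (\<Sum>c\<in>UNIV. \<Gamma> j b c * Z $ c))"
    unfolding sum_distrib_left sum_distrib_right
    by (subst (2) sum.swap) (simp add: ac_simps)
  have "d b (ip Y Z) = (\<Sum>i\<in>UNIV. \<Sum>j\<in>UNIV. (\<Sum>a\<in>UNIV. \<Gamma> a b i * G a j) * Y $ i * Z $ j)
    + (\<Sum>i\<in>UNIV. \<Sum>j\<in>UNIV. (\<Sum>a\<in>UNIV. \<Gamma> a b j * G i a) * Y $ i * Z $ j)
    + (\<Sum>i\<in>UNIV. \<Sum>j\<in>UNIV. G i j * d b (Y $ i) * Z $ j)
    + (\<Sum>i\<in>UNIV. \<Sum>j\<in>UNIV. G i j * Y $ i * d b (Z $ j))"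
    by (simp add: ip_def d_sum d_mult d_G sum.distrib distrib_right distrib_left mult.assoc)
  also have "\<dots> = ip (nbc b Y) Z + ip Y (nbc b Z)"
    unfolding 1 2 by (simp add: ip_def nbc_def sum.distrib distrib_left distrib_right)
  finally show ?thesis .
qed

lemma ip_nb_left: "ip (nb X Y) Z = (\<Sum>b\<in>UNIV. X $ b * ip (nbc b Y) Z)"
proof -
  have "ip (nb X Y) Z = (\<Sum>i\<in>UNIV. \<Sum>j\<in>UNIV. \<Sum>b\<in>UNIV. X $ b * (G i j * nbc b Y $ i * Z $ j))"
    by (simp add: ip_def nb_def nbc_def sum_distrib_left sum_distrib_right ac_simps)
  also have "\<dots> = (\<Sum>b\<in>UNIV. X $ b * ip (nbc b Y) Z)"
    unfolding ip_def sum_distrib_left by (subst (2) sum.swap, subst sum.swap) simp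
  finally show ?thesis .
qed

lemma ip_sym: "ip X Y = ip Y X"
  unfolding ip_def by (subst sum.swap) (simp add: ac_simps G_sym)

text \<open>The second-order part is symmetric in \<open>X\<close> and \<open>Y\<close> by
  \<open>d_commute\<close>, so only the first sum contributes to the commutator.\<close>

lemma ac_ac: "ac X (ac Y f) = (\<Sum>a\<in>UNIV. (\<Sum>b\<in>UNIV. X $ b * d b (Y $ a)) * d a f)
    + (\<Sum>a\<in>UNIV. \<Sum>b\<in>UNIV. X $ b * Y $ a * d b (d a f))"
proof -
  have "ac X (ac Y f) = (\<Sum>b\<in>UNIV. \<Sum>a\<in>UNIV. X $ b * d b (Y $ a) * d a f + X $ b * Y $ a * d b (d a f))"
    by (simp add: ac_def d_sum d_mult sum_distrib_left distrib_left mult.assoc)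
  also have "\<dots> = (\<Sum>a\<in>UNIV. \<Sum>b\<in>UNIV. X $ b * d b (Y $ a) * d a f + X $ b * Y $ a * d b (d a f))"
    by (rule sum.swap)
  finally show ?thesis by (simp add: sum.distrib sum_distrib_right)
qed

sublocale levi_civita sc ac nb ip
proof
  show "sc a (x + y) = sc a x + sc a y" for a x y by (simp add: sc_def vec_eq_iff distrib_left)
  show "sc (a + b) x = sc a x + sc b x" for a b x by (simp add: sc_def vec_eq_iff distrib_right)
  show "sc a (sc b x) = sc (a * b) x" for a b x by (simp add: sc_def vec_eq_iff mult.assoc)
  show "sc 1 x = x" for x by (simp add: sc_def vec_eq_iff)
  show "ac (X + Y) f = ac X f + ac Y f" for X Y f by (simp add: ac_def distrib_right sum.distrib)
  show "ac (sc f X) h = f * ac X h" for f X h by (simp add: ac_def sc_def sum_distrib_left mult.assoc)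
  show "ac X (f + h) = ac X f + ac X h" for f X h by (simp add: ac_def d_add distrib_left sum.distrib)
  show "ac X (f * h) = ac X f * h + f * ac X h" for f X h
    by (simp add: ac_def d_mult distrib_left sum.distrib sum_distrib_left sum_distrib_right ac_simps)
  show "X = 0" if "\<And>f. ac X f = 0" for X
  proof -
    have "X $ i = 0" for i using that[of "coord i"] by (simp add: ac_def d_coord if_distrib cong:
        if_cong)
    thus ?thesis by (simp add: vec_eq_iff)
  qed
  show "nb (X + Y) Z = nb X Z + nb Y Z" for X Y Z
    by (simp add: nb_def vec_eq_iff distrib_right sum.distrib)
  show "nb (sc f X) Z = sc f (nb X Z)" for f X Z
    by (simp add: nb_def sc_def vec_eq_iff sum_distrib_left mult.assoc)
  show "nb X (Y + Z) = nb X Y + nb X Z" for X Y Z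
    by (simp add: nb_def vec_eq_iff d_add distrib_left sum.distrib ac_simps)
  show "nb X (sc f Z) = sc (ac X f) Z + sc f (nb X Z)" for X f Z
    by (simp add: nb_def sc_def ac_def vec_eq_iff d_mult distrib_left sum.distrib sum_distrib_left
      sum_distrib_right ac_simps)
  show "ip (X + Y) Z = ip X Z + ip Y Z" for X Y Z
    by (simp add: ip_def distrib_left distrib_right sum.distrib)
  show "ip (sc f X) Z = f * ip X Z" for f X Z
    by (simp add: ip_def sc_def sum_distrib_left ac_simps)
  show "ip X Y = ip Y X" for X Y by (rule ip_sym)
  show "ac X (ip Y Z) = ip (nb X Y) Z + ip Y (nb X Z)" for X Y Z
    by (simp add: ac_def d_ip ip_nb_left ip_sym[of Y "nb X Z"] ip_sym[of Y
        "nbc _ Z"] distrib_left sum.distrib)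
  show "ac (nb X Y - nb Y X) f = ac X (ac Y f) - ac Y (ac X f)" for X Y f
  proof -
    have "(\<Sum>b\<in>UNIV. X $ b * (\<Sum>c\<in>UNIV. \<Gamma> a b c * Y $ c)) = (\<Sum>b\<in>UNIV. Y $ b * (\<Sum>c\<in>UNIV. \<Gamma> a b c * X $ c))"
        for a
      unfolding sum_distrib_left by (subst sum.swap) (simp add: ac_simps \<Gamma>_sym)
    hence *: "(nb X Y - nb Y X) $ a = (\<Sum>b\<in>UNIV. X $ b * d b (Y $ a)) - (\<Sum>b\<in>UNIV. Y $ b * d b (X $ a))"
        for a
      by (simp add: nb_def distrib_left sum.distrib)
    have "(\<Sum>a\<in>UNIV. \<Sum>b\<in>UNIV. X $ b * Y $ a * d b (d a f)) = (\<Sum>a\<in>UNIV. \<Sum>b\<in>UNIV. Y $ b * X $ a * d b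
        (d a f))"
      by (subst sum.swap) (simp add: ac_simps d_commute)
    moreover have "ac (nb X Y - nb Y X) f = (\<Sum>a\<in>UNIV. ((\<Sum>b\<in>UNIV. X $ b * d b (Y $ a))
        - (\<Sum>b\<in>UNIV. Y $ b * d b (X $ a))) * d a f)"
      by (simp only: ac_def *)
    ultimately show ?thesis by (simp add: ac_ac left_diff_distrib sum_subtractf)
  qed
qed (rule double_eq_0)

lemma Rm_sum:
  "Rm (\<Sum>i\<in>I. sc (f i) (X i)) Y Z T = (\<Sum>i\<in>I. f i * Rm (X i) Y Z T)"
  "Rm Y (\<Sum>i\<in>I. sc (f i) (X i)) Z T = (\<Sum>i\<in>I. f i * Rm Y (X i) Z T)"
  "Rm Y Z (\<Sum>i\<in>I. sc (f i) (X i)) T = (\<Sum>i\<in>I. f i * Rm Y Z (X i) T)"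
  "Rm Y Z T (\<Sum>i\<in>I. sc (f i) (X i)) = (\<Sum>i\<in>I. f i * Rm Y Z T (X i))"
  using Rm_linear(2)[of 0 0 Y Z T] Rm_linear(4)[of Y 0 0 Z T] Rm_linear(6)[of Y Z 0 0 T] Rm_linear(8)[of
      Y Z T 0 0]
  by (induction I rule: infinite_finite_induct) (simp_all add: Rm_linear)

lemma axis_expand: "X = (\<Sum>i\<in>UNIV. sc (X $ i) (axis i 1))"
  by (simp add: vec_eq_iff sc_def axis_def if_distrib cong: if_cong)

lemma Rm_expand: "Rm X Y Z T = (\<Sum>i\<in>UNIV. \<Sum>j\<in>UNIV. \<Sum>k\<in>UNIV. \<Sum>t\<in>UNIV.
    Rm (axis i 1) (axis j 1) (axis k 1) (axis t 1) * X $ i * Y $ j * Z $ k * T $ t)"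
proof -
  have 1: "Rm X Y Z T = (\<Sum>i\<in>UNIV. X $ i * Rm (axis i 1) Y Z T)" for X Y Z T
    by (subst axis_expand[of X]) (rule Rm_sum)
  have 2: "Rm X Y Z T = (\<Sum>i\<in>UNIV. Y $ i * Rm X (axis i 1) Z T)" for X Y Z T
    by (subst axis_expand[of Y]) (rule Rm_sum)
  have 3: "Rm X Y Z T = (\<Sum>i\<in>UNIV. Z $ i * Rm X Y (axis i 1) T)" for X Y Z T
    by (subst axis_expand[of Z]) (rule Rm_sum)
  have 4: "Rm X Y Z T = (\<Sum>i\<in>UNIV. T $ i * Rm X Y Z (axis i 1))" for X Y Z T
    by (subst axis_expand[of T]) (rule Rm_sum)
  show ?thesis
    by (subst 1, subst 2, subst 3, subst 4) (simp add: sum_distrib_left ac_simps)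
qed

text \<open>The classical coordinate formula for the curvature; coordinate fields have bracket zero.
  It links the abstract \<open>Rm\<close> with the component functions of the perturbed
  metric.\<close>

lemma Rm_axis: "Rm (axis i 1) (axis j 1) (axis k 1) (axis t 1) = (\<Sum>a\<in>UNIV. G a t *
    (d i (\<Gamma> a j k) - d j (\<Gamma> a i k) + (\<Sum>c\<in>UNIV. \<Gamma> a i c * \<Gamma> c j k) - (\<Sum>c\<in>UNIV. \<Gamma> a j c * \<Gamma> c i k)))"
proof -
  have d_1: "d i 1 = 0" for i using d_mult[of i 1 1] by simp
  have nb_axis: "nb (axis i 1) Y = nbc i Y" for i Y
    unfolding nb_def nbc_def vec_eq_iff
    by (simp add: axis_def if_distrib[of "\<lambda>x. x * _"] cong: if_cong)
  have nbc_axis: "nbc i (axis j 1) = (\<chi> a. \<Gamma> a i j)" for i j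
    unfolding nbc_def vec_eq_iff
    by (simp add: d_0 d_1 axis_def if_distrib[of "d i"] if_distrib[of "\<lambda>x. _ * x"] cong: if_cong)
  have "br (axis i 1) (axis j 1) = 0" unfolding br_def nb_axis nbc_axis by (simp add: \<Gamma>_sym vec_eq_iff)
  hence "curv (axis i 1) (axis j 1) (axis k 1) = nbc i (\<chi> a. \<Gamma> a j k) - nbc j (\<chi> a. \<Gamma> a i k)"
    unfolding curv_def nb_axis nbc_axis by simp
  also have "\<dots> = (\<chi> a. d i (\<Gamma> a j k) - d j (\<Gamma> a i k) + (\<Sum>c\<in>UNIV. \<Gamma> a i c * \<Gamma> c j k)
      - (\<Sum>c\<in>UNIV. \<Gamma> a j c * \<Gamma> c i k))"
    by (simp add: nbc_def vec_eq_iff)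
  finally show ?thesis
    unfolding Rm_def ip_def by (simp add: axis_def if_distrib[of "\<lambda>x. _ * x"] cong: if_cong)
qed

end

section \<open>Germs modulo the square of the parameter\<close>

abbreviation ds :: "(real \<times> (real^4) \<Rightarrow> 'b::real_normed_vector) \<Rightarrow> real \<times> (real^4) \<Rightarrow> 'b" where
  "ds \<equiv> ddir (1, 0)"
abbreviation dx :: "4 \<Rightarrow> (real \<times> (real^4) \<Rightarrow> 'b::real_normed_vector) \<Rightarrow> real \<times> (real^4) \<Rightarrow> 'b" where
  "dx i \<equiv> ddir (0, axis i 1)"

definition smooth_at :: "'a::euclidean_space \<Rightarrow> ('a \<Rightarrow> 'b::real_normed_vector) \<Rightarrow> bool" where
  "smooth_at p f \<longleftrightarrow> (\<exists>S. smooth_on S f \<and> p \<in> S)"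

lemma smooth_atI: "smooth_on S f \<Longrightarrow> p \<in> S \<Longrightarrow> smooth_at p f"
  by (auto simp: smooth_at_def)

lemma smooth_at_obtain2:
  assumes "smooth_at p f" "smooth_at p g"
  obtains S where "smooth_on S f" "smooth_on S g" "p \<in> S"
proof -
  obtain S T where "smooth_on S f" "smooth_on T g" "p \<in> S" "p \<in> T"
    using assms unfolding smooth_at_def by auto
  moreover from this have "open (S \<inter> T)" by (auto simp: smooth_on_def)
  ultimately show thesis
    by (intro that[of "S \<inter> T"]) (auto intro: smooth_on_subset)
qed

lemma smooth_at_add: "smooth_at p f \<Longrightarrow> smooth_at p g \<Longrightarrow> smooth_at p (\<lambda>x. f x + g x)"
  by (erule smooth_at_obtain2, assumption) (auto simp: smooth_at_def intro: smooth_on_add)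

lemma smooth_at_mult: 
  fixes f g :: "_ \<Rightarrow> 'b::real_normed_algebra"
  shows "smooth_at p f \<Longrightarrow> smooth_at p g \<Longrightarrow> smooth_at p (\<lambda>x. f x * g x)"
  by (erule smooth_at_obtain2, assumption) (auto simp: smooth_at_def intro: smooth_on_mult)

lemma smooth_at_minus: "smooth_at p f \<Longrightarrow> smooth_at p (\<lambda>x. - f x)"
  by (auto simp: smooth_at_def intro: smooth_on_minus)

lemma smooth_at_const: "smooth_at p (\<lambda>_. c)"
  unfolding smooth_at_def by (rule exI[of _ UNIV]) (auto intro: smooth_on_const)

lemma smooth_at_ddir: "smooth_at p f \<Longrightarrow> v \<in> Basis \<Longrightarrow> smooth_at p (ddir v f)"
  by (auto simp: smooth_at_def intro: smooth_on_ddir)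

lemma smooth_at_affine:
  fixes f :: "'a::euclidean_space \<Rightarrow> 'b::real_normed_vector" and A :: "'c::euclidean_space \<Rightarrow> 'a"
  assumes "bounded_linear A" "smooth_at (a + A p) f"
  shows "smooth_at p (\<lambda>x. f (a + A x))"
proof -
  obtain S where S: "smooth_on S f" "a + A p \<in> S" using assms by (auto simp: smooth_at_def)
  define T where "T = (\<lambda>x. a + A x) -` S"
  have "open T" unfolding T_def using S(1) linear_continuous_on[OF assms(1)]
    by (intro open_vimage continuous_intros) (auto simp: smooth_on_def)
  thus ?thesis using smooth_on_affine[OF assms(1) S(1), of T a] S(2)
    by (auto simp: smooth_at_def T_def)
qed

lemma smooth_at_shift: "smooth_at (a + p) f \<Longrightarrow> smooth_at p (\<lambda>x. f (a + x))"
  by (rule smooth_at_affine[OF bounded_linear_ident])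

lemma smooth_at_slice: "smooth_at (0, x) f \<Longrightarrow> smooth_at x (\<lambda>y. f (0, y))"
  using smooth_at_affine[of "\<lambda>y. (0, y)" 0 x f] by (simp add: bounded_linear_Pair bounded_linear_zero
      bounded_linear_ident)

lemma smooth_at_eventually: "smooth_at p f \<Longrightarrow> \<forall>\<^sub>F q in nhds p. smooth_at q f"
  unfolding smooth_at_def eventually_nhds smooth_on_def by blast

lemma eventually_nhds_slice:
  assumes "\<forall>\<^sub>F q in nhds (s::'a::topological_space, x::'b::topological_space). P q"
  shows "\<forall>\<^sub>F y in nhds x. P (s, y)"
proof -
  have "filterlim (\<lambda>y. (s, y)) (nhds (s, x)) (nhds x)"
    by (intro tendsto_intros filterlim_ident)
  thus ?thesis using assms by (rule eventually_compose_filterlim[rotated])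
qed

lemma smooth_at_eventually_slice: "smooth_at (0, x) f \<Longrightarrow> \<forall>\<^sub>F y in nhds x. smooth_at (0, y) f"
  by (rule eventually_nhds_slice[OF smooth_at_eventually])

lemma smooth_on_open: "smooth_on S f \<Longrightarrow> open S"
  by (simp add: smooth_on_def)

lemma smooth_at_cong:
  assumes "smooth_at p f" "\<forall>\<^sub>F q in nhds p. f q = g q" shows "smooth_at p g"
proof -
  obtain S where S: "smooth_on S f" "p \<in> S"
    using assms(1) unfolding smooth_at_def by blast
  obtain T where T: "open T" "p \<in> T" "\<forall>q\<in>T. f q = g q"
    using assms(2)[unfolded eventually_nhds] by (elim exE conjE)
  have "smooth_on (S \<inter> T) f"
    using T(1) smooth_on_open[OF S(1)] by (intro smooth_on_subset[OF S(1)] open_Int) simp_all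
  hence "smooth_on (S \<inter> T) g"
    by (rule smooth_on_cong[THEN iffD1, rotated]) (use T(3) in simp)
  thus ?thesis using S(2) T(2) by (intro smooth_atI[of "S \<inter> T"]) simp_all
qed

lemma smooth_at_differentiable: "smooth_at p f \<Longrightarrow> f differentiable at p"
  by (auto simp: smooth_at_def intro: smooth_on_differentiable)

lemma ddir_cong_nhds:
  assumes "\<forall>\<^sub>F y in nhds x. f y = g y" shows "ddir v f x = ddir v g x"
  using assms unfolding eventually_nhds by (auto intro: ddir_cong_open)

lemma eventually_nhds_ddir_cong:
  assumes "\<forall>\<^sub>F y in nhds x. f y = g y" shows "\<forall>\<^sub>F y in nhds x. ddir v f y = ddir v g y"
  using eventually_eventually[THEN iffD2, OF assms] by eventually_elim (rule ddir_cong_nhds)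

lemma ddir_commute_at:
  fixes f :: "'a::euclidean_space \<Rightarrow> complex"
  shows "smooth_at p f \<Longrightarrow> u \<in> Basis \<Longrightarrow> v \<in> Basis \<Longrightarrow> ddir u (ddir v f) p = ddir v (ddir u f) p"
  by (auto simp: smooth_at_def intro: ddir_commute)

lemma basis_Pair [simp]: "(1::real, 0::real^4) \<in> Basis" "(0::real, axis i 1 :: real^4) \<in> Basis"
  by (auto simp: Basis_prod_def)

lemma ddir_slice: "smooth_at (s, x) f \<Longrightarrow> ddir v (\<lambda>y. f (s, y)) x = ddir (0, v) f (s, x)"
  for f :: "real \<times> (real^4) \<Rightarrow> 'b::real_normed_vector"
  using ddir_affine(1)[of "\<lambda>y. (0, y)" f "(s, 0)" x v]
  by (simp add: bounded_linear_Pair bounded_linear_zero bounded_linear_ident smooth_at_differentiable)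

text \<open>Two functions of the parameter \<open>s\<close> and a point are identified if near the origin they agree at
  \<open>s = 0\<close> together with their derivatives with respect to \<open>s\<close>, i.e. modulo \<open>s\<^sup>2\<close>.\<close>

definition dual_eq :: "(real \<times> (real^4) \<Rightarrow> complex) \<Rightarrow> (real \<times> (real^4) \<Rightarrow> complex) \<Rightarrow> bool" where
  "dual_eq f g \<longleftrightarrow> smooth_at 0 f \<and> smooth_at 0 g \<and>
     (\<forall>\<^sub>F x in nhds 0. f (0, x) = g (0, x) \<and> ds f (0, x) = ds g (0, x))"

\<comment> \<open>The quotient is partial because \<open>dual_eq\<close> is reflexive only on
  functions smooth near the origin. Agreement on a neighbourhood in the slice, instead of at one
  point, makes spatial derivatives well defined.\<close>
quotient_type dual_germ = "real \<times> (real^4) \<Rightarrow> complex" / partial: dual_eq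
proof (rule part_equivpI)
  show "\<exists>x. dual_eq x x" by (rule exI[of _ "\<lambda>_. 0"]) (simp add: dual_eq_def smooth_at_const)
  show "symp dual_eq" by (rule sympI) (auto simp: dual_eq_def elim: eventually_mono)
  show "transp dual_eq" by (rule transpI) (auto simp: dual_eq_def elim: eventually_elim2)
qed

lemma smooth_at_0_slice: "smooth_at 0 f \<Longrightarrow> \<forall>\<^sub>F x in nhds (0::real^4). smooth_at (0::real, x) f"
  using smooth_at_eventually_slice[of 0 f] by (simp add: zero_prod_def)

lemma abs_dual_germ_eq_iff:
  "smooth_at 0 f \<Longrightarrow> smooth_at 0 g \<Longrightarrow> abs_dual_germ f = abs_dual_germ g \<longleftrightarrow> dual_eq f g"
  using Quotient_rel[OF Quotient_dual_germ, of f g] by (simp add: dual_eq_def)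

lemma dual_eq_refl [simp]: "dual_eq f f \<longleftrightarrow> smooth_at 0 f"
  by (simp add: dual_eq_def)

section \<open>Ring structure and derivations on the germs\<close>

instantiation dual_germ :: comm_ring_1
begin

lift_definition zero_dual_germ :: dual_germ is "\<lambda>_. 0" by (simp add: smooth_at_const)
lift_definition one_dual_germ :: dual_germ is "\<lambda>_. 1" by (simp add: smooth_at_const)

lift_definition plus_dual_germ :: "dual_germ \<Rightarrow> dual_germ \<Rightarrow> dual_germ" is "\<lambda>f g x. f x + g x"
proof -
  fix f f' g g' assume "dual_eq f f'" "dual_eq g g'"
  hence s: "smooth_at 0 f" "smooth_at 0 f'" "smooth_at 0 g" "smooth_at 0 g'"
    and e: "\<forall>\<^sub>F x in nhds 0. f (0, x) = f' (0, x) \<and> ds f (0, x) = ds f' (0, x)"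
      "\<forall>\<^sub>F x in nhds 0. g (0, x) = g' (0, x) \<and> ds g (0, x) = ds g' (0, x)" by (auto simp: dual_eq_def)
  have "\<forall>\<^sub>F x in nhds 0. f (0, x) + g (0, x) = f' (0, x) + g' (0, x) \<and>
      ds (\<lambda>x. f x + g x) (0, x) = ds (\<lambda>x. f' x + g' x) (0, x)"
    using e s[THEN smooth_at_0_slice] by eventually_elim (simp add: ddir_add smooth_at_differentiable)
  thus "dual_eq (\<lambda>x. f x + g x) (\<lambda>x. f' x + g' x)" using s by (simp add: dual_eq_def smooth_at_add)
qed

lift_definition times_dual_germ :: "dual_germ \<Rightarrow> dual_germ \<Rightarrow> dual_germ" is "\<lambda>f g x. f x * g x"
proof -
  fix f f' g g' assume "dual_eq f f'" "dual_eq g g'"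
  hence s: "smooth_at 0 f" "smooth_at 0 f'" "smooth_at 0 g" "smooth_at 0 g'"
    and e: "\<forall>\<^sub>F x in nhds 0. f (0, x) = f' (0, x) \<and> ds f (0, x) = ds f' (0, x)"
      "\<forall>\<^sub>F x in nhds 0. g (0, x) = g' (0, x) \<and> ds g (0, x) = ds g' (0, x)" by (auto simp: dual_eq_def)
  have "\<forall>\<^sub>F x in nhds 0. f (0, x) * g (0, x) = f' (0, x) * g' (0, x) \<and>
      ds (\<lambda>x. f x * g x) (0, x) = ds (\<lambda>x. f' x * g' x) (0, x)"
    using e s[THEN smooth_at_0_slice] by eventually_elim (simp add: ddir_mult smooth_at_differentiable)
  thus "dual_eq (\<lambda>x. f x * g x) (\<lambda>x. f' x * g' x)" using s by (simp add: dual_eq_def smooth_at_mult)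
qed

lift_definition uminus_dual_germ :: "dual_germ \<Rightarrow> dual_germ" is "\<lambda>f x. - f x"
proof -
  fix f f' assume "dual_eq f f'"
  hence s: "smooth_at 0 f" "smooth_at 0 f'"
    and e: "\<forall>\<^sub>F x in nhds 0. f (0, x) = f' (0, x) \<and> ds f (0, x) = ds f' (0, x)"
        by (auto simp: dual_eq_def)
  have "\<forall>\<^sub>F x in nhds 0. - f (0, x) = - f' (0, x) \<and> ds (\<lambda>x. - f x) (0, x) = ds (\<lambda>x. - f' x) (0, x)"
    using e s[THEN smooth_at_0_slice]
    by eventually_elim (simp add: ddir_linear[OF bounded_linear_minus[OF bounded_linear_ident]]
        smooth_at_differentiable)
  thus "dual_eq (\<lambda>x. - f x) (\<lambda>x. - f' x)" using s by (simp add: dual_eq_def smooth_at_minus)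
qed

definition minus_dual_germ :: "dual_germ \<Rightarrow> dual_germ \<Rightarrow> dual_germ" where
  "minus_dual_germ a b = a + - b"

instance
proof
  fix a b c :: dual_germ
  show "a - b = a + - b" by (simp add: minus_dual_germ_def)
  show "a * b * c = a * (b * c)"
    by (induction a; induction b; induction c)
      (simp add: times_dual_germ.abs_eq smooth_at_mult mult.assoc)
  show "a * b = b * a"
    by (induction a; induction b) (simp add: times_dual_germ.abs_eq mult.commute)
  show "1 * a = a" 
    by (induction a) (simp add: times_dual_germ.abs_eq one_dual_germ_def smooth_at_const)
  show "a + b + c = a + (b + c)"
    by (induction a; induction b; induction c)
      (simp add: plus_dual_germ.abs_eq smooth_at_add add.assoc)
  show "a + b = b + a"
    by (induction a; induction b) (simp add: plus_dual_germ.abs_eq add.commute)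
  show "0 + a = a" 
    by (induction a) (simp add: plus_dual_germ.abs_eq zero_dual_germ_def smooth_at_const)
  show "- a + a = 0"
    by (induction a) (simp add: plus_dual_germ.abs_eq uminus_dual_germ.abs_eq zero_dual_germ_def
      smooth_at_minus)
  show "(a + b) * c = a * c + b * c"
    by (induction a; induction b; induction c)
      (simp add: plus_dual_germ.abs_eq times_dual_germ.abs_eq smooth_at_add smooth_at_mult
          distrib_right)
  show "(0::dual_germ) \<noteq> 1"
    by (simp add: zero_dual_germ_def one_dual_germ_def abs_dual_germ_eq_iff dual_eq_def smooth_at_const)
qed

end


text \<open>Only spatial derivatives descend: the derivative in \<open>s\<close> takes
  \<open>s^2\<close> to \<open>2 s\<close>. Well-definedness uses that \<open>ds\<close> and
  \<open>dx i\<close> commute, so that \<open>ds (dx i f)\<close> on the slice is a derivative of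
  \<open>ds f\<close> along the slice.\<close>

lift_definition dual_deriv :: "4 \<Rightarrow> dual_germ \<Rightarrow> dual_germ" is "\<lambda>i. dx i"
proof -
  fix i f f' assume "dual_eq f f'"
  hence s: "smooth_at 0 f" "smooth_at 0 f'"
    and e: "\<forall>\<^sub>F x in nhds 0. f (0, x) = f' (0, x)" "\<forall>\<^sub>F x in nhds 0. ds f (0, x) = ds f' (0, x)"
    by (auto simp: dual_eq_def elim: eventually_mono)
  have "\<forall>\<^sub>F x in nhds 0. dx i f (0, x) = dx i f' (0, x) \<and> ds (dx i f) (0, x) = ds (dx i f') (0, x)"
    using e[THEN eventually_nhds_ddir_cong, of "axis i 1"] s[THEN smooth_at_0_slice]
    by eventually_elim (simp add: ddir_slice smooth_at_ddir ddir_commute_at[of _ _ "(1, 0)"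
        "(0, axis i 1)"])
  thus "dual_eq (dx i f) (dx i f')" using s by (simp add: dual_eq_def smooth_at_ddir)
qed

text \<open>The type of germs cannot depend on the base point, so germs at \<open>(0, x)\<close> are
  translated to the origin.\<close>

definition jet :: "real^4 \<Rightarrow> (real \<times> (real^4) \<Rightarrow> complex) \<Rightarrow> dual_germ" where
  "jet x f = abs_dual_germ (\<lambda>p. f ((0, x) + p))"

lemma smooth_at_jet: "smooth_at (0, x) f \<Longrightarrow> smooth_at 0 (\<lambda>p. f ((0, x) + p))"
  by (rule smooth_at_shift) simp

lemma ddir_shift: "smooth_at (a + p) f \<Longrightarrow> ddir v (\<lambda>p. f (a + p)) p = ddir v f (a + p)"
  using ddir_affine(1)[OF bounded_linear_ident smooth_at_differentiable] by blast

lemma eventually_nhds_shift: "(\<forall>\<^sub>F y in nhds (0::'a::real_normed_vector). P (x + y))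
    \<longleftrightarrow> (\<forall>\<^sub>F y in nhds x. P y)"
proof
  assume "\<forall>\<^sub>F y in nhds 0. P (x + y)"
  moreover have "((\<lambda>y. y - x) \<longlongrightarrow> x - x) (nhds x)" by (intro tendsto_intros filterlim_ident)
  ultimately show "\<forall>\<^sub>F y in nhds x. P y"
    using eventually_compose_filterlim[of "\<lambda>y. P (x + y)" "nhds 0" "\<lambda>y. y - x" "nhds x"] by simp
next
  assume "\<forall>\<^sub>F y in nhds x. P y"
  moreover have "((\<lambda>y. x + y) \<longlongrightarrow> x + 0) (nhds 0)" by (intro tendsto_intros filterlim_ident)
  ultimately show "\<forall>\<^sub>F y in nhds 0. P (x + y)"
    using eventually_compose_filterlim[of P "nhds x" "\<lambda>y. x + y" "nhds 0"] by simp
qed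

lemma jet_eq_iff:
  assumes "smooth_at (0, x) f" "smooth_at (0, x) g"
  shows "jet x f = jet x g \<longleftrightarrow> (\<forall>\<^sub>F y in nhds x. f (0, y) = g (0, y) \<and> ds f (0, y) = ds g (0, y))"
proof -
  have "jet x f = jet x g \<longleftrightarrow> (\<forall>\<^sub>F y in nhds 0. f (0, x + y) = g (0, x + y) \<and>
      ds (\<lambda>p. f ((0, x) + p)) (0, y) = ds (\<lambda>p. g ((0, x) + p)) (0, y))"
    unfolding jet_def using assms[THEN smooth_at_jet] by (simp add: abs_dual_germ_eq_iff)
        (simp add: dual_eq_def)
  also have "\<dots> \<longleftrightarrow> (\<forall>\<^sub>F y in nhds 0. f (0, x + y) = g (0, x + y) \<and> ds f (0, x + y) = ds g (0, x + y))"
  proof (rule eventually_cong)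
    show "\<forall>\<^sub>F y in nhds 0. smooth_at (0, x + y) f \<and> smooth_at (0, x + y) g"
      unfolding eventually_nhds_shift[of "\<lambda>y. smooth_at (0, y) f \<and> smooth_at (0, y) g"]
      using assms[THEN smooth_at_eventually_slice] by eventually_elim simp
  qed (simp add: ddir_shift)
  also have "\<dots> \<longleftrightarrow> (\<forall>\<^sub>F y in nhds x. f (0, y) = g (0, y) \<and> ds f (0, y) = ds g (0, y))"
    by (rule eventually_nhds_shift)
  finally show ?thesis .
qed

lemma jet_cong: 
  assumes "smooth_at (0, x) f" "\<forall>\<^sub>F p in nhds (0, x). f p = g p"
  shows "jet x f = jet x g"
proof -
  have g: "smooth_at (0, x) g" using assms by (rule smooth_at_cong)
  show ?thesis
    using assms(2)[THEN eventually_nhds_slice] assms(2)[THEN eventually_nhds_ddir_cong, THEN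
        eventually_nhds_slice]
    unfolding jet_eq_iff[OF assms(1) g] by eventually_elim simp
qed

lemma jet_cases: obtains f where "smooth_at (0, x) f" "a = jet x f"
proof (induction a)
  case (1 f)
  show ?case
  proof (rule 1(2))
    show "smooth_at (0, x) (\<lambda>p. f (- (0, x) + p))"
      using 1(1) by (intro smooth_at_shift) (simp add: zero_prod_def)
    show "abs_dual_germ f = jet x (\<lambda>p. f (- (0, x) + p))"
      by (simp only: jet_def minus_add_cancel)
  qed
qed

lemma jet_add: "smooth_at (0, x) f \<Longrightarrow> smooth_at (0, x) g \<Longrightarrow> jet x (\<lambda>p. f p + g p) = jet x f + jet x g"
  unfolding jet_def by (simp add: plus_dual_germ.abs_eq smooth_at_jet)

lemma jet_mult: "smooth_at (0, x) f \<Longrightarrow> smooth_at (0, x) g \<Longrightarrow> jet x (\<lambda>p. f p * g p) = jet x f * jet x g"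
  unfolding jet_def by (simp add: times_dual_germ.abs_eq smooth_at_jet)

lemma jet_minus: "smooth_at (0, x) f \<Longrightarrow> jet x (\<lambda>p. - f p) = - jet x f"
  unfolding jet_def by (simp add: uminus_dual_germ.abs_eq smooth_at_jet)

lemma jet_diff: "smooth_at (0, x) f \<Longrightarrow> smooth_at (0, x) g \<Longrightarrow> jet x (\<lambda>p. f p - g p) = jet x f - jet x g"
  using jet_add[of x f "\<lambda>p. - g p"] by (simp add: jet_minus smooth_at_minus)

lemma jet_0 [simp]: "jet x (\<lambda>p. 0) = 0" and jet_1 [simp]: "jet x (\<lambda>p. 1) = 1"
  by (simp_all add: jet_def zero_dual_germ_def one_dual_germ_def)

lemma jet_numeral [simp]: "jet x (\<lambda>p. numeral n) = numeral n"
proof -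
  have "jet x (\<lambda>p. of_nat k) = of_nat k" for k
    by (induction k) (simp_all add: jet_add smooth_at_const)
  from this[of "numeral n"] show ?thesis by simp
qed

lemma smooth_at_sum:
  "(\<And>i. i \<in> I \<Longrightarrow> smooth_at p (f i)) \<Longrightarrow> smooth_at p (\<lambda>x. \<Sum>i\<in>I. f i x)"
  by (induction I rule: infinite_finite_induct) (auto intro: smooth_at_const smooth_at_add)

lemma jet_sum:
  "(\<And>i. i \<in> I \<Longrightarrow> smooth_at (0, x) (f i)) \<Longrightarrow> jet x (\<lambda>p. \<Sum>i\<in>I. f i p) = (\<Sum>i\<in>I. jet x (f i))"
  by (induction I rule: infinite_finite_induct) (auto simp: jet_add smooth_at_sum)

lemma dual_deriv_jet:
  assumes "smooth_at (0, x) f"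
  shows "dual_deriv i (jet x f) = jet x (dx i f)"
proof -
  have "\<forall>\<^sub>F p in nhds 0. dx i (\<lambda>p. f ((0, x) + p)) p = dx i f ((0, x) + p)"
    unfolding eventually_nhds_shift[of "\<lambda>q. dx i (\<lambda>p. f ((0, x) + p)) (q - (0, x)) = dx i f q"
        "(0, x)", simplified]
    using smooth_at_eventually[OF assms] by eventually_elim (simp add: ddir_shift)
  hence "jet 0 (dx i (\<lambda>p. f ((0, x) + p))) = jet 0 (\<lambda>p. dx i f ((0, x) + p))"
    using assms by (intro jet_cong) (auto intro!: smooth_at_ddir smooth_at_jet simp flip: zero_prod_def)
  thus ?thesis
    using assms by (simp add: jet_def dual_deriv.abs_eq smooth_at_jet flip: zero_prod_def)
qed

lemma dual_deriv_add: "dual_deriv i (a + b) = dual_deriv i a + dual_deriv i b"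
proof -
  obtain f g where f: "smooth_at (0, 0) f" "a = jet 0 f" and g: "smooth_at (0, 0) g" "b = jet 0 g"
    by (meson jet_cases)
  have "jet 0 (\<lambda>p. dx i f p + dx i g p) = jet 0 (dx i (\<lambda>p. f p + g p))"
    using f g smooth_at_eventually[OF f(1)] smooth_at_eventually[OF g(1)]
    by (intro jet_cong) (auto intro!: smooth_at_add smooth_at_ddir simp: ddir_add
        smooth_at_differentiable elim: eventually_elim2)
  thus ?thesis using f g by (simp add: dual_deriv_jet smooth_at_add smooth_at_ddir flip: jet_add)
qed

lemma dual_deriv_mult: "dual_deriv i (a * b) = dual_deriv i a * b + a * dual_deriv i b"
proof -
  obtain f g where f: "smooth_at (0, 0) f" "a = jet 0 f" and g: "smooth_at (0, 0) g" "b = jet 0 g"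
    by (meson jet_cases)
  have "jet 0 (\<lambda>p. dx i f p * g p + f p * dx i g p) = jet 0 (dx i (\<lambda>p. f p * g p))"
    using f g smooth_at_eventually[OF f(1)] smooth_at_eventually[OF g(1)]
    by (intro jet_cong) (auto intro!: smooth_at_add smooth_at_mult smooth_at_ddir simp: ddir_mult
        smooth_at_differentiable elim: eventually_elim2)
  thus ?thesis using f g 
    by (simp add: dual_deriv_jet smooth_at_mult smooth_at_ddir flip: jet_add jet_mult)
qed

lemma dual_deriv_commute: "dual_deriv i (dual_deriv j a) = dual_deriv j (dual_deriv i a)"
proof -
  obtain f where f: "smooth_at (0, 0) f" "a = jet 0 f" by (meson jet_cases)
  have "jet 0 (dx i (dx j f)) = jet 0 (dx j (dx i f))"
    using f smooth_at_eventually[OF f(1)]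
    by (intro jet_cong) (auto intro!: smooth_at_ddir ddir_commute_at elim: eventually_mono)
  thus ?thesis using f by (simp add: dual_deriv_jet smooth_at_ddir)
qed

lemma smooth_at_linear: "bounded_linear B \<Longrightarrow> smooth_at p f \<Longrightarrow> smooth_at p (\<lambda>x. B (f x))"
  by (auto simp: smooth_at_def intro: smooth_on_linear)

lemma smooth_at_ident: "smooth_at p (\<lambda>x. x)"
  by (auto simp: smooth_at_def intro!: exI[of _ UNIV] smooth_on_ident)

definition dual_coord :: "real^4 \<Rightarrow> 4 \<Rightarrow> dual_germ" where
  "dual_coord x j = jet x (\<lambda>p. of_real (snd p $ j))"

lemma ddir_bounded_linear: "bounded_linear B \<Longrightarrow> ddir v B p = B v"
  by (rule ddir_eqI[OF bounded_linear_imp_has_derivative])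

lemma smooth_at_bounded_linear: "bounded_linear B \<Longrightarrow> smooth_at p B"
  using smooth_at_linear[OF _ smooth_at_ident] .

lemma bounded_linear_coord: "bounded_linear (\<lambda>p::real \<times> (real^4). complex_of_real (snd p $ j))"
  by (intro bounded_linear_compose[OF bounded_linear_of_real] bounded_linear_compose[OF
      bounded_linear_vec_nth] bounded_linear_snd)

lemma dual_deriv_coord: "dual_deriv i (dual_coord x j) = (if i = j then 1 else 0)"
proof -
  have "dx i (\<lambda>p. complex_of_real (snd p $ j)) = (\<lambda>p. if i = j then 1 else 0)"
    using ddir_bounded_linear[OF bounded_linear_coord[of j]] by (auto simp: fun_eq_iff axis_def)
  thus ?thesis
    unfolding dual_coord_def
    by (simp add: dual_deriv_jet smooth_at_bounded_linear bounded_linear_coord)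
qed

lemma dual_germ_numeral_cancel:
  fixes r :: dual_germ
  assumes "numeral k * r = 0" shows "r = 0"
proof -
  have "jet 0 (\<lambda>p. inverse (numeral k)) * numeral k = jet 0 (\<lambda>p. inverse (numeral k) * numeral k)"
    by (subst jet_mult) (simp_all add: smooth_at_const)
  hence "jet 0 (\<lambda>p. inverse (numeral k)) * numeral k = 1" by simp
  hence "r = jet 0 (\<lambda>p. inverse (numeral k)) * (numeral k * r)" by (simp flip: mult.assoc)
  thus ?thesis using assms by simp
qed

text \<open>The germ of the parameter \<open>s\<close>, the nilpotent generator of the dual numbers.
  It is the element \<open>e\<close> of \<open>teukolsky\<close>.\<close>

definition eps :: "real^4 \<Rightarrow> dual_germ" where
  "eps x = jet x (\<lambda>p. of_real (fst p))"

lemma bounded_linear_fst_complex: "bounded_linear (\<lambda>p::real \<times> (real^4). complex_of_real (fst p))"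
  by (intro bounded_linear_compose[OF bounded_linear_of_real] bounded_linear_fst)

lemma dual_deriv_eps: "dual_deriv i (eps x) = 0"
proof -
  have "dx i (\<lambda>p. complex_of_real (fst p)) = (\<lambda>p. 0)"
    using ddir_bounded_linear[OF bounded_linear_fst_complex] by (auto simp: fun_eq_iff)
  thus ?thesis
    unfolding eps_def by (simp add: dual_deriv_jet smooth_at_bounded_linear bounded_linear_fst_complex)
qed

lemma ds_eps_mult: "f differentiable at (0, y) \<Longrightarrow> ds (\<lambda>p. complex_of_real (fst p) * f p) (0, y)
    = f (0, y)"
  using ddir_bounded_linear[OF bounded_linear_fst_complex]
  by (simp add: ddir_mult smooth_at_differentiable[OF smooth_at_bounded_linear[OF
      bounded_linear_fst_complex]])

text \<open>The product with \<open>s\<close> vanishes at \<open>s = 0\<close>, and its derivative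
  there is the old value. A factor \<open>eps\<close> thus forgets exactly the first-order
  part.\<close>

lemma eps_mult_jet_eq_iff:
  assumes "smooth_at (0, x) f" "smooth_at (0, x) g"
  shows "eps x * jet x f = eps x * jet x g \<longleftrightarrow> (\<forall>\<^sub>F y in nhds x. f (0, y) = g (0, y))"
proof -
  note s = smooth_at_bounded_linear[OF bounded_linear_fst_complex]
  have "eps x * jet x f = eps x * jet x g \<longleftrightarrow>
    jet x (\<lambda>p. of_real (fst p) * f p) = jet x (\<lambda>p. of_real (fst p) * g p)"
    using assms by (simp add: eps_def jet_mult s)
  also have "\<dots> \<longleftrightarrow> (\<forall>\<^sub>F y in nhds x. ds (\<lambda>p. complex_of_real (fst p) * f p) (0, y)
      = ds (\<lambda>p. complex_of_real (fst p) * g p) (0, y))"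
    using assms by (subst jet_eq_iff) (simp_all add: smooth_at_mult s)
  also have "\<dots> \<longleftrightarrow> (\<forall>\<^sub>F y in nhds x. f (0, y) = g (0, y))"
  proof (rule eventually_cong)
    show "\<forall>\<^sub>F y in nhds x. smooth_at (0, y) f \<and> smooth_at (0, y) g"
      using assms[THEN smooth_at_eventually_slice] by eventually_elim simp
  qed (simp add: ds_eps_mult smooth_at_differentiable)
  finally show ?thesis .
qed

lemma eps_mult_jet_eq_0_iff:
  assumes "smooth_at (0, x) f"
  shows "eps x * jet x f = 0 \<longleftrightarrow> (\<forall>\<^sub>F y in nhds x. f (0, y) = 0)"
  using eps_mult_jet_eq_iff[OF assms smooth_at_const[of _ 0]] by simp

lemma smooth_at_base:
  fixes f :: "real^4 \<Rightarrow> 'b::real_normed_vector"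
  shows "smooth_at x f \<Longrightarrow> smooth_at (s::real, x) (\<lambda>p. f (snd p))"
  using smooth_at_affine[of snd 0 "(s, x)" f] by (simp add: bounded_linear_snd)

lemma ddir_base: 
  fixes f :: "real^4 \<Rightarrow> 'b::real_normed_vector"
  shows "smooth_at (snd p) f \<Longrightarrow> ddir v (\<lambda>p. f (snd p)) (p::real \<times> (real^4)) = ddir (snd v) f (snd p)"
  using ddir_affine(1)[of "snd :: real \<times> (real^4) \<Rightarrow> _" f 0 p v]
      by (simp add: bounded_linear_snd smooth_at_differentiable)

text \<open>First-order Taylor expansion in \<open>s\<close>. With
  \<open>eps_mult_jet_eq_0_iff\<close> it shows that the annihilator of \<open>eps\<close> is the
  ideal generated by \<open>eps\<close>.\<close>

lemma jet_eps_factor: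
  assumes "smooth_at (0, x) f" "\<forall>\<^sub>F y in nhds x. f (0, y) = 0"
  shows "jet x f = eps x * jet x (\<lambda>p. ds f (0, snd p))"
proof -
  note s = smooth_at_bounded_linear[OF bounded_linear_fst_complex]
  have b: "smooth_at x (\<lambda>y. ds f (0, y))" by (intro smooth_at_slice smooth_at_ddir assms) simp
  have *: "ds (\<lambda>p. complex_of_real (fst p) * ds f (0, snd p)) (0, y) = ds f (0, y)"
    if "smooth_at y (\<lambda>y. ds f (0, y))" for y
    using ds_eps_mult[OF smooth_at_differentiable[OF smooth_at_base[OF that, of 0]]] by simp
  have "\<forall>\<^sub>F y in nhds x. f (0, y) = of_real (fst (0::real, y)) * ds f (0, snd (0::real, y)) \<and>
     ds f (0, y) = ds (\<lambda>p. of_real (fst p) * ds f (0, snd p)) (0, y)"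
    using assms(2) smooth_at_eventually[OF b]
    by eventually_elim (simp add: *)
  hence "jet x f = jet x (\<lambda>p. of_real (fst p) * ds f (0, snd p))"
    using assms(1) by (subst jet_eq_iff) (auto intro!: smooth_at_mult s smooth_at_base b)
  thus ?thesis by (simp add: eps_def jet_mult s smooth_at_base[OF b])
qed

lemma eps_div: "eps x * r = 0 \<Longrightarrow> \<exists>y. r = eps x * y"
  by (rule jet_cases[of x r]) (auto simp: eps_mult_jet_eq_0_iff intro: jet_eps_factor)

section \<open>The inverse metric in terms of a tetrad\<close>

lemma matrix_inv_eqI:
  fixes G :: "'a::field^'n^'n"
  assumes "K ** G = mat 1" shows "matrix_inv G = K"
proof -
  have 1: "G ** K = mat 1" using assms by (simp add: matrix_left_right_inverse)
  have "G ** matrix_inv G = mat 1 \<and> matrix_inv G ** G = mat 1"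
    unfolding matrix_inv_def by (rule someI[of _ K]) (simp add: assms 1)
  hence "matrix_inv G = matrix_inv G ** (G ** K)" by (simp add: 1)
  also have "\<dots> = K" using \<open>_ \<and> _\<close> by (simp add: matrix_mul_assoc)
  finally show ?thesis .
qed

lemma inner_g_sym: "transpose G = G \<Longrightarrow> inner_g G u v = inner_g G v u"
  unfolding inner_g_def
  by (subst sum.swap) (simp add: transpose_def vec_eq_iff ac_simps)

text \<open>With the tetrad as rows of \<open>W\<close>, the Gram matrix is the permutation matrix
  \<open>S\<close>, which is its own inverse. Solving for the inverse of \<open>Gc\<close> gives
  \<open>transpose W ** S ** W\<close>, whose entries are the displayed sums.\<close>

lemma tetrad_dual_basis:
  assumes t: "tetrad_at G u v" and G: "transpose G = G"
  shows "(\<Sum>j\<in>UNIV. (u $ i * cnj (u $ j) + cnj (u $ i) * u $ j + v $ i * cnj (v $ j)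
      + cnj (v $ i) * v $ j)
    * of_real (G $ j $ k)) = (if i = k then 1 else 0)"
proof -
  define W :: "complex^4^4" where "W = vector [u, conj_vec u, v, conj_vec v]"
  define S :: "complex^4^4" where "S = vector [axis 2 1, axis 1 1, axis 4 1, axis 3 1]"
  define Gc :: "complex^4^4" where "Gc = (\<chi> i j. of_real (G $ i $ j))"
  have W: "W $ 1 = u" "W $ 2 = conj_vec u" "W $ 3 = v" "W $ 4 = conj_vec v"
    by (simp_all add: W_def vector_def)
  have S: "S $ 1 = axis 2 1" "S $ 2 = axis 1 1" "S $ 3 = axis 4 1" "S $ 4 = axis 3 1"
    by (simp_all add: S_def vector_def)
  have inner: "(W ** Gc ** transpose W) $ a $ b = inner_g G (W $ a) (W $ b)" for a b
    by (simp add: matrix_matrix_mult_def inner_g_def Gc_def transpose_def sum_4 algebra_simps)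
  have "W ** Gc ** transpose W = S"
    unfolding vec_eq_iff inner forall_4 using t G
    by (simp add: W S tetrad_at_def axis_def inner_g_sym[OF G, of "conj_vec u" u] inner_g_sym[OF G, of v
        u]
      inner_g_sym[OF G, of "conj_vec v" u] inner_g_sym[OF G, of v "conj_vec u"]
      inner_g_sym[OF G, of "conj_vec v" "conj_vec u"] inner_g_sym[OF G, of "conj_vec v" v])
  moreover have "S ** S = mat 1"
    unfolding vec_eq_iff forall_4 matrix_matrix_mult_def by (simp add: S mat_def axis_def sum_4)
  ultimately have "(S ** W ** Gc) ** transpose W = mat 1"
    by (simp add: matrix_mul_assoc[symmetric])
  hence "transpose W ** (S ** W ** Gc) = mat 1"
    by (simp add: matrix_left_right_inverse)
  hence *: "(transpose W ** S ** W) ** Gc = mat 1"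
    by (simp add: matrix_mul_assoc)
  have "(transpose W ** S ** W) $ i $ j = 
    u $ i * cnj (u $ j) + cnj (u $ i) * u $ j + v $ i * cnj (v $ j) + cnj (v $ i) * v $ j" for j
    unfolding matrix_matrix_mult_def transpose_def
    by (simp add: sum_4 W S axis_def conj_vec_def)
  hence "((transpose W ** S ** W) ** Gc) $ i $ k = (\<Sum>j\<in>UNIV. (u $ i * cnj (u $ j) + cnj (u $ i) * u $ j
      + v $ i * cnj (v $ j) + cnj (v $ i) * v $ j)
    * of_real (G $ j $ k))"
    unfolding matrix_matrix_mult_def[of _ Gc] by (simp add: Gc_def)
  thus ?thesis unfolding * by (simp add: mat_def)
qed

text \<open>The inverse metric becomes a polynomial in the tetrad and its conjugate. This yields the
  smoothness of \<open>Ki\<close> as well as completeness of the frame over the ring. The sum is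
  real because its terms form conjugate pairs.\<close>

lemma tetrad_matrix_inv:
  assumes t: "tetrad_at G u v" and G: "transpose G = G"
  shows "matrix_inv G ** G = mat 1"
    and "complex_of_real (matrix_inv G $ i $ j) =
      u $ i * cnj (u $ j) + cnj (u $ i) * u $ j + v $ i * cnj (v $ j) + cnj (v $ i) * v $ j"
proof -
  define K where "K = (\<lambda>i j. u $ i * cnj (u $ j) + cnj (u $ i) * u $ j + v $ i * cnj (v $ j)
      + cnj (v $ i) * v $ j)"
  have K: "K i j = of_real (Re (K i j))" for i j
    by (simp add: complex_eq_iff K_def)
  define R :: "real^4^4" where "R = (\<chi> i j. Re (K i j))"
  have KG: "(\<Sum>j\<in>UNIV. K i j * of_real (G $ j $ k)) = (if i = k then 1 else 0)" for i k
    unfolding K_def by (rule tetrad_dual_basis[OF t G])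
  have "complex_of_real ((R ** G) $ i $ k) = (if i = k then 1 else 0)" for i k
    using KG[of i k] by (simp add: matrix_matrix_mult_def R_def flip: K)
  hence "complex_of_real ((R ** G) $ i $ k) = complex_of_real (mat 1 $ i $ k)" for i k
    by (simp add: mat_def)
  hence "(R ** G) $ i $ k = mat 1 $ i $ k" for i k
    by (simp only: of_real_eq_iff)
  hence RG: "R ** G = mat 1" by (simp add: vec_eq_iff)
  show "matrix_inv G ** G = mat 1" "complex_of_real (matrix_inv G $ i $ j) =
      u $ i * cnj (u $ j) + cnj (u $ i) * u $ j + v $ i * cnj (v $ j) + cnj (v $ i) * v $ j"
    unfolding matrix_inv_eqI[OF RG] using RG K[of i j, symmetric]
        by (simp_all add: R_def) (simp add: K_def)
qed

section \<open>Coordinate components of a perturbed metric\<close>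

lemma partial_eq_ddir: "partial i f = ddir (axis i 1) f"
  by (simp add: fun_eq_iff partial_def ddir_def)

lemma partial_const [simp]: "partial i (\<lambda>_. c) x = 0"
  unfolding partial_eq_ddir by (rule ddir_eqI[where f' = "\<lambda>_. 0"]) auto

lemma smooth_on_dx: "smooth_on S f \<Longrightarrow> smooth_on S (dx i f)"
  by (rule smooth_on_ddir) simp_all

lemma smooth_on_half: "smooth_on S f \<Longrightarrow> smooth_on S (\<lambda>x. f x / 2 :: real)"
  by (rule smooth_on_linear[OF bounded_linear_divide])

lemma smooth_on_nth: "smooth_on S f \<Longrightarrow> smooth_on S (\<lambda>x. f x $ i)"
  by (rule smooth_on_linear[OF bounded_linear_vec_nth])

lemma smooth_on_of_real: "smooth_on S f \<Longrightarrow> smooth_on S (\<lambda>x. complex_of_real (f x))"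
  by (rule smooth_on_linear[OF bounded_linear_of_real])

lemma has_vector_derivative_matrix:
  fixes F :: "real \<Rightarrow> real^'n^'m"
  assumes "\<And>i j. ((\<lambda>s. F s $ i $ j) has_vector_derivative D $ i $ j) (at s)"
  shows "(F has_vector_derivative D) (at s)"
  unfolding has_vector_derivative_def has_derivative_componentwise_within[of F]
  using assms by (auto simp: Basis_vec_def inner_axis has_vector_derivative_def)

text \<open>The situation in a single chart: \<open>U0\<close> is the coordinate region of the
  chart, \<open>\<Omega>\<close> the domain of the tetrad family, and \<open>U\<close> the part of
  the slice \<open>s = 0\<close> on which the equations are considered.\<close>

locale tetrad_perturbation =
  fixes g h :: "real^4 \<Rightarrow> real^4^4" and U0 U :: "(real^4) set" and \<Omega> :: "(real \<times> (real^4)) set"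
    and L M :: "real \<times> (real^4) \<Rightarrow> complex^4"
  assumes smooth_g: "smooth_on U0 g" and smooth_h: "smooth_on U0 h"
    and sym_g: "y \<in> U0 \<Longrightarrow> transpose (g y) = g y" and sym_h: "y \<in> U0 \<Longrightarrow> transpose (h y) = h y"
    and smooth_L: "smooth_on \<Omega> L" and smooth_M: "smooth_on \<Omega> M"
    and \<Omega>_U0: "(s, y) \<in> \<Omega> \<Longrightarrow> y \<in> U0"
    and tetrad_\<Omega>: "(s, y) \<in> \<Omega> \<Longrightarrow> tetrad_at (perturbed g h s y) (L (s, y)) (M (s, y))"
    and open_U: "open U" and U_\<Omega>: "y \<in> U \<Longrightarrow> (0, y) \<in> \<Omega>"
    and ricci_0: "y \<in> U \<Longrightarrow> ricci g y = 0"
    and linearized_ricci_0: "y \<in> U \<Longrightarrow> linearized_ricci g h y = 0"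
begin

definition gs :: "real \<times> (real^4) \<Rightarrow> real^4^4" where "gs p = perturbed g h (fst p) (snd p)"

lemma perturbed_eq: "perturbed g h s = (\<lambda>y. gs (s, y))"
  by (simp add: gs_def fun_eq_iff)

lemma open_\<Omega>: "open \<Omega>" using smooth_L by (rule smooth_on_open)

lemma smooth_gs: "smooth_on \<Omega> (\<lambda>p. gs p $ i $ j)"
proof -
  have base: "smooth_on \<Omega> (\<lambda>p. f (snd p))" if "smooth_on U0 f" for f :: "real^4 \<Rightarrow> real^4^4"
    using smooth_on_affine[OF bounded_linear_snd that open_\<Omega>, of 0] \<Omega>_U0 by auto
  have "smooth_on \<Omega> (\<lambda>p. g (snd p) $ i $ j + fst p * h (snd p) $ i $ j)"
    by (intro smooth_on_add smooth_on_mult smooth_on_nth base smooth_g smooth_h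
      smooth_on_linear[OF bounded_linear_fst smooth_on_ident] open_\<Omega>)
  thus ?thesis by (simp add: gs_def perturbed_def)
qed

lemma gs_sym: "p \<in> \<Omega> \<Longrightarrow> gs p $ i $ j = gs p $ j $ i"
proof -
  assume "p \<in> \<Omega>"
  hence "transpose (g (snd p)) $ i $ j = g (snd p) $ i $ j" "transpose (h (snd p)) $ i $ j
      = h (snd p) $ i $ j"
    using \<Omega>_U0[of "fst p" "snd p"] sym_g sym_h by auto
  thus ?thesis by (simp add: gs_def perturbed_def transpose_def)
qed

lemma gs_transpose: "p \<in> \<Omega> \<Longrightarrow> transpose (gs p) = gs p"
  by (simp add: vec_eq_iff transpose_def gs_sym)

lemma tetrad_gs: "p \<in> \<Omega> \<Longrightarrow> tetrad_at (gs p) (L p) (M p)"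
  using tetrad_\<Omega>[of "fst p" "snd p"] by (simp add: gs_def)

definition Ki :: "4 \<Rightarrow> 4 \<Rightarrow> real \<times> (real^4) \<Rightarrow> real" where "Ki i j p = matrix_inv (gs p) $ i $ j"

lemma Ki_tetrad: "p \<in> \<Omega> \<Longrightarrow> complex_of_real (Ki i j p) =
   L p $ i * cnj (L p $ j) + cnj (L p $ i) * L p $ j + M p $ i * cnj (M p $ j)
       + cnj (M p $ i) * M p $ j"
  unfolding Ki_def by (rule tetrad_matrix_inv(2)[OF tetrad_gs gs_transpose])

lemma smooth_cnj: "smooth_on S f \<Longrightarrow> smooth_on S (\<lambda>x. cnj (f x))"
  by (rule smooth_on_linear[OF bounded_linear_cnj])

lemma smooth_LM: "smooth_on \<Omega> (\<lambda>p. L p $ i)" "smooth_on \<Omega> (\<lambda>p. M p $ i)"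
  by (intro smooth_on_nth smooth_L smooth_M)+

lemma smooth_Ki: "smooth_on \<Omega> (Ki i j)"
proof -
  let ?f = "\<lambda>p. L p $ i * cnj (L p $ j) + cnj (L p $ i) * L p $ j + M p $ i * cnj (M p $ j)
      + cnj (M p $ i) * M p $ j"
  have "smooth_on \<Omega> (\<lambda>p. Re (?f p))"
    by (intro smooth_on_linear[OF bounded_linear_Re] smooth_on_add smooth_on_mult smooth_cnj smooth_LM)
  moreover have "Re (?f p) = Ki i j p" if "p \<in> \<Omega>" for p
    by (subst Ki_tetrad[OF that, symmetric]) simp
  ultimately show ?thesis using smooth_on_cong[of \<Omega> "\<lambda>p. Re (?f p)" "Ki i j"] by simp
qed

lemma Ki_inverse:
  assumes "p \<in> \<Omega>"
  shows "(\<Sum>n\<in>UNIV. Ki i n p * gs p $ n $ j) = (if i = j then 1 else 0)"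
    and "(\<Sum>n\<in>UNIV. gs p $ i $ n * Ki n j p) = (if i = j then 1 else 0)"
proof -
  have 1: "matrix_inv (gs p) ** gs p = mat 1"
    by (rule tetrad_matrix_inv(1)[OF tetrad_gs gs_transpose]) (use assms in auto)
  hence 2: "gs p ** matrix_inv (gs p) = mat 1" by (simp add: matrix_left_right_inverse)
  have "(matrix_inv (gs p) ** gs p) $ i $ j = (if i = j then 1 else 0)"
    "(gs p ** matrix_inv (gs p)) $ i $ j = (if i = j then 1 else 0)"
    unfolding 1 2 by (simp_all add: mat_def)
  thus "(\<Sum>n\<in>UNIV. Ki i n p * gs p $ n $ j) = (if i = j then 1 else 0)"
     "(\<Sum>n\<in>UNIV. gs p $ i $ n * Ki n j p) = (if i = j then 1 else 0)"
    by (simp_all add: matrix_matrix_mult_def Ki_def)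
qed

lemma dx_slice: "smooth_on \<Omega> f \<Longrightarrow> (s, x) \<in> \<Omega> \<Longrightarrow> partial i (\<lambda>y. f (s, y)) x = dx i f (s, x)"
  unfolding partial_eq_ddir by (rule ddir_slice[OF smooth_atI])

lemma open_slice: "open {y. (s, y) \<in> \<Omega>}"
  using open_vimage[OF open_\<Omega>, of "\<lambda>y. (s, y)"] by (simp add: vimage_def continuous_intros)

lemma partial_cong_slice:
  assumes "smooth_on \<Omega> f" "(s, x) \<in> \<Omega>" "\<And>y. (s, y) \<in> \<Omega> \<Longrightarrow> F y = f (s, y)"
  shows "partial i F x = dx i f (s, x)"
proof -
  have "partial i F x = partial i (\<lambda>y. f (s, y)) x"
    unfolding partial_eq_ddir by (rule ddir_cong_open[OF open_slice[of s]]) (use assms in auto)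
  thus ?thesis using dx_slice[OF assms(1,2)] by simp
qed

section \<open>Christoffel symbols and curvature of the perturbed metric\<close>

definition dg :: "4 \<Rightarrow> 4 \<Rightarrow> 4 \<Rightarrow> real \<times> (real^4) \<Rightarrow> real" where
  "dg i j k = dx i (\<lambda>p. gs p $ j $ k)"

definition Chr :: "4 \<Rightarrow> 4 \<Rightarrow> 4 \<Rightarrow> real \<times> (real^4) \<Rightarrow> real" where
  "Chr k i j p = (\<Sum>n\<in>UNIV. Ki k n p * (dg i j n p + dg j i n p - dg n i j p)) / 2"

lemma christoffel_eq: "(s, x) \<in> \<Omega> \<Longrightarrow> christoffel (perturbed g h s) k i j x = Chr k i j (s, x)"
  unfolding christoffel_def Chr_def perturbed_eq dg_def Ki_def by (simp add: dx_slice[OF smooth_gs])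

lemma smooth_dg: "smooth_on \<Omega> (dg i j k)"
  unfolding dg_def by (intro smooth_on_dx smooth_gs)

lemma smooth_Chr: "smooth_on \<Omega> (Chr k i j)"
  unfolding Chr_def[abs_def]
  by (intro smooth_on_half smooth_on_sum smooth_on_mult smooth_on_add smooth_on_diff smooth_Ki smooth_dg
      open_\<Omega>)

lemma dg_sym: "p \<in> \<Omega> \<Longrightarrow> dg i j k p = dg i k j p"
  unfolding dg_def by (rule ddir_cong_open[OF open_\<Omega>]) (auto simp: gs_sym)

lemma Chr_sym: "p \<in> \<Omega> \<Longrightarrow> Chr k i j p = Chr k j i p"
  unfolding Chr_def using dg_sym[of p _ i j] by (simp add: ac_simps)

lemma Chr_lower: "p \<in> \<Omega> \<Longrightarrow> (\<Sum>a\<in>UNIV. gs p $ t $ a * Chr a i j p) = (dg i j t p + dg j i t p - dg t i j p)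
    / 2"
proof -
  assume p: "p \<in> \<Omega>"
  have "(\<Sum>a\<in>UNIV. gs p $ t $ a * Chr a i j p) =
     (\<Sum>n\<in>UNIV. (\<Sum>a\<in>UNIV. gs p $ t $ a * Ki a n p) * ((dg i j n p + dg j i n p - dg n i j p) / 2))"
    unfolding Chr_def sum_distrib_right sum_distrib_left sum_divide_distrib
    by (subst sum.swap) (simp add: mult.assoc)
  also have "\<dots> = (dg i j t p + dg j i t p - dg t i j p) / 2"
    by (simp only: Ki_inverse[OF p] mult_delta_left mult_1_left sum.delta' finite UNIV_I if_True)
  finally show ?thesis .
qed

lemma metric_compatible:
  "p \<in> \<Omega> \<Longrightarrow> dg b i j p = (\<Sum>a\<in>UNIV. Chr a b i p * gs p $ a $ j + Chr a b j p * gs p $ i $ a)"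
  using Chr_lower[of p j b i] Chr_lower[of p i b j] dg_sym[of p b i j] dg_sym[of p i b j] dg_sym[of p j
      b i]
  by (simp add: sum.distrib gs_sym[of p _ j] mult.commute[of "Chr _ _ _ _"])

definition RmC :: "4 \<Rightarrow> 4 \<Rightarrow> 4 \<Rightarrow> 4 \<Rightarrow> real \<times> (real^4) \<Rightarrow> real" where
  "RmC i j k t p = (\<Sum>a\<in>UNIV. gs p $ a $ t * (dx i (Chr a j k) p - dx j (Chr a i k) p
     + (\<Sum>c\<in>UNIV. Chr a i c p * Chr c j k p) - (\<Sum>c\<in>UNIV. Chr a j c p * Chr c i k p)))"

lemma smooth_RmC: "smooth_on \<Omega> (RmC i j k t)"
  unfolding RmC_def[abs_def]
  by (intro smooth_on_sum smooth_on_mult smooth_on_add smooth_on_diff smooth_gs smooth_on_dx smooth_Chr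
      open_\<Omega>)

lemma riemann_comp_eq:
  assumes p: "(s, x) \<in> \<Omega>"
  shows "riemann_comp (perturbed g h s) x i j k t = RmC i j k t (s, x)"
proof -
  let ?g = "perturbed g h s"
  have axis_mult: "(\<Sum>c\<in>UNIV. f c * axis k (1::real) $ c) = f k" "(\<Sum>c\<in>UNIV. axis k (1::real) $ c * f c)
      = f k" for f :: "4 \<Rightarrow> real" and k
    by (simp_all add: axis_def if_distrib[of "\<lambda>x. _ * x"] if_distrib[of "\<lambda>x. x * _"] cong: if_cong)
  have nab: "nabla ?g (coord_field i) Y y $ a = partial i (\<lambda>y. Y y $ a) y
      + (\<Sum>c\<in>UNIV. christoffel ?g a i c y * Y y $ c)"
    for i a y and Y :: "real^4 \<Rightarrow> real^4"
    unfolding nabla_def coord_field_def by (simp add: axis_mult)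
  have nab1: "nabla ?g (coord_field j) (coord_field k) y $ a = christoffel ?g a j k y" for j k a y
    unfolding nab by (simp add: coord_field_def axis_mult)
  have nab2: "nabla ?g (coord_field i) (nabla ?g (coord_field j) (coord_field k)) x $ a
    = dx i (Chr a j k) (s, x) + (\<Sum>c\<in>UNIV. Chr a i c (s, x) * Chr c j k (s, x))" for i j a
    unfolding nab[of i "nabla ?g (coord_field j) (coord_field k)"] nab1
    by (simp add: christoffel_eq p partial_cong_slice[OF smooth_Chr p christoffel_eq])
  have "lie_bracket (coord_field i) (coord_field j) = (\<lambda>x. 0 :: real^4)"
    by (simp add: lie_bracket_def coord_field_def vec_eq_iff fun_eq_iff)
  hence nab0: "nabla ?g (lie_bracket (coord_field i) (coord_field j)) (coord_field k) x = (0 :: real^4)"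
    by (simp add: nabla_def vec_eq_iff)
  have inner: "inner_g G V (coord_field t x) = (\<Sum>a\<in>UNIV. G $ a $ t * V $ a)" for G and V :: "real^4"
    unfolding inner_g_def coord_field_def
    by (simp add: axis_def if_distrib[of "\<lambda>x. _ * x"] cong: if_cong)
  have "gs (s, x) = ?g x" by (simp add: gs_def)
  thus ?thesis
    unfolding riemann_comp_def riemann_def nab0 inner by (simp add: nab2 RmC_def diff_add_eq add_diff_eq
        diff_diff_add[symmetric])
qed

definition RicC :: "4 \<Rightarrow> 4 \<Rightarrow> real \<times> (real^4) \<Rightarrow> real" where
  "RicC j k p = (\<Sum>a\<in>UNIV. \<Sum>b\<in>UNIV. Ki a b p * RmC a j k b p)"

lemma smooth_RicC: "smooth_on \<Omega> (RicC j k)"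
  unfolding RicC_def[abs_def] by (intro smooth_on_sum smooth_on_mult smooth_Ki smooth_RmC open_\<Omega>)

lemma ricci_eq: "(s, x) \<in> \<Omega> \<Longrightarrow> ricci (perturbed g h s) x $ j $ k = RicC j k (s, x)"
  by (simp add: ricci_def RicC_def riemann_comp_eq Ki_def) (simp add: perturbed_eq)

lemma RicC_0: "y \<in> U \<Longrightarrow> RicC j k (0, y) = 0"
  using ricci_eq[OF U_\<Omega>, of y j k] ricci_0[of y] by (simp add: perturbed_def)

section \<open>The linearized Ricci equation as a derivative in the parameter\<close>

lemma has_vector_derivative_ds:
  assumes "smooth_at (0, y) f"
  shows "((\<lambda>s. f (s, y)) has_vector_derivative ds f (0, y)) (at 0)"
proof -
  have "((\<lambda>s. (s, y)) has_vector_derivative (1, 0)) (at 0)"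
    by (auto intro!: derivative_eq_intros)
  moreover have "(f has_derivative frechet_derivative f (at (0, y))) (at (0, y))"
    using smooth_at_differentiable[OF assms] by (simp add: frechet_derivative_works)
  ultimately show ?thesis
    using vector_derivative_diff_chain_within[of "\<lambda>s. (s, y)" "(1, 0)" 0 UNIV f
        "frechet_derivative f (at (0, y))"]
    by (simp add: o_def ddir_def has_derivative_at_withinI)
qed

lemma has_vector_derivative_ds_cong:
  assumes "smooth_on \<Omega> f" "y \<in> U" "\<And>s. (s, y) \<in> \<Omega> \<Longrightarrow> F s = f (s, y)"
  shows "(F has_vector_derivative ds f (0, y)) (at 0)"
proof -
  have "open ((\<lambda>s. (s, y)) -` \<Omega>)" by (intro open_vimage open_\<Omega> continuous_intros)
  moreover have "0 \<in> (\<lambda>s. (s, y)) -` \<Omega>" using U_\<Omega>[OF assms(2)] by simp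
  ultimately show ?thesis
    using has_vector_derivative_transform_within_open[OF has_vector_derivative_ds[OF smooth_atI[OF
        assms(1) U_\<Omega>[OF assms(2)]]]]
      assms(3) by (metis vimageE)
qed

lemma ds_RicC_0: "y \<in> U \<Longrightarrow> ds (RicC j k) (0, y) = 0"
proof -
  assume y: "y \<in> U"
  have "((\<lambda>s. ricci (perturbed g h s) y) has_vector_derivative (\<chi> j k. ds (RicC j k) (0, y))) (at 0)"
    by (rule has_vector_derivative_matrix)
      (simp, rule has_vector_derivative_ds_cong[OF smooth_RicC y], simp add: ricci_eq)
  hence "linearized_ricci g h y = (\<chi> j k. ds (RicC j k) (0, y))"
    unfolding linearized_ricci_def by (rule vector_derivative_at)
  thus ?thesis using linearized_ricci_0[OF y] by (simp add: vec_eq_iff)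
qed

end

section \<open>The null frame of a family of tetrads\<close>

locale tetrad_perturbation_at = tetrad_perturbation +
  fixes x :: "real^4" assumes x_U: "x \<in> U"
begin

definition jetR :: "(real \<times> (real^4) \<Rightarrow> real) \<Rightarrow> dual_germ" where
  "jetR f = jet x (\<lambda>p. complex_of_real (f p))"

lemma smooth_at_\<Omega>: "smooth_on \<Omega> f \<Longrightarrow> smooth_at (0, x) f"
  using U_\<Omega>[OF x_U] by (rule smooth_atI[rotated])

lemma eventually_\<Omega>: "\<forall>\<^sub>F p in nhds (0, x). p \<in> \<Omega>"
  using open_\<Omega> U_\<Omega>[OF x_U] by (rule eventually_nhds_in_open)

lemma eventually_U: "\<forall>\<^sub>F y in nhds x. y \<in> U"
  using open_U x_U by (rule eventually_nhds_in_open)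

lemma jet_cong_\<Omega>: "smooth_on \<Omega> f \<Longrightarrow> (\<And>p. p \<in> \<Omega> \<Longrightarrow> f p = f' p) \<Longrightarrow> jet x f = jet x f'"
  by (intro jet_cong smooth_at_\<Omega> eventually_mono[OF eventually_\<Omega>])

lemma jetR_cong: "smooth_on \<Omega> f \<Longrightarrow> (\<And>p. p \<in> \<Omega> \<Longrightarrow> f p = f' p) \<Longrightarrow> jetR f = jetR f'"
  unfolding jetR_def by (rule jet_cong_\<Omega>) (auto intro: smooth_on_of_real)

lemma smooth_at_jetR: "smooth_on \<Omega> f \<Longrightarrow> smooth_at (0, x) (\<lambda>p. complex_of_real (f p))"
  by (intro smooth_at_\<Omega> smooth_on_of_real)

lemma jetR_add: "smooth_on \<Omega> f \<Longrightarrow> smooth_on \<Omega> f' \<Longrightarrow> jetR (\<lambda>p. f p + f' p) = jetR f + jetR f'"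
  by (simp add: jetR_def jet_add smooth_at_jetR)

lemma jetR_diff: "smooth_on \<Omega> f \<Longrightarrow> smooth_on \<Omega> f' \<Longrightarrow> jetR (\<lambda>p. f p - f' p) = jetR f - jetR f'"
  by (simp add: jetR_def jet_diff smooth_at_jetR)

lemma jetR_mult: "smooth_on \<Omega> f \<Longrightarrow> smooth_on \<Omega> f' \<Longrightarrow> jetR (\<lambda>p. f p * f' p) = jetR f * jetR f'"
  by (simp add: jetR_def jet_mult smooth_at_jetR)

lemma jetR_sum: "(\<And>i. i \<in> I \<Longrightarrow> smooth_on \<Omega> (f i)) \<Longrightarrow> jetR (\<lambda>p. \<Sum>i\<in>I. f i p) = (\<Sum>i\<in>I. jetR (f i))"
  by (simp add: jetR_def jet_sum smooth_at_jetR)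

lemma jetR_dx: "smooth_on \<Omega> f \<Longrightarrow> dual_deriv i (jetR f) = jetR (dx i f)"
  unfolding jetR_def
  by (simp add: dual_deriv_jet smooth_at_jetR)
    (auto intro!: jet_cong_\<Omega> smooth_on_dx smooth_on_of_real ddir_linear bounded_linear_of_real
        smooth_on_differentiable)

lemmas smooth_rules = smooth_on_sum smooth_on_mult smooth_on_add smooth_on_diff smooth_gs smooth_Ki
    smooth_dg
  smooth_Chr smooth_RmC smooth_RicC open_\<Omega> smooth_on_dx

sublocale coordinate_connection dual_deriv "\<lambda>i j. jetR (\<lambda>p. gs p $ i $ j)" "\<lambda>k i j. jetR (Chr k i j)"
    "dual_coord x"
proof
  fix i j a b and f f' r :: dual_germ
  show "dual_deriv i (f + f') = dual_deriv i f + dual_deriv i f'" by (rule dual_deriv_add)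
  show "dual_deriv i (f * f') = dual_deriv i f * f' + f * dual_deriv i f'" by (rule dual_deriv_mult)
  show "dual_deriv i (dual_deriv j f) = dual_deriv j (dual_deriv i f)" by (rule dual_deriv_commute)
  show "dual_deriv i (dual_coord x j) = (if i = j then 1 else 0)" by (rule dual_deriv_coord)
  show "jetR (\<lambda>p. gs p $ i $ j) = jetR (\<lambda>p. gs p $ j $ i)"
    by (intro jetR_cong smooth_gs) (rule gs_sym)
  show "jetR (Chr a i j) = jetR (Chr a j i)"
    by (intro jetR_cong smooth_Chr) (rule Chr_sym)
  have "dual_deriv b (jetR (\<lambda>p. gs p $ i $ j)) = jetR (dg b i j)"
    by (simp add: jetR_dx smooth_gs dg_def)
  also have "\<dots> = jetR (\<lambda>p. \<Sum>a\<in>UNIV. Chr a b i p * gs p $ a $ j + Chr a b j p * gs p $ i $ a)"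
    by (intro jetR_cong smooth_dg metric_compatible)
  also have "\<dots> = (\<Sum>a\<in>UNIV. jetR (Chr a b i) * jetR (\<lambda>p. gs p $ a $ j) + jetR (Chr a b j) * jetR
      (\<lambda>p. gs p $ i $ a))"
    by (simp add: jetR_sum jetR_add jetR_mult smooth_rules)
  finally show "dual_deriv b (jetR (\<lambda>p. gs p $ i $ j)) =
      (\<Sum>a\<in>UNIV. jetR (Chr a b i) * jetR (\<lambda>p. gs p $ a $ j) + jetR (Chr a b j) * jetR (\<lambda>p. gs p $ i $
          a))" .
  assume "r + r = 0"
  hence "2 * r = 0" by (simp only: mult_2)
  thus "r = 0" by (rule dual_germ_numeral_cancel)
qed

lemma Rm_jet: "Rm (axis i 1) (axis j 1) (axis k 1) (axis t 1) = jetR (RmC i j k t)"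
  unfolding Rm_axis RmC_def[abs_def]
  by (simp add: jetR_sum jetR_add jetR_diff jetR_mult jetR_dx smooth_rules)

text \<open>The two Ricci hypotheses meet here: the equation for \<open>g\<close> kills the value at
  \<open>s = 0\<close> and the linearized equation kills the derivative in \<open>s\<close>.\<close>

lemma jetR_RicC: "jetR (RicC j k) = 0"
proof -
  have "jetR (RicC j k) = jet x (\<lambda>_. 0)"
    unfolding jetR_def
  proof (subst jet_eq_iff)
    have "ds (\<lambda>p. complex_of_real (RicC j k p)) (0, y) = 0" if "y \<in> U" for y
      using ddir_linear[OF bounded_linear_of_real smooth_on_differentiable[OF smooth_RicC U_\<Omega>[OF that]],
          of "(1, 0)" j k]
        ds_RicC_0[OF that] by simp
    moreover have "ds (\<lambda>p. 0 :: complex) p = 0" for p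
      by (rule ddir_eqI[where f' = "\<lambda>_. 0"]) auto
    ultimately show "\<forall>\<^sub>F y in nhds x. complex_of_real (RicC j k (0, y)) = 0 \<and>
        ds (\<lambda>p. complex_of_real (RicC j k p)) (0, y) = ds (\<lambda>p. 0) (0, y)"
      using eventually_U by (auto elim!: eventually_mono simp: RicC_0)
  qed (auto intro!: smooth_at_jetR smooth_RicC smooth_at_const)
  thus ?thesis by simp
qed

definition jetV :: "(real \<times> (real^4) \<Rightarrow> complex^4) \<Rightarrow> dual_germ^4" where
  "jetV u = (\<chi> i. jet x (\<lambda>p. u p $ i))"

lemma ip_jetV:
  assumes "\<And>i. smooth_on \<Omega> (\<lambda>p. u p $ i)" "\<And>i. smooth_on \<Omega> (\<lambda>p. v p $ i)"
  shows "ip (jetV u) (jetV v) = jet x (\<lambda>p. inner_g (gs p) (u p) (v p))"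
  unfolding ip_def unfolding inner_g_def jetV_def jetR_def using assms
  by (simp add: jet_sum jet_mult smooth_at_\<Omega> smooth_on_of_real smooth_rules)

abbreviation "Lc \<equiv> \<lambda>p. conj_vec (L p)"
abbreviation "Mc \<equiv> \<lambda>p. conj_vec (M p)"

lemma smooth_frame: "smooth_on \<Omega> (\<lambda>p. L p $ i)" "smooth_on \<Omega> (\<lambda>p. M p $ i)"
  "smooth_on \<Omega> (\<lambda>p. Lc p $ i)" "smooth_on \<Omega> (\<lambda>p. Mc p $ i)"
  by (auto intro: smooth_LM smooth_cnj simp: conj_vec_def)

lemma jetR_Ki: "jetR (Ki i j) = jetV L $ i * jetV Lc $ j + jetV Lc $ i * jetV L $ j
    + jetV M $ i * jetV Mc $ j + jetV Mc $ i * jetV M $ j"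
proof -
  have "jetR (Ki i j) = jet x (\<lambda>p. L p $ i * Lc p $ j + Lc p $ i * L p $ j + M p $ i * Mc p $ j
      + Mc p $ i * M p $ j)"
    unfolding jetR_def by (intro jet_cong_\<Omega> smooth_on_of_real smooth_Ki) (simp add: Ki_tetrad
        conj_vec_def)
  thus ?thesis
    by (simp add: jetV_def jet_add jet_mult smooth_at_\<Omega> smooth_frame smooth_rules)
qed

lemma jet_inner_const:
  assumes "\<And>i. smooth_on \<Omega> (\<lambda>p. u p $ i)" "\<And>i. smooth_on \<Omega> (\<lambda>p. v p $ i)"
    "\<And>p. p \<in> \<Omega> \<Longrightarrow> inner_g (gs p) (u p) (v p) = c"
  shows "ip (jetV u) (jetV v) = jet x (\<lambda>_. c)"
  unfolding ip_jetV[OF assms(1,2)] using assms(3)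
  by (intro jet_cong_\<Omega>) (auto simp: inner_g_def intro!: smooth_on_of_real assms smooth_rules)

sublocale vacuum_frame sc ac nb ip "jetV L" "jetV Lc" "jetV M" "jetV Mc"
proof
  note t = tetrad_gs[unfolded tetrad_at_def]
  show "ip (jetV L) (jetV L) = 0" by (subst jet_inner_const[where c=0]) (auto simp: smooth_frame t)
  show "ip (jetV L) (jetV Lc) = 1" by (subst jet_inner_const[where c=1]) (auto simp: smooth_frame t)
  show "ip (jetV L) (jetV M) = 0" by (subst jet_inner_const[where c=0]) (auto simp: smooth_frame t)
  show "ip (jetV L) (jetV Mc) = 0" by (subst jet_inner_const[where c=0]) (auto simp: smooth_frame t)
  show "ip (jetV Lc) (jetV Lc) = 0" by (subst jet_inner_const[where c=0]) (auto simp: smooth_frame t)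
  show "ip (jetV Lc) (jetV M) = 0" by (subst jet_inner_const[where c=0]) (auto simp: smooth_frame t)
  show "ip (jetV Lc) (jetV Mc) = 0" by (subst jet_inner_const[where c=0]) (auto simp: smooth_frame t)
  show "ip (jetV M) (jetV M) = 0" by (subst jet_inner_const[where c=0]) (auto simp: smooth_frame t)
  show "ip (jetV M) (jetV Mc) = 1" by (subst jet_inner_const[where c=1]) (auto simp: smooth_frame t)
  show "ip (jetV Mc) (jetV Mc) = 0" by (subst jet_inner_const[where c=0]) (auto simp: smooth_frame t)
next
  fix X
  \<comment> \<open>Lowering and then raising the index of \<open>X\<close> is the identity. With
    \<open>Ki\<close> written through the tetrad, this becomes the frame expansion of
    \<open>X\<close>.\<close>
  have delta: "(\<Sum>b\<in>UNIV. jetR (\<lambda>p. gs p $ a $ b) * jetR (Ki b i)) = (if a = i then 1 else 0)" for a i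
  proof -
    have "(\<Sum>b\<in>UNIV. jetR (\<lambda>p. gs p $ a $ b) * jetR (Ki b i)) = jetR (\<lambda>p. \<Sum>b\<in>UNIV. gs p $ a $ b * Ki b i
        p)"
      by (simp add: jetR_sum jetR_mult smooth_rules)
    also have "\<dots> = jetR (\<lambda>_. if a = i then 1 else 0)"
      by (intro jetR_cong) (auto intro!: smooth_rules simp: Ki_inverse)
    finally show ?thesis by (simp add: jetR_def)
  qed
  have "(\<Sum>a\<in>UNIV. X $ a * (\<Sum>b\<in>UNIV. jetR (\<lambda>p. gs p $ a $ b) * jetR (Ki b i))) = X $ i" for i
    unfolding delta by (simp add: if_distrib[of "\<lambda>x. _ * x"] cong: if_cong)
  moreover have "(\<Sum>a\<in>UNIV. X $ a * (\<Sum>b\<in>UNIV. jetR (\<lambda>p. gs p $ a $ b) * jetR (Ki b i)))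
      = ip X (jetV Lc) * jetV L $ i + ip X (jetV L) * jetV Lc $ i
      + ip X (jetV Mc) * jetV M $ i + ip X (jetV M) * jetV Mc $ i" for i
    unfolding jetR_Ki ip_def
    by (simp add: sum_distrib_left sum_distrib_right sum.distrib distrib_left distrib_right ac_simps)
  ultimately show "X = sc (ip X (jetV Lc)) (jetV L) + sc (ip X (jetV L)) (jetV Lc)
      + sc (ip X (jetV Mc)) (jetV M) + sc (ip X (jetV M)) (jetV Mc)"
    by (simp add: vec_eq_iff sc_def)
next
  fix Y Z
  \<comment> \<open>The factor \<open>X $ a * T $ b\<close> is isolated so that the four frame terms
    add up to \<open>Ki a b\<close>, and the trace becomes the Ricci germ.\<close>
  have 1: "Rm X Y Z T = (\<Sum>j\<in>UNIV. \<Sum>k\<in>UNIV. \<Sum>a\<in>UNIV. \<Sum>b\<in>UNIV. (X $ a * T $ b) * (jetR (RmC a j k b) * Y $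
      j * Z $ k))" for X T
  proof -
    have "Rm X Y Z T = (\<Sum>a\<in>UNIV. \<Sum>j\<in>UNIV. \<Sum>k\<in>UNIV. \<Sum>b\<in>UNIV. (X $ a * T $ b) * (jetR (RmC a j k b) * Y $
        j * Z $ k))"
      unfolding Rm_expand[of X] Rm_jet by (simp add: ac_simps)
    also have "\<dots> = (\<Sum>j\<in>UNIV. \<Sum>k\<in>UNIV. \<Sum>a\<in>UNIV. \<Sum>b\<in>UNIV. (X $ a * T $ b) * (jetR (RmC a j k b) * Y $ j
        * Z $ k))"
      by (rule trans[OF sum.swap], rule sum.cong[OF refl], rule sum.swap)
    finally show ?thesis .
  qed
  have "(\<Sum>a\<in>UNIV. \<Sum>b\<in>UNIV. jetR (Ki a b) * jetR (RmC a j k b)) = 0" for j k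
  proof -
    have "(\<Sum>a\<in>UNIV. \<Sum>b\<in>UNIV. jetR (Ki a b) * jetR (RmC a j k b)) = jetR (RicC j k)"
      unfolding RicC_def[abs_def] by (simp add: jetR_sum jetR_mult smooth_rules)
    thus ?thesis by (simp add: jetR_RicC)
  qed
  hence "0 = (\<Sum>j\<in>UNIV. \<Sum>k\<in>UNIV. (\<Sum>a\<in>UNIV. \<Sum>b\<in>UNIV. jetR (Ki a b) * jetR (RmC a j k b)) * (Y $ j * Z $
      k))"
    by simp
  also have "\<dots> = Rm (jetV L) Y Z (jetV Lc) + Rm (jetV Lc) Y Z (jetV L) + Rm (jetV M) Y Z (jetV Mc)
      + Rm (jetV Mc) Y Z (jetV M)"
    unfolding 1 jetR_Ki
    by (simp add: sum_distrib_right sum.distrib distrib_right mult.assoc)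
  finally show "Rm (jetV L) Y Z (jetV Lc) + Rm (jetV Lc) Y Z (jetV L) + Rm (jetV M) Y Z (jetV Mc)
      + Rm (jetV Mc) Y Z (jetV M) = 0"
    by simp
qed

end

section \<open>Reduction to the unperturbed metric\<close>

context tetrad_perturbation
begin

text \<open>The divisions in \<open>weyl_comp\<close> are written as products with constants, so
  that the product rules for smoothness and germs apply.\<close>

definition WC :: "4 \<Rightarrow> 4 \<Rightarrow> 4 \<Rightarrow> 4 \<Rightarrow> real \<times> (real^4) \<Rightarrow> real" where
  "WC i j k t p = RmC i j k t p
     - (gs p $ i $ t * RicC j k p - gs p $ i $ k * RicC j t p
        + gs p $ j $ k * RicC i t p - gs p $ j $ t * RicC i k p) * (1/2)
     + (\<Sum>a\<in>UNIV. \<Sum>b\<in>UNIV. Ki a b p * RicC a b p) * ((gs p $ i $ t * gs p $ j $ k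
         - gs p $ i $ k * gs p $ j $ t) * (1/6))"

lemma weyl_comp_eq: "(s, y) \<in> \<Omega> \<Longrightarrow> weyl_comp (perturbed g h s) y i j k t = WC i j k t (s, y)"
  by (simp add: weyl_comp_def WC_def riemann_comp_eq ricci_eq scalar_curvature_def)
    (simp add: perturbed_eq Ki_def)

lemma smooth_WC: "smooth_on \<Omega> (WC i j k t)"
  unfolding WC_def[abs_def]
  by (intro smooth_on_sum smooth_on_mult smooth_on_add smooth_on_diff smooth_gs smooth_Ki smooth_RmC
      smooth_RicC
    open_\<Omega> smooth_on_const)

definition weylC where
  "weylC u v w z p = (\<Sum>i\<in>UNIV. \<Sum>j\<in>UNIV. \<Sum>k\<in>UNIV. \<Sum>t\<in>UNIV.
     complex_of_real (WC i j k t p) * u p $ i * v p $ j * w p $ k * z p $ t)"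

lemma weyl_eq: "(s, y) \<in> \<Omega> \<Longrightarrow>
    weyl (perturbed g h s) y (u (s, y)) (v (s, y)) (w (s, y)) (z (s, y)) = weylC u v w z (s, y)"
  by (simp add: weyl_def weylC_def weyl_comp_eq)

lemma smooth_weylC:
  assumes "\<And>i. smooth_on \<Omega> (\<lambda>p. u p $ i)" "\<And>i. smooth_on \<Omega> (\<lambda>p. v p $ i)"
    "\<And>i. smooth_on \<Omega> (\<lambda>p. w p $ i)" "\<And>i. smooth_on \<Omega> (\<lambda>p. z p $ i)"
  shows "smooth_on \<Omega> (weylC u v w z)"
  unfolding weylC_def[abs_def] 
  by (intro smooth_on_sum smooth_on_mult smooth_on_of_real smooth_WC assms open_\<Omega>)

end

text \<open>\<open>base_rep x r f\<close> says that the germ \<open>r\<close> reduces to \<open>f\<close> at \<open>s = 0\<close>.\<close>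

definition base_rep :: "real^4 \<Rightarrow> dual_germ \<Rightarrow> (real^4 \<Rightarrow> complex) \<Rightarrow> bool" where
  "base_rep x r f \<longleftrightarrow> smooth_at x f \<and> eps x * r = eps x * jet x (\<lambda>p. f (snd p))"

lemma base_rep_jet: "smooth_at (0, x) F \<Longrightarrow> base_rep x (jet x F) (\<lambda>y. F (0, y))"
  unfolding base_rep_def
  by (subst eps_mult_jet_eq_iff) (auto intro: smooth_at_slice smooth_at_base[OF smooth_at_slice])

lemma base_rep_unique:
  assumes "base_rep x r f" "base_rep x r' f'" "eps x * r = eps x * r'"
  shows "\<forall>\<^sub>F y in nhds x. f y = f' y"
  using assms eps_mult_jet_eq_iff[of x "\<lambda>p. f (snd p)" "\<lambda>p. f' (snd p)"]
  by (simp add: base_rep_def smooth_at_base)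

lemma base_rep_zero: "base_rep x r f \<Longrightarrow> eps x * r = 0 \<Longrightarrow> f x = 0"
  using eps_mult_jet_eq_0_iff[of x "\<lambda>p. f (snd p)"] eventually_nhds_x_imp_x[of "\<lambda>y. f y = 0" x]
  by (simp add: base_rep_def smooth_at_base)

lemma base_rep_cong: "base_rep x r f \<Longrightarrow> \<forall>\<^sub>F y in nhds x. f y = f' y \<Longrightarrow> base_rep x r f'"
proof -
  assume f: "base_rep x r f" and e: "\<forall>\<^sub>F y in nhds x. f y = f' y"
  have f': "smooth_at x f'" using f e by (auto simp: base_rep_def intro: smooth_at_cong)
  have "eps x * jet x (\<lambda>p. f (snd p)) = eps x * jet x (\<lambda>p. f' (snd p))"
    using f e f' by (subst eps_mult_jet_eq_iff) (auto simp: base_rep_def smooth_at_base)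
  thus ?thesis using f f' by (simp add: base_rep_def)
qed

lemma base_rep_const: "base_rep x (jet x (\<lambda>_. c)) (\<lambda>_. c)"
  by (simp add: base_rep_def smooth_at_const)

lemma base_rep_numeral: "base_rep x (numeral k) (\<lambda>_. numeral k)"
  using base_rep_const[of x "numeral k"] by simp

lemma base_rep_0: "base_rep x 0 (\<lambda>_. 0)"
  using base_rep_const[of x 0] by simp

lemma base_rep_add: "base_rep x r f \<Longrightarrow> base_rep x r' f' \<Longrightarrow> base_rep x (r + r') (\<lambda>y. f y + f' y)"
  by (simp add: base_rep_def smooth_at_add jet_add smooth_at_base distrib_left)

lemma base_rep_minus: "base_rep x r f \<Longrightarrow> base_rep x (- r) (\<lambda>y. - f y)"
  by (simp add: base_rep_def smooth_at_minus jet_minus smooth_at_base)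

lemma base_rep_diff: "base_rep x r f \<Longrightarrow> base_rep x r' f' \<Longrightarrow> base_rep x (r - r') (\<lambda>y. f y - f' y)"
  using base_rep_add[of x r f "- r'" "\<lambda>y. - f' y"] base_rep_minus by simp

lemma base_rep_mult: "base_rep x r f \<Longrightarrow> base_rep x r' f' \<Longrightarrow> base_rep x (r * r') (\<lambda>y. f y * f' y)"
  by (simp add: base_rep_def smooth_at_mult jet_mult smooth_at_base) (metis mult.assoc mult.commute)

lemma base_rep_sum: "(\<And>i. i \<in> I \<Longrightarrow> base_rep x (r i) (f i)) \<Longrightarrow> base_rep x (\<Sum>i\<in>I. r i) (\<lambda>y. \<Sum>i\<in>I. f i y)"
  by (induction I rule: infinite_finite_induct) (simp_all add: base_rep_0 base_rep_add)

text \<open>\<open>eps\<close> is a constant for the derivations, so reduction to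
  \<open>s = 0\<close> commutes with spatial derivatives.\<close>

lemma base_rep_deriv:
  assumes "base_rep x r f" shows "base_rep x (dual_deriv i r) (partial i f)"
proof -
  have f: "smooth_at x f" and e: "eps x * r = eps x * jet x (\<lambda>p. f (snd p))" using assms
      by (auto simp: base_rep_def)
  have d: "smooth_at x (partial i f)" unfolding partial_eq_ddir by (intro smooth_at_ddir f)
      (simp add: axis_in_Basis_iff)
  have "eps x * dual_deriv i r = dual_deriv i (eps x * r)" by (simp add: dual_deriv_mult dual_deriv_eps)
  also have "\<dots> = eps x * jet x (dx i (\<lambda>p. f (snd p)))"
    unfolding e by (simp add: dual_deriv_mult dual_deriv_eps dual_deriv_jet smooth_at_base f)
  also have "\<dots> = eps x * jet x (\<lambda>p. partial i f (snd p))"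
  proof (subst eps_mult_jet_eq_iff)
    show "\<forall>\<^sub>F y in nhds x. dx i (\<lambda>p. f (snd p)) (0, y) = partial i f (snd (0::real, y))"
      using smooth_at_eventually[OF f] by eventually_elim (simp add: ddir_base partial_eq_ddir)
  qed (auto intro!: smooth_at_ddir smooth_at_base f d)
  finally show ?thesis using d by (simp add: base_rep_def)
qed

context tetrad_perturbation_at
begin

text \<open>All terms by which Weyl and Riemann components differ contain the Ricci germ, which is
  zero.\<close>

lemma jetR_WC: "jetR (WC i j k t) = jetR (RmC i j k t)"
  unfolding WC_def[abs_def]
  by (simp add: jetR_sum jetR_add jetR_diff jetR_mult jetR_RicC smooth_rules smooth_on_const del:
      mult_1_right times_divide_eq_right)

lemma jet_weylC:
  assumes "\<And>i. smooth_on \<Omega> (\<lambda>p. u p $ i)" "\<And>i. smooth_on \<Omega> (\<lambda>p. v p $ i)"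
    "\<And>i. smooth_on \<Omega> (\<lambda>p. w p $ i)" "\<And>i. smooth_on \<Omega> (\<lambda>p. z p $ i)"
  shows "jet x (weylC u v w z) = Rm (jetV u) (jetV v) (jetV w) (jetV z)"
  unfolding weylC_def[abs_def] Rm_expand[of "jetV u"] Rm_jet jetR_WC[symmetric] 
  unfolding jetR_def jetV_def
  by (simp add: jet_sum jet_mult smooth_at_\<Omega> smooth_rules smooth_on_of_real smooth_WC assms)

definition base_repV :: "dual_germ^4 \<Rightarrow> (real^4 \<Rightarrow> complex^4) \<Rightarrow> bool" where
  "base_repV X u \<longleftrightarrow> (\<forall>i. base_rep x (X $ i) (\<lambda>y. u y $ i))"

lemma base_rep_ac: "base_repV X u \<Longrightarrow> base_rep x r f \<Longrightarrow> base_rep x (ac X r) (deriv_along u f)"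
  unfolding ac_def deriv_along_def[abs_def] base_repV_def
  by (intro base_rep_sum base_rep_mult base_rep_deriv) auto

lemma base_rep_jetR: "smooth_on \<Omega> f \<Longrightarrow> base_rep x (jetR f) (\<lambda>y. complex_of_real (f (0, y)))"
  unfolding jetR_def by (rule base_rep_jet) (rule smooth_at_jetR)

lemma perturbed_0 [simp]: "perturbed g h 0 = g"
  by (simp add: perturbed_def)

text \<open>At \<open>s = 0\<close> the symbols \<open>Chr\<close> are the Christoffel symbols of
  \<open>g\<close>. Ring coefficients thus reduce to contractions of \<open>conn\<close>, the
  quantity in the definition of the spin coefficients.\<close>

lemma base_rep_conn:
  assumes Z: "base_repV Z z" and X: "base_repV X u" and Y: "base_repV Y v"
  shows "base_rep x (ip Z (nb X Y)) (\<lambda>y. \<Sum>b\<in>UNIV. u y $ b * conn g z v b y)"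
proof -
  have n: "base_rep x (nb X Y $ a) (\<lambda>y. \<Sum>b\<in>UNIV. u y $ b * (partial b (\<lambda>y. v y $ a) y +
      (\<Sum>c\<in>UNIV. complex_of_real (Chr a b c (0, y)) * v y $ c)))" for a
    using X Y unfolding nb_def base_repV_def vec_lambda_beta
    by (intro base_rep_sum base_rep_mult base_rep_add base_rep_deriv base_rep_jetR smooth_Chr) auto
  have "base_rep x (ip Z (nb X Y)) (\<lambda>y. \<Sum>i\<in>UNIV. \<Sum>j\<in>UNIV. complex_of_real (gs (0, y) $ i $ j) * z y $ i
      *
      (\<Sum>b\<in>UNIV. u y $ b * (partial b (\<lambda>y. v y $ j) y +
      (\<Sum>c\<in>UNIV. complex_of_real (Chr j b c (0, y)) * v y $ c))))"
    using Z unfolding ip_def base_repV_def by (intro base_rep_sum base_rep_mult base_rep_jetR smooth_gs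
        n) auto
  moreover have "(\<Sum>i\<in>UNIV. \<Sum>j\<in>UNIV. complex_of_real (gs (0, y) $ i $ j) * z y $ i *
      (\<Sum>b\<in>UNIV. u y $ b * (partial b (\<lambda>y. v y $ j) y +
      (\<Sum>c\<in>UNIV. complex_of_real (Chr j b c (0, y)) * v y $ c)))) = (\<Sum>b\<in>UNIV. u y $ b * conn g z v b y)"
    if y: "y \<in> U" for y
  proof -
    have axis_mult: "(\<Sum>c\<in>UNIV. axis k (1::complex) $ c * f c) = f k" for f :: "4 \<Rightarrow> complex" and k
      by (simp add: axis_def if_distrib[of "\<lambda>x. x * _"] cong: if_cong)
    have "gs (0, y) = g y" by (simp add: gs_def)
    moreover have "christoffel g k i j y = Chr k i j (0, y)" for i j k
      using christoffel_eq[OF U_\<Omega>[OF y], of k i j] by simp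
    ultimately have "conn g z v b y = (\<Sum>i\<in>UNIV. \<Sum>j\<in>UNIV. complex_of_real (gs (0, y) $ i $ j) * z y $ i *
       (partial b (\<lambda>y. v y $ j) y + (\<Sum>c\<in>UNIV. complex_of_real (Chr j b c (0, y)) * v y $ c)))" for b
      by (simp add: conn_def inner_g_def nabla_def coord_field_def axis_mult)
    hence "(\<Sum>b\<in>UNIV. u y $ b * conn g z v b y) = (\<Sum>b\<in>UNIV. \<Sum>i\<in>UNIV. \<Sum>j\<in>UNIV. complex_of_real
        (gs (0, y) $ i $ j) * z y $ i *
       (u y $ b * (partial b (\<lambda>y. v y $ j) y + (\<Sum>c\<in>UNIV. complex_of_real (Chr j b c (0, y)) * v y $
           c))))"
      by (simp add: sum_distrib_left mult.left_commute[of "u y $ _"])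
    also have "\<dots> = (\<Sum>i\<in>UNIV. \<Sum>j\<in>UNIV. \<Sum>b\<in>UNIV. complex_of_real (gs (0, y) $ i $ j) * z y $ i *
       (u y $ b * (partial b (\<lambda>y. v y $ j) y + (\<Sum>c\<in>UNIV. complex_of_real (Chr j b c (0, y)) * v y $
           c))))"
      by (rule trans[OF sum.swap], rule sum.cong[OF refl], rule sum.swap)
    finally show ?thesis by (simp add: sum_distrib_left)
  qed
  ultimately show ?thesis
    by (elim base_rep_cong) (use eventually_U in \<open>auto elim!: eventually_mono\<close>)
qed

end

section \<open>The perturbation equation at a point\<close>

context tetrad_perturbation_at
begin

lemma teukolsky_at:
  fixes l m :: "real^4 \<Rightarrow> complex^4"
  assumes l: "\<And>y. y \<in> U \<Longrightarrow> l y = L (0, y)" and m: "\<And>y. y \<in> U \<Longrightarrow> m y = M (0, y)"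
    and Psi0: "\<And>y. y \<in> U \<Longrightarrow> Psi0 g l m y = 0" and Psi1: "\<And>y. y \<in> U \<Longrightarrow> Psi1 g l m y = 0"
    and Psi2: "\<And>y. y \<in> U \<Longrightarrow> Psi2 g l m y \<noteq> 0"
    and spin: "spin_coefficients g l m U \<gamma> \<epsilon> \<alpha> \<beta> \<nu> \<pi> lam \<mu> \<tau> \<kappa> \<rho> \<sigma>
           \<gamma>t \<epsilon>t \<alpha>t \<beta>t \<nu>t \<pi>t lamt \<mu>t \<tau>t \<kappa>t \<rho>t \<sigma>t"
  defines "\<psi> \<equiv> Psi0_dot g h (\<lambda>s y. L (s, y)) (\<lambda>s y. M (s, y))"
  shows "(deriv_along l \<boxplus> (\<lambda>y. - 3 * \<epsilon> y + \<epsilon>t y - \<rho>t y - 4 * \<rho> y))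
        ((deriv_along (\<lambda>x. conj_vec (l x)) \<boxplus> (\<lambda>y. - 4 * \<gamma> y + \<mu> y)) \<psi>) x
     - (deriv_along m \<boxplus> (\<lambda>y. - \<alpha>t y - 3 * \<beta> y + \<pi>t y - 4 * \<tau> y))
        ((deriv_along (\<lambda>x. - conj_vec (m x)) \<boxplus> (\<lambda>y. - 4 * \<alpha> y + \<pi> y)) \<psi>) x
     - 3 * Psi2 g l m x * \<psi> x = 0"
proof -
  let ?l = "jetV L" and ?n = "jetV Lc" and ?m = "jetV M" and ?k = "jetV Mc"
  let ?lb = "\<lambda>y. conj_vec (l y)" and ?mb = "\<lambda>y. conj_vec (m y)"
  note frame_smooth = smooth_frame[THEN smooth_at_\<Omega>]
  have rep_l: "base_repV ?l l" and rep_m: "base_repV ?m m" and rep_n: "base_repV ?n ?lb" and rep_k: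
      "base_repV ?k ?mb"
    unfolding base_repV_def jetV_def vec_lambda_beta
    by (intro allI base_rep_cong[OF base_rep_jet[OF frame_smooth(1)]] base_rep_cong[OF base_rep_jet[OF
        frame_smooth(2)]]
        base_rep_cong[OF base_rep_jet[OF frame_smooth(3)]] base_rep_cong[OF base_rep_jet[OF
            frame_smooth(4)]]
        eventually_mono[OF eventually_U], simp add: l m)+

  \<comment> \<open>\<open>c u v w\<close> is the contraction of \<open>u^a \<nabla>_b v_a\<close>
    with \<open>w^b\<close>. Taking a tetrad vector for \<open>w\<close> isolates one spin
    coefficient in each defining expansion.\<close>
  define c where "c = (\<lambda>u v w y. \<Sum>b\<in>UNIV. w y $ b * conn g u v b y)"
  have rep_c: "base_rep x (ip Z (nb X Y)) (c z v u)" if "base_repV Z z" "base_repV Y v" "base_repV X u"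
      for Z z Y v X u
    unfolding c_def by (rule base_rep_conn[OF that(1,3,2)])
  have tet: "tetrad_at (g y) (l y) (m y)" and gsym: "transpose (g y) = g y" if "y \<in> U" for y
    using tetrad_gs[OF U_\<Omega>[OF that]] gs_transpose[OF U_\<Omega>[OF that]] that by (simp_all add: gs_def l m)
  have lower: "(\<Sum>b\<in>UNIV. w $ b * lower G u $ b) = inner_g G u w" for G u and w :: "complex^4"
    unfolding lower_def inner_g_def
    by (simp add: sum_distrib_left) (subst sum.swap, simp add: ac_simps)
  have pair: "(\<Sum>b\<in>UNIV. w $ b * (p * lower G u1 $ b + q * lower G u2 $ b + r * lower G u3 $ b
      + s * lower G u4 $ b))
     = p * inner_g G u1 w + q * inner_g G u2 w + r * inner_g G u3 w + s * inner_g G u4 w"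
         for G u1 u2 u3 u4 and w :: "complex^4" and p q r s
    by (simp add: lower[symmetric] sum_distrib_left distrib_left sum.distrib mult.left_commute)
  have inner: "inner_g (g y) (l y) (l y) = 0" "inner_g (g y) (l y) (?lb y) = 1"
      "inner_g (g y) (l y) (m y) = 0" "inner_g (g y) (l y) (?mb y) = 0"
    "inner_g (g y) (?lb y) (l y) = 1" "inner_g (g y) (?lb y) (?lb y) = 0" "inner_g (g y) (?lb y) (m y)
        = 0" "inner_g (g y) (?lb y) (?mb y) = 0"
    "inner_g (g y) (m y) (l y) = 0" "inner_g (g y) (m y) (?lb y) = 0" "inner_g (g y) (m y) (m y) = 0"
        "inner_g (g y) (m y) (?mb y) = 1"
    "inner_g (g y) (?mb y) (l y) = 0" "inner_g (g y) (?mb y) (?lb y) = 0" "inner_g (g y) (?mb y) (m y)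
        = 1" "inner_g (g y) (?mb y) (?mb y) = 0"
    if "y \<in> U" for y
    using tet[OF that] gsym[OF that] unfolding tetrad_at_def
    by (simp_all add: inner_g_sym[of "g y" "?lb y" "l y"] inner_g_sym[of "g y" "m y"
        "l y"] inner_g_sym[of "g y" "m y" "?lb y"]
      inner_g_sym[of "g y" "?mb y" "l y"] inner_g_sym[of "g y" "?mb y" "?lb y"] inner_g_sym[of "g y"
          "?mb y" "m y"])

  have spin': "(c ?lb l w y - c m ?mb w y) / 2 = \<gamma> y * inner_g (g y) (l y) (w y)
      + \<epsilon> y * inner_g (g y) (?lb y) (w y)
        - \<alpha> y * inner_g (g y) (m y) (w y) + \<beta> y * inner_g (g y) (?mb y) (w y)"
    "c ?lb ?mb w y = - \<nu> y * inner_g (g y) (l y) (w y) - \<pi> y * inner_g (g y) (?lb y) (w y)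
        + lam y * inner_g (g y) (m y) (w y) - \<mu> y * inner_g (g y) (?mb y) (w y)"
    "c m l w y = \<tau> y * inner_g (g y) (l y) (w y) + \<kappa> y * inner_g (g y) (?lb y) (w y)
        - \<rho> y * inner_g (g y) (m y) (w y) + \<sigma> y * inner_g (g y) (?mb y) (w y)"
    "(c ?lb l w y - c ?mb m w y) / 2 = \<gamma>t y * inner_g (g y) (l y) (w y) + \<epsilon>t y * inner_g (g y) (?lb y)
        (w y)
        - \<beta>t y * inner_g (g y) (m y) (w y) + \<alpha>t y * inner_g (g y) (?mb y) (w y)"
    "c ?lb m w y = \<nu>t y * inner_g (g y) (l y) (w y) + \<pi>t y * inner_g (g y) (?lb y) (w y)
        - \<mu>t y * inner_g (g y) (m y) (w y) + lamt y * inner_g (g y) (?mb y) (w y)"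
    "c ?mb l w y = - \<tau>t y * inner_g (g y) (l y) (w y) - \<kappa>t y * inner_g (g y) (?lb y) (w y)
        + \<sigma>t y * inner_g (g y) (m y) (w y) - \<rho>t y * inner_g (g y) (?mb y) (w y)"
    if "y \<in> U" for y w
  proof -
    note sp = spin[unfolded spin_coefficients_def Let_def, rule_format, OF that]
    have half: "(c u v w y - c u' v' w y) / 2 = (\<Sum>b\<in>UNIV. w y $ b * ((conn g u v b y - conn g u' v' b y)
        / 2))" for u v u' v'
      by (simp add: c_def sum_subtractf[symmetric] sum_divide_distrib algebra_simps)
    show "(c ?lb l w y - c m ?mb w y) / 2 = \<gamma> y * inner_g (g y) (l y) (w y)
        + \<epsilon> y * inner_g (g y) (?lb y) (w y)
        - \<alpha> y * inner_g (g y) (m y) (w y) + \<beta> y * inner_g (g y) (?mb y) (w y)"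
      unfolding half conjunct1[OF sp] pair by simp
    show "c ?lb ?mb w y = - \<nu> y * inner_g (g y) (l y) (w y) - \<pi> y * inner_g (g y) (?lb y) (w y)
        + lam y * inner_g (g y) (m y) (w y) - \<mu> y * inner_g (g y) (?mb y) (w y)"
      unfolding c_def sp[THEN conjunct2, THEN conjunct1] pair by simp
    show "c m l w y = \<tau> y * inner_g (g y) (l y) (w y) + \<kappa> y * inner_g (g y) (?lb y) (w y)
        - \<rho> y * inner_g (g y) (m y) (w y) + \<sigma> y * inner_g (g y) (?mb y) (w y)"
      unfolding c_def sp[THEN conjunct2, THEN conjunct2, THEN conjunct1] pair by simp
    show "(c ?lb l w y - c ?mb m w y) / 2 = \<gamma>t y * inner_g (g y) (l y) (w y)
        + \<epsilon>t y * inner_g (g y) (?lb y) (w y)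
        - \<beta>t y * inner_g (g y) (m y) (w y) + \<alpha>t y * inner_g (g y) (?mb y) (w y)"
      unfolding half sp[THEN conjunct2, THEN conjunct2, THEN conjunct2, THEN conjunct1] pair by simp
    show "c ?lb m w y = \<nu>t y * inner_g (g y) (l y) (w y) + \<pi>t y * inner_g (g y) (?lb y) (w y)
        - \<mu>t y * inner_g (g y) (m y) (w y) + lamt y * inner_g (g y) (?mb y) (w y)"
      unfolding c_def sp[THEN conjunct2, THEN conjunct2, THEN conjunct2, THEN conjunct2, THEN conjunct1]
          pair by simp
    show "c ?mb l w y = - \<tau>t y * inner_g (g y) (l y) (w y) - \<kappa>t y * inner_g (g y) (?lb y) (w y)
        + \<sigma>t y * inner_g (g y) (m y) (w y) - \<rho>t y * inner_g (g y) (?mb y) (w y)"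
      unfolding c_def sp[THEN conjunct2, THEN conjunct2, THEN conjunct2, THEN conjunct2, THEN conjunct2]
          pair by simp
  qed

  \<comment> \<open>The product rule for \<open>g(m, conj m) = 1\<close> is read off from the ring
    identity \<open>ip_nb_const\<close>.\<close>
  have anti: "\<forall>\<^sub>F y in nhds x. c m ?mb w y = - c ?mb m w y" if "base_repV X w" for X w
  proof (rule base_rep_unique)
    show "base_rep x (ip ?m (nb X ?k)) (c m ?mb w)" by (rule rep_c[OF rep_m rep_k that])
    show "base_rep x (- ip ?k (nb X ?m)) (\<lambda>y. - c ?mb m w y)" by (intro base_rep_minus rep_c[OF rep_k
        rep_m that])
    show "eps x * ip ?m (nb X ?k) = eps x * - ip ?k (nb X ?m)"
      by (subst ip_nb_const) (simp_all add: ip_frame)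
  qed
  \<comment> \<open>By \<open>anti\<close> the two halved expressions are
    \<open>(cnl + ckm) / 2\<close> and \<open>(cnl - ckm) / 2\<close>, whose sum and difference
    recover \<open>cnl\<close> and \<open>ckm\<close>.\<close>
  have rep_cnl: "base_rep x (cnl X) (\<lambda>y. f y + f' y)" and rep_ckm: "base_rep x (ckm X) (\<lambda>y. f y - f' y)"
    if X: "base_repV X w"
     and ff': "\<And>y. y \<in> U \<Longrightarrow> (c ?lb l w y - c m ?mb w y) / 2 = f y \<and> (c ?lb l w y - c ?mb m w y) / 2
         = f' y" for X w f f'
  proof -
    have "\<forall>\<^sub>F y in nhds x. c ?lb l w y = f y + f' y \<and> c ?mb m w y = f y - f' y"
      using anti[OF X] eventually_U by eventually_elim (auto simp: ff'[THEN conjunct1, symmetric]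
          ff'[THEN conjunct2, symmetric] field_simps)
    hence ev: "\<forall>\<^sub>F y in nhds x. c ?lb l w y = f y + f' y" "\<forall>\<^sub>F y in nhds x. c ?mb m w y = f y - f' y"
      by (auto elim: eventually_mono)
    show "base_rep x (cnl X) (\<lambda>y. f y + f' y)"
      unfolding cnl_def by (rule base_rep_cong[OF rep_c[OF rep_n rep_l X] ev(1)])
    show "base_rep x (ckm X) (\<lambda>y. f y - f' y)"
      unfolding ckm_def by (rule base_rep_cong[OF rep_c[OF rep_k rep_m X] ev(2)])
  qed
  have rep_eq: "base_rep x (ip Z (nb X Y)) f" if "base_repV Z z" "base_repV Y v" "base_repV X u" 
      "\<And>y. y \<in> U \<Longrightarrow> c z v u y = f y" for Z z Y v X u f
    by (rule base_rep_cong[OF rep_c[OF that(1-3)] eventually_mono[OF eventually_U that(4)]])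

  have "base_rep x (cnl ?l) (\<lambda>y. \<epsilon> y + \<epsilon>t y)" "base_rep x (ckm ?l) (\<lambda>y. \<epsilon> y - \<epsilon>t y)"
    "base_rep x (cnl ?n) (\<lambda>y. \<gamma> y + \<gamma>t y)" "base_rep x (ckm ?n) (\<lambda>y. \<gamma> y - \<gamma>t y)"
    "base_rep x (cnl ?m) (\<lambda>y. \<beta> y + \<alpha>t y)" "base_rep x (ckm ?m) (\<lambda>y. \<beta> y - \<alpha>t y)"
    "base_rep x (cnl ?k) (\<lambda>y. - \<alpha> y + - \<beta>t y)" "base_rep x (ckm ?k) (\<lambda>y. - \<alpha> y - - \<beta>t y)"
    by (intro rep_cnl[OF rep_l] rep_cnl[OF rep_n] rep_cnl[OF rep_m] rep_cnl[OF rep_k]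
        rep_ckm[OF rep_l] rep_ckm[OF rep_n] rep_ckm[OF rep_m] rep_ckm[OF rep_k]; simp add: spin'(1,4)
            inner)+
  moreover have "base_rep x (cml ?k) (\<lambda>y. - \<rho> y)" "base_rep x (cml ?n) \<tau>" "base_rep x (ckl ?m) (\<lambda>y.
      - \<rho>t y)"
    "base_rep x (cnk ?m) (\<lambda>y. - \<mu> y)" "base_rep x (cnk ?l) (\<lambda>y. - \<pi> y)" "base_rep x (cnm ?l) \<pi>t"
    unfolding cml_def ckl_def cnk_def cnm_def
    by (intro rep_eq[OF rep_m rep_l rep_k] rep_eq[OF rep_m rep_l rep_n] rep_eq[OF rep_k rep_l rep_m]
      rep_eq[OF rep_n rep_k rep_m] rep_eq[OF rep_n rep_k rep_l] rep_eq[OF rep_n rep_m rep_l]; simp add: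
          spin'(2,3,5,6) inner)+
  ultimately have coeffs: "base_rep x (cnl ?l) (\<lambda>y. \<epsilon> y + \<epsilon>t y)" "base_rep x (ckm ?l) (\<lambda>y. \<epsilon> y - \<epsilon>t y)"
    "base_rep x (cnl ?n) (\<lambda>y. \<gamma> y + \<gamma>t y)" "base_rep x (ckm ?n) (\<lambda>y. \<gamma> y - \<gamma>t y)"
    "base_rep x (cnl ?m) (\<lambda>y. \<beta> y + \<alpha>t y)" "base_rep x (ckm ?m) (\<lambda>y. \<beta> y - \<alpha>t y)"
    "base_rep x (cnl ?k) (\<lambda>y. - \<alpha> y + - \<beta>t y)" "base_rep x (ckm ?k) (\<lambda>y. - \<alpha> y - - \<beta>t y)"
    "base_rep x (cml ?k) (\<lambda>y. - \<rho> y)" "base_rep x (cml ?n) \<tau>" "base_rep x (ckl ?m) (\<lambda>y. - \<rho>t y)"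
    "base_rep x (cnk ?m) (\<lambda>y. - \<mu> y)" "base_rep x (cnk ?l) (\<lambda>y. - \<pi> y)" "base_rep x (cnm ?l) \<pi>t" .

  define F where "F = (\<lambda>p. - weylC L M L M p)"
  have smooth_F: "smooth_on \<Omega> F"
    unfolding F_def by (intro smooth_on_minus smooth_weylC smooth_frame)
  have \<psi>: "\<psi> y = ds F (0, y)" if "y \<in> U" for y
    unfolding \<psi>_def Psi0_dot_def
    by (rule vector_derivative_at, rule has_vector_derivative_ds_cong[OF smooth_F that])
      (simp add: Psi0_def F_def weyl_eq)
  have weyl_U: "weyl g y (u (0, y)) (v (0, y)) (w (0, y)) (z (0, y)) = weylC u v w z (0, y)" if "y \<in> U"
      for u v w z y
    using weyl_eq[OF U_\<Omega>[OF that]] by simp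
  \<comment> \<open>The derivative in \<open>s\<close> is extended constantly in \<open>s\<close>.
    Since \<open>Psi0\<close> vanishes at \<open>s = 0\<close>, its germ is \<open>eps\<close> times
    this one.\<close>
  define \<Psi> where "\<Psi> = jet x (\<lambda>p. ds F (0, snd p))"
  have A0: "A0 = - (eps x * \<Psi>)"
  proof -
    have "\<forall>\<^sub>F y in nhds x. F (0, y) = 0"
      using eventually_U
    proof eventually_elim
      case (elim y)
      show ?case using Psi0[OF elim] weyl_U[OF elim, of L M L M] by (simp add: F_def Psi0_def l m elim)
    qed
    hence "jet x F = eps x * \<Psi>"
      unfolding \<Psi>_def by (intro jet_eps_factor smooth_at_\<Omega> smooth_F)
    moreover have "jet x F = - A0"
      unfolding F_def A0_def by (simp add: jet_minus smooth_at_\<Omega> smooth_weylC jet_weylC smooth_frame)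
    ultimately show ?thesis by (simp add: minus_equation_iff)
  qed
  have rep_\<psi>: "base_rep x \<Psi> \<psi>"
  proof (rule base_rep_cong)
    show "base_rep x \<Psi> (\<lambda>y. ds F (0, y))"
      unfolding \<Psi>_def base_rep_def
      by (simp add: smooth_at_slice smooth_at_ddir smooth_at_\<Omega>[OF smooth_F])
    show "\<forall>\<^sub>F y in nhds x. ds F (0, y) = \<psi> y"
      using eventually_U by (rule eventually_mono) (simp add: \<psi>)
  qed
  have A2: "A2 = jet x (weylC L M Lc Mc)" and A1: "A1 = jet x (weylC L Lc L M)"
    unfolding A1_def A2_def by (simp_all add: jet_weylC smooth_frame)
  have Psi2_eq: "Psi2 g l m y = weylC L M Lc Mc (0, y)" if "y \<in> U" for y
    using weyl_U[OF that, of L M Lc Mc] by (simp add: Psi2_def l m that)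
  have rep_A2: "base_rep x A2 (Psi2 g l m)"
    unfolding A2
    by (rule base_rep_cong[OF base_rep_jet[OF smooth_at_\<Omega>]])
      (auto intro!: smooth_weylC smooth_frame eventually_mono[OF eventually_U] simp: Psi2_eq)
  have A1_eps: "eps x * A1 = 0"
    unfolding A1
  proof (subst eps_mult_jet_eq_0_iff)
    show "\<forall>\<^sub>F y in nhds x. weylC L Lc L M (0, y) = 0"
      using eventually_U
    proof eventually_elim
      case (elim y)
      show ?case using Psi1[OF elim] weyl_U[OF elim, of L Lc L M] by (simp add: Psi1_def l m elim)
    qed
  qed (intro smooth_at_\<Omega> smooth_weylC smooth_frame)
  have eps_eps: "eps x * eps x = 0"
    using eps_mult_jet_eq_0_iff[OF smooth_at_bounded_linear[OF bounded_linear_fst_complex], of x]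
    by (simp add: eps_def)
  have ac_eps: "ac X (eps x) = 0" for X by (simp add: ac_def dual_deriv_eps)
  \<comment> \<open>Under the factor \<open>eps\<close> the hypothesis is an equation between
    functions at \<open>s = 0\<close>, where \<open>Psi2\<close> has no zeros and can be cancelled
    pointwise.\<close>
  have cancel: "eps x * r = 0" if "eps x * (A2 * r) = 0" for r
  proof (rule jet_cases[of x r])
    fix f assume f: "smooth_at (0, x) f" "r = jet x f"
    have W: "smooth_at (0, x) (weylC L M Lc Mc)" by (intro smooth_at_\<Omega> smooth_weylC smooth_frame)
    have "eps x * jet x (\<lambda>p. weylC L M Lc Mc p * f p) = 0"
      using that f W by (simp add: A2 jet_mult)
    hence "\<forall>\<^sub>F y in nhds x. weylC L M Lc Mc (0, y) * f (0, y) = 0"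
      using f W by (simp add: eps_mult_jet_eq_0_iff smooth_at_mult)
    hence "\<forall>\<^sub>F y in nhds x. f (0, y) = 0"
      using eventually_U
    proof eventually_elim
      case (elim y)
      thus ?case using Psi2[of y] by (simp add: Psi2_eq)
    qed
    thus ?thesis using f by (simp add: eps_mult_jet_eq_0_iff)
  qed
  have eps_A0: "eps x * A0 = 0"
    unfolding A0 by (simp add: eps_eps flip: mult.assoc)
  \<comment> \<open>\<open>Q2\<close>, \<open>Q1\<close> and \<open>E\<close> are the expressions of
    \<open>teukolsky\<close> with \<open>\<Psi>\<close> in place of \<open>A0\<close>. Pulling
    \<open>- eps\<close> through the derivations turns that lemma into
    \<open>eps x * E = 0\<close>.\<close>
  define Q2 where "Q2 = ac ?n \<Psi> + (- 2 * (cnl ?n + ckm ?n) - cnk ?m) * \<Psi>"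
  define Q1 where "Q1 = - ac ?k \<Psi> + (2 * (cnl ?k + ckm ?k) - cnk ?l) * \<Psi>"
  define E where "E = ac ?l Q2 + (- cnl ?l - 2 * ckm ?l + ckl ?m + 4 * cml ?k) * Q2
      - (ac ?m Q1 + (- 2 * cnl ?m - ckm ?m + cnm ?l - 4 * cml ?n) * Q1) - 3 * A2 * \<Psi>"
  have "ac ?n A0 + (- 2 * (cnl ?n + ckm ?n) - cnk ?m) * A0 = - (eps x * Q2)"
    "- ac ?k A0 + (2 * (cnl ?k + ckm ?k) - cnk ?l) * A0 = - (eps x * Q1)"
    unfolding A0 Q1_def Q2_def by (simp_all add: ac_mult ac_eps algebra_simps)
  hence "- (eps x * E) = 0"
    using teukolsky[of "eps x", OF ac_eps eps_div dual_germ_numeral_cancel cancel eps_A0 A1_eps]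
    unfolding E_def by (simp add: A0 ac_mult ac_eps) (simp add: algebra_simps)
  hence eps_E: "eps x * E = 0" by simp
  have "base_rep x Q2 (\<lambda>y. deriv_along ?lb \<psi> y + (- 2 * ((\<gamma> y + \<gamma>t y) + (\<gamma> y - \<gamma>t y)) - - \<mu> y) * \<psi> y)"
    unfolding Q2_def
    by (intro base_rep_add base_rep_mult base_rep_diff base_rep_minus base_rep_numeral base_rep_ac rep_n
        rep_\<psi> coeffs)
  hence Q2: "base_rep x Q2 ((deriv_along ?lb \<boxplus> (\<lambda>y. - 4 * \<gamma> y + \<mu> y)) \<psi>)"
    by (rule base_rep_cong) (simp add: plus_scalar_def algebra_simps)
  have "base_rep x Q1 (\<lambda>y. - deriv_along ?mb \<psi> y + (2 * ((- \<alpha> y + - \<beta>t y) + (- \<alpha> y - - \<beta>t y))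
      - - \<pi> y) * \<psi> y)"
    unfolding Q1_def
    by (intro base_rep_add base_rep_mult base_rep_diff base_rep_minus base_rep_numeral base_rep_ac rep_k
        rep_\<psi> coeffs)
  hence Q1: "base_rep x Q1 ((deriv_along (\<lambda>x. - conj_vec (m x)) \<boxplus> (\<lambda>y. - 4 * \<alpha> y + \<pi> y)) \<psi>)"
    by (rule base_rep_cong) (simp add: plus_scalar_def deriv_along_def sum_negf algebra_simps)
  let ?d2 = "(deriv_along ?lb \<boxplus> (\<lambda>y. - 4 * \<gamma> y + \<mu> y)) \<psi>"
  let ?d1 = "(deriv_along (\<lambda>x. - conj_vec (m x)) \<boxplus> (\<lambda>y. - 4 * \<alpha> y + \<pi> y)) \<psi>"
  \<comment> \<open>Here the sums and differences become the stated coefficients: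
    \<open>-(\<epsilon> + \<epsilon>t) - 2 (\<epsilon> - \<epsilon>t) = -3 \<epsilon> +
    \<epsilon>t\<close> and \<open>-2 (\<beta> + \<alpha>t) - (\<beta> - \<alpha>t) = -3 \<beta> -
    \<alpha>t\<close>.\<close>
  have "base_rep x E (\<lambda>y. deriv_along l ?d2 y + (- (\<epsilon> y + \<epsilon>t y) - 2 * (\<epsilon> y - \<epsilon>t y) + - \<rho>t y
      + 4 * - \<rho> y) * ?d2 y
      - (deriv_along m ?d1 y + (- 2 * (\<beta> y + \<alpha>t y) - (\<beta> y - \<alpha>t y) + \<pi>t y - 4 * \<tau> y) * ?d1 y)
      - 3 * Psi2 g l m y * \<psi> y)"
    unfolding E_def
    by (intro base_rep_add base_rep_mult base_rep_diff base_rep_minus base_rep_numeral base_rep_ac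
      rep_l rep_m rep_\<psi> rep_A2 coeffs Q1 Q2)
  from base_rep_zero[OF this eps_E] show ?thesis
    by (simp add: plus_scalar_def[of "deriv_along l"] plus_scalar_def[of "deriv_along m"])
        (simp add: algebra_simps)
qed

end

section \<open>The exchange of \<open>m\<close> and its conjugate\<close>

lemma conj_vec_minus [simp]: "conj_vec (- u) = - conj_vec u"
  by (simp add: conj_vec_def vec_eq_iff)

lemma conj_vec_conj_vec [simp]: "conj_vec (conj_vec u) = u"
  by (simp add: conj_vec_def vec_eq_iff)

lemma bounded_linear_conj_vec: "bounded_linear conj_vec"
  unfolding linear_conv_bounded_linear[symmetric]
  by (rule linearI) (simp_all add: conj_vec_def vec_eq_iff)

lemma inner_g_minus [simp]: "inner_g G (- u) v = - inner_g G u v" "inner_g G u (- v) = - inner_g G u v"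
  by (simp_all add: inner_g_def sum_negf)

lemma lower_minus [simp]: "lower G (- u) $ b = - lower G u $ b"
  by (simp add: lower_def sum_negf)

lemma tetrad_at_swap:
  assumes "tetrad_at G u v" "transpose G = G"
  shows "tetrad_at G u (- conj_vec v)"
  using assms(1) inner_g_sym[OF assms(2), of v "conj_vec v"] by (simp add: tetrad_at_def)

lemma conn_minus_left: "conn g (\<lambda>x. - u x) v b x = - conn g u v b x"
  by (simp add: conn_def)

text \<open>Smoothness of \<open>v\<close> excludes the case in which
  \<open>frechet_derivative\<close> is an unspecified value.\<close>

lemma conn_minus_right:
  assumes "smooth_at x v" shows "conn g u (\<lambda>x. - v x) b x = - conn g u v b x"
proof -
  have "partial b (\<lambda>y. - v y $ a) x = - partial b (\<lambda>y. v y $ a) x" for a b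
    unfolding partial_eq_ddir
    by (rule ddir_linear[OF bounded_linear_minus[OF bounded_linear_ident] smooth_at_differentiable])
      (rule smooth_at_linear[OF bounded_linear_vec_nth assms])
  hence "nabla g X (\<lambda>x. - v x) x = - nabla g X v x" for X
    by (simp add: nabla_def vec_eq_iff sum_negf distrib_left right_diff_distrib sum_subtractf
        sum.distrib)
  thus ?thesis by (simp add: conn_def)
qed

text \<open>Replacing \<open>m\<close> by minus its conjugate turns the last three defining
  equations into the first three. The minus sign matches that in the tilde operator and lets all
  coefficients be exchanged with their signs unchanged.\<close>

lemma spin_coefficients_swap:
  assumes m: "smooth_on S m"
    and "spin_coefficients g l m S \<gamma> \<epsilon> \<alpha> \<beta> \<nu> \<pi> lam \<mu> \<tau> \<kappa> \<rho> \<sigma>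
           \<gamma>t \<epsilon>t \<alpha>t \<beta>t \<nu>t \<pi>t lamt \<mu>t \<tau>t \<kappa>t \<rho>t \<sigma>t"
  shows "spin_coefficients g l (\<lambda>x. - conj_vec (m x)) S \<gamma>t \<epsilon>t \<alpha>t \<beta>t \<nu>t \<pi>t lamt \<mu>t \<tau>t \<kappa>t \<rho>t \<sigma>t
           \<gamma> \<epsilon> \<alpha> \<beta> \<nu> \<pi> lam \<mu> \<tau> \<kappa> \<rho> \<sigma>"
proof -
  have "smooth_at x m" "smooth_at x (\<lambda>x. conj_vec (m x))" if "x \<in> S" for x
    using that m by (auto intro: smooth_atI smooth_on_linear[OF bounded_linear_conj_vec])
  thus ?thesis
    using assms(2) unfolding spin_coefficients_def Let_def
    by (simp add: conn_minus_left conn_minus_right)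
qed

lemma weyl_minus [simp]:
  "weyl g x (- u) v w z = - weyl g x u v w z" "weyl g x u (- v) w z = - weyl g x u v w z"
  "weyl g x u v (- w) z = - weyl g x u v w z" "weyl g x u v w (- z) = - weyl g x u v w z"
  by (simp_all add: weyl_def sum_negf)

theorem theorem3:
  fixes X :: "'a topology" and A :: "'a chart set" and c :: "'a chart"
    and g h :: "'a tensor2" and V :: "'a set"
    and l m :: "'a cvector_field" and ls ms :: "real \<Rightarrow> 'a cvector_field"
    and \<gamma> \<epsilon> \<alpha> \<beta> \<nu> \<pi> lam \<mu> \<tau> \<kappa> \<rho> \<sigma> :: "real^4 \<Rightarrow> complex"
    and \<gamma>t \<epsilon>t \<alpha>t \<beta>t \<nu>t \<pi>t lamt \<mu>t \<tau>t \<kappa>t \<rho>t \<sigma>t :: "real^4 \<Rightarrow> complex"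
  assumes "smooth_four_manifold X A"
    and "riemannian_metric A g" and "ricci_flat A g" and "type_D X A g"
    and "ricci_flat_perturbation A g h"
    and "adapted_tetrad X A g V l m"
    and "tetrad_family X A g h V l m ls ms"
    and "c \<in> A"
    and "spin_coefficients (g c) (l c) (m c) (region c V) \<gamma> \<epsilon> \<alpha> \<beta> \<nu> \<pi> lam \<mu> \<tau> \<kappa> \<rho> \<sigma>
           \<gamma>t \<epsilon>t \<alpha>t \<beta>t \<nu>t \<pi>t lamt \<mu>t \<tau>t \<kappa>t \<rho>t \<sigma>t"
  shows "let D = deriv_along (l c);
             \<Delta> = deriv_along (\<lambda>x. conj_vec (l c x));
             \<delta> = deriv_along (m c);
             \<delta>t = deriv_along (\<lambda>x. - conj_vec (m c x));
             \<psi> = Psi0_dot (g c) (h c) (\<lambda>s. ls s c) (\<lambda>s. ms s c);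
             \<psi>t = Psi0t_dot (g c) (h c) (\<lambda>s. ls s c) (\<lambda>s. ms s c)
         in \<forall>x\<in>region c V.
           (D \<boxplus> (\<lambda>y. - 3 * \<epsilon> y + \<epsilon>t y - \<rho>t y - 4 * \<rho> y)) ((\<Delta> \<boxplus> (\<lambda>y. - 4 * \<gamma> y + \<mu> y)) \<psi>) x
           - (\<delta> \<boxplus> (\<lambda>y. - \<alpha>t y - 3 * \<beta> y + \<pi>t y - 4 * \<tau> y)) ((\<delta>t \<boxplus> (\<lambda>y. - 4 * \<alpha> y + \<pi> y)) \<psi>) x
           - 3 * Psi2 (g c) (l c) (m c) x * \<psi> x = 0 \<and>
           (D \<boxplus> (\<lambda>y. - 3 * \<epsilon>t y + \<epsilon> y - \<rho> y - 4 * \<rho>t y)) ((\<Delta> \<boxplus> (\<lambda>y. - 4 * \<gamma>t y + \<mu>t y)) \<psi>t) x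
           - (\<delta>t \<boxplus> (\<lambda>y. - \<alpha> y - 3 * \<beta>t y + \<pi> y - 4 * \<tau>t y)) ((\<delta> \<boxplus> (\<lambda>y. - 4 * \<alpha>t y + \<pi>t y)) \<psi>t) x
           - 3 * Psi2t (g c) (l c) (m c) x * \<psi>t x = 0"
proof -
  define U where "U = region c V"
  note family = assms(7)[unfolded tetrad_family_def]
  obtain N where N: "{0} \<times> V \<subseteq> N"
    and tetN: "\<forall>s. tetrad X A (\<lambda>c. perturbed (g c) (h c) s) {p. (s, p) \<in> N} (ls s) (ms s)"
    and smooth_ls: "\<forall>c\<in>A. smooth_on {(s, x). x \<in> region c {p. (s, p) \<in> N}} (\<lambda>(s, x). ls s c x)"
    and smooth_ms: "\<forall>c\<in>A. smooth_on {(s, x). x \<in> region c {p. (s, p) \<in> N}} (\<lambda>(s, x). ms s c x)"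
    using conjunct1[OF family] by (elim exE conjE)
  have base: "l c y = ls 0 c y" "m c y = ms 0 c y" if "y \<in> U" for y
    using conjunct2[OF family] \<open>c \<in> A\<close> that by (simp_all add: U_def)
  \<comment> \<open>The slices of this set may vary with \<open>s\<close>; it contains a
    neighbourhood of each \<open>(0, x)\<close> with \<open>x\<close> in \<open>U\<close>, which is
    all that a germ sees.\<close>
  define \<Omega> where "\<Omega> = {(s, x). x \<in> region c {p. (s, p) \<in> N}}"
  define L where "L = (\<lambda>(s, x). ls s c x)"
  define M where "M = (\<lambda>(s, x). ms s c x)"
  have g: "smooth_on (region c UNIV) (g c)" "\<And>y. y \<in> region c UNIV \<Longrightarrow> transpose (g c y) = g c y"
    and h: "smooth_on (region c UNIV) (h c)" "\<And>y. y \<in> region c UNIV \<Longrightarrow> transpose (h c y) = h c y"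
    using assms(2,5) \<open>c \<in> A\<close>
    by (auto simp: riemannian_metric_def ricci_flat_perturbation_def smooth_symmetric_tensor_def)
  have U_UNIV: "y \<in> region c UNIV" if "y \<in> U" for y using that by (auto simp: U_def region_def)
  have \<Omega>_UNIV: "y \<in> region c UNIV" if "(s, y) \<in> \<Omega>" for s y using that by (auto simp: \<Omega>_def region_def)
  have tet: "tetrad_at (perturbed (g c) (h c) s y) (L (s, y)) (M (s, y))" if "(s, y) \<in> \<Omega>" for s y
    using spec[OF tetN, of s] that \<open>c \<in> A\<close> by (auto simp: tetrad_def \<Omega>_def L_def M_def)
  have smooth_m: "smooth_on U (m c)"
    using assms(6) \<open>c \<in> A\<close> by (auto simp: adapted_tetrad_def tetrad_def smooth_cvector_field_def U_def)
  have perturbation: "tetrad_perturbation (g c) (h c) (region c UNIV) U \<Omega> L M"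
  proof
    show "y \<in> U \<Longrightarrow> (0, y) \<in> \<Omega>" for y using N by (auto simp: U_def \<Omega>_def region_def)
    show "open U" using smooth_m by (rule smooth_on_open)
    show "y \<in> U \<Longrightarrow> ricci (g c) y = 0" for y
      using assms(3) \<open>c \<in> A\<close> U_UNIV by (auto simp: ricci_flat_def)
    show "y \<in> U \<Longrightarrow> linearized_ricci (g c) (h c) y = 0" for y
      using assms(5) \<open>c \<in> A\<close> U_UNIV by (auto simp: ricci_flat_perturbation_def)
    show "smooth_on \<Omega> L" "smooth_on \<Omega> M" using smooth_ls smooth_ms \<open>c \<in> A\<close>
        by (simp_all add: \<Omega>_def L_def M_def)
  qed (use g h \<Omega>_UNIV tet in auto)
  interpret P: tetrad_perturbation "g c" "h c" "region c UNIV" U \<Omega> L M by (rule perturbation)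
  have perturbation': "tetrad_perturbation (g c) (h c) (region c UNIV) U \<Omega> L (\<lambda>p. - conj_vec (M p))"
  proof
    show "smooth_on \<Omega> (\<lambda>p. - conj_vec (M p))"
      by (intro smooth_on_minus smooth_on_linear[OF bounded_linear_conj_vec] P.smooth_M)
    show "tetrad_at (perturbed (g c) (h c) s y) (L (s, y)) (- conj_vec (M (s, y)))" if "(s, y) \<in> \<Omega>"
        for s y
      using P.gs_transpose[OF that] by (intro tetrad_at_swap tet[OF that]) (simp add: P.gs_def)
  qed (use P.smooth_g P.smooth_h P.sym_g P.sym_h P.smooth_L P.\<Omega>_U0 P.open_U P.U_\<Omega> P.ricci_0
      P.linearized_ricci_0 in auto)
  have adapted: "Psi0 (g c) (l c) (m c) y = 0" "Psi1 (g c) (l c) (m c) y = 0"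
        "Psi0t (g c) (l c) (m c) y = 0" "Psi1t (g c) (l c) (m c) y = 0"
        "Psi2 (g c) (l c) (m c) y \<noteq> 0" "Psi2t (g c) (l c) (m c) y \<noteq> 0" if "y \<in> U" for y
    using assms(6) \<open>c \<in> A\<close> that by (auto simp: adapted_tetrad_def U_def)
  define m' where "m' = (\<lambda>y. - conj_vec (m c y))"
  \<comment> \<open>\<open>Psi0\<close> and \<open>Psi2\<close> are quadratic in \<open>m\<close>
    and its conjugate, so the sign of \<open>m'\<close> drops out. \<open>Psi1\<close> is linear and
    changes sign, which preserves its vanishing.\<close>
  have swap: "Psi0 (g c) (l c) m' = Psi0t (g c) (l c) (m c)" "Psi2 (g c) (l c) m'
      = Psi2t (g c) (l c) (m c)"
    "Psi1 (g c) (l c) m' = (\<lambda>y. - Psi1t (g c) (l c) (m c) y)"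
    by (auto simp: fun_eq_iff m'_def Psi0_def Psi0t_def Psi1_def Psi1t_def Psi2_def Psi2t_def)
  have dot: "Psi0_dot (g c) (h c) (\<lambda>s y. L (s, y)) (\<lambda>s y. M (s, y)) = Psi0_dot (g c) (h c) (\<lambda>s. ls s c)
      (\<lambda>s. ms s c)"
    "Psi0_dot (g c) (h c) (\<lambda>s y. L (s, y)) (\<lambda>s y. - conj_vec (M (s, y)))
        = Psi0t_dot (g c) (h c) (\<lambda>s. ls s c) (\<lambda>s. ms s c)"
    by (simp_all add: fun_eq_iff Psi0_dot_def Psi0t_dot_def Psi0_def Psi0t_def L_def M_def)
  show ?thesis
    unfolding Let_def U_def[symmetric]
  proof (intro ballI conjI)
    fix x assume x: "x \<in> U"
    interpret P: tetrad_perturbation_at "g c" "h c" "region c UNIV" U \<Omega> L M x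
      using perturbation x by (simp add: tetrad_perturbation_at_def tetrad_perturbation_at_axioms_def)
    \<comment> \<open>For this exchanged family, \<open>deriv_along m'\<close> is the tilde operator
      and minus the conjugate of \<open>m'\<close> is \<open>m\<close>, so the same lemma yields the
      second equation.\<close>
    interpret Q: tetrad_perturbation_at "g c" "h c" "region c UNIV" U \<Omega> L "\<lambda>p. - conj_vec (M p)" x
      using perturbation' x by (simp add: tetrad_perturbation_at_def tetrad_perturbation_at_axioms_def)
    note spin = assms(9)[folded U_def]
    show "(deriv_along (l c) \<boxplus> (\<lambda>y. - 3 * \<epsilon> y + \<epsilon>t y - \<rho>t y - 4 * \<rho> y))
           ((deriv_along (\<lambda>x. conj_vec (l c x)) \<boxplus> (\<lambda>y. - 4 * \<gamma> y + \<mu> y))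
             (Psi0_dot (g c) (h c) (\<lambda>s. ls s c) (\<lambda>s. ms s c))) x
         - (deriv_along (m c) \<boxplus> (\<lambda>y. - \<alpha>t y - 3 * \<beta> y + \<pi>t y - 4 * \<tau> y))
           ((deriv_along (\<lambda>x. - conj_vec (m c x)) \<boxplus> (\<lambda>y. - 4 * \<alpha> y + \<pi> y))
             (Psi0_dot (g c) (h c) (\<lambda>s. ls s c) (\<lambda>s. ms s c))) x
         - 3 * Psi2 (g c) (l c) (m c) x * Psi0_dot (g c) (h c) (\<lambda>s. ls s c) (\<lambda>s. ms s c) x = 0"
      using P.teukolsky_at[OF _ _ _ _ _ spin] unfolding dot
      by (simp add: adapted base L_def M_def)
    have "(deriv_along (l c) \<boxplus> (\<lambda>y. - 3 * \<epsilon>t y + \<epsilon> y - \<rho> y - 4 * \<rho>t y))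
           ((deriv_along (\<lambda>x. conj_vec (l c x)) \<boxplus> (\<lambda>y. - 4 * \<gamma>t y + \<mu>t y))
             (Psi0t_dot (g c) (h c) (\<lambda>s. ls s c) (\<lambda>s. ms s c))) x
         - (deriv_along m' \<boxplus> (\<lambda>y. - \<alpha> y - 3 * \<beta>t y + \<pi> y - 4 * \<tau>t y))
           ((deriv_along (\<lambda>x. - conj_vec (m' x)) \<boxplus> (\<lambda>y. - 4 * \<alpha>t y + \<pi>t y))
             (Psi0t_dot (g c) (h c) (\<lambda>s. ls s c) (\<lambda>s. ms s c))) x
         - 3 * Psi2t (g c) (l c) (m c) x * Psi0t_dot (g c) (h c) (\<lambda>s. ls s c) (\<lambda>s. ms s c) x = 0"
      using Q.teukolsky_at[OF _ _ _ _ _ spin_coefficients_swap[OF smooth_m spin, folded m'_def]]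
          unfolding dot swap
      by (simp add: adapted base L_def M_def m'_def)
    thus "(deriv_along (l c) \<boxplus> (\<lambda>y. - 3 * \<epsilon>t y + \<epsilon> y - \<rho> y - 4 * \<rho>t y))
           ((deriv_along (\<lambda>x. conj_vec (l c x)) \<boxplus> (\<lambda>y. - 4 * \<gamma>t y + \<mu>t y))
             (Psi0t_dot (g c) (h c) (\<lambda>s. ls s c) (\<lambda>s. ms s c))) x
         - (deriv_along (\<lambda>x. - conj_vec (m c x)) \<boxplus> (\<lambda>y. - \<alpha> y - 3 * \<beta>t y + \<pi> y - 4 * \<tau>t y))
           ((deriv_along (m c) \<boxplus> (\<lambda>y. - 4 * \<alpha>t y + \<pi>t y))
             (Psi0t_dot (g c) (h c) (\<lambda>s. ls s c) (\<lambda>s. ms s c))) x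
         - 3 * Psi2t (g c) (l c) (m c) x * Psi0t_dot (g c) (h c) (\<lambda>s. ls s c) (\<lambda>s. ms s c) x = 0"
      by (simp add: m'_def)
  qed
qed

end
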